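(* Let $\Gamma$ be a group, let $E$ be a $\Gamma$-semilattice and let $\mathfrak R$ be a collection of finite covers for $E$ such that $(E,\mathfrak R)$ satisfies conditions (i), (ii) and (iii) of the context. Let $I$ be the ideal of $\mathbb Z[E^\times]$ generated by all elements $e-\bigvee\mathcal R$ with $e\in E^\times$ and $\mathcal R\in\mathfrak R(e)$. Define iteratively $E_0:=E$, $\mathfrak R_0:=\mathfrak R$ and, for all integers $k\ge 0$, $E_{k+1}:=E(E_k,\mathfrak R_k)$ and $\mathfrak R_{k+1}:=\mathfrak R(E_k,\mathfrak R_k)$. Then the canonical projection $\mathbb Z[E^\times]\to\mathbb Z[E^\times]/I$ and the homomorphisms $\mathbb Z[E_{k+1}^\times]\to\mathbb Z[E_k^\times]$ induced by the inclusions $E_{k+1}\hookrightarrow\mathrm{Idem}(\mathbb Z[E_k^\times])$ give rise to a $\Gamma$-equivariant long exact sequence $$\cdots\to\mathbb Z[E_2^\times]\to\mathbb Z[E_1^\times]\to\mathbb Z[E^\times]\to\mathbb Z[E^\times]/I\to 0.$$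
   Context: **Semilattices.** A semilattice is a commutative semigroup $E$ in which every element is idempotent; all semilattices have a zero element $0$ (so $0e=0$ for all $e$). Write $e\le f$ if $ef=e$, and $e\lneq f$ if $e\le f$ and $e\ne f$. Put $E^\times=E\setminus\{0\}$. $\mathbb Z[E^\times]$ is the free $\mathbb Z$-module on $E^\times$ with the bilinear multiplication for which the product of basis elements $e,f$ is $ef$ if $ef\neq0$ in $E$ and $0$ otherwise. $\mathbb Z$-algebras need not be unital. For a $\mathbb Z$-algebra $A$, $\mathrm{Idem}(A)=\{a\in A: a^2=a\}$; a semigroup homomorphism $E\to\mathrm{Idem}(A)$ mapping $0$ to $0$ extends uniquely to a $\mathbb Z$-algebra homomorphism $\mathbb Z[E^\times]\to A$. A $\Gamma$-semilattice is a semilattice with an action $(g,e)\mapsto\tau_g(e)$ of the group $\Gamma$ by semigroup automorphisms; it induces an action on $\mathbb Z[E^\times]$. For finitely many commuting idempotents, $\bigvee_{j\in J}e_j=\sum_{\varnothing\ne J'\subseteq J}(-1)^{|J'|-1}\prod_{j\in J'}e_j$ (zero if $J=\varnothing$); for a finite set $\mathcal R\subseteq E^\times$, $\bigvee\mathcal R:=\bigvee_{f\in\mathcal R}f\in\mathbb Z[E^\times]$. For $x=\sum_{\varepsilon\in E^\times}n_\varepsilon\varepsilon\in\mathbb Z[E^\times]$ let $E(x)=\{\varepsilon\in E^\times:n_\varepsilon\neq0\}$ be its support. **Finite covers.** A finite cover for $e\in E^\times$ is a finite subset $\mathcal R\subseteq E^\times$ such that $f\le e$ for all $f\in\mathcal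 R$, and for every $f'\in E^\times$ with $f'\le e$ there is $f\in\mathcal R$ with $f'f\ne0$. A collection of finite covers $\mathfrak R$ for $E$ assigns to every $e\in E^\times$ a set $\mathfrak R(e)$ of finite covers for $e$. For $d\in E^\times$, $d\cdot\mathcal R=\{df:f\in\mathcal R\}$ and $(d\cdot\mathcal R)^\times=(d\cdot\mathcal R)\cap E^\times$. **Conditions on a pair $(E,\mathfrak R)$.** (i) For $d,e\in E^\times$ with $de\ne0$ and $\mathcal R\in\mathfrak R(e)$: either $de\in(d\cdot\mathcal R)^\times$ or $(d\cdot\mathcal R)^\times\in\mathfrak R(de)$. (ii) For $e\in E^\times$, pairwise distinct $\mathcal R_1,\dots,\mathcal R_r\in\mathfrak R(e)$ and $\varepsilon_i\in E(\bigvee\mathcal R_i)$ ($1\le i\le r$), put $\varepsilon=\prod_{i=1}^r\varepsilon_i$ and $\varepsilon(\check j)=\prod_{i\ne j}\varepsilon_i$ (for $r=1$, $\varepsilon(\check j)=e$). Then for every $1\le j\le r$: if $\varepsilon(\check j)\neq0$, then $\varepsilon\lneq\varepsilon(\check j)$. (iii) For all $g\in\Gamma$ and $e\in E^\times$: $\tau_g(\mathfrak R(e))=\mathfrak R(\tau_g(e))$. **The construction $(E(E,\mathfrak R),\mathfrak R(E,\mathfrak R))$.** Let $(E,\mathfrak R)$ satisfy (i)–(iii). For $e\in E^\times$ and a non-empty finite subset $\mathfrak S_e\subseteq\mathfrak R(e)$ put $e(\mathfrak S_e)=\prod_{\mathcal R\in\mathfrak S_e}(e-\bigvee\mathcal R)\in\mathbb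 Z[E^\times]$. Let $E(E,\mathfrak R)=\{e(\mathfrak S_e): e\in E^\times,\ \varnothing\ne\mathfrak S_e\subseteq\mathfrak R(e)\text{ finite}\}\cup\{0\}\subseteq\mathrm{Idem}(\mathbb Z[E^\times])$, with the multiplication of $\mathbb Z[E^\times]$ and the restriction of the $\Gamma$-action on $\mathbb Z[E^\times]$. For $\tilde{\mathcal R}\in\mathfrak R(e)\setminus\mathfrak S_e$ put $\mathcal R(\mathfrak S_e,\tilde{\mathcal R})=\{e(\mathfrak S_e\cup\{\tilde{\mathcal R}\})\}\cup\{f\cdot e(\mathfrak S_e): f\in\tilde{\mathcal R},\ f\cdot e(\mathfrak S_e)\neq0\}$, and $\mathfrak R(E,\mathfrak R)(e(\mathfrak S_e))=\{\mathcal R(\mathfrak S_e,\tilde{\mathcal R}):\tilde{\mathcal R}\in\mathfrak R(e)\setminus\mathfrak S_e\}$. The pair $(E(E,\mathfrak R),\mathfrak R(E,\mathfrak R))$ is again a $\Gamma$-semilattice with a collection of finite covers satisfying (i)–(iii), so the construction can be iterated. *)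

theory Defs
  imports
    "HOL-Algebra.Free_Abelian_Groups"
    "HOL-Algebra.Group_Action"
    "HOL-Library.FSet"
begin

section \<open>Semilattices with a group action and chosen finite covers\<close>

record ('a, 'g) cov_semilattice = "'a partial_object" +
  sl_mult :: "'a \<Rightarrow> 'a \<Rightarrow> 'a"
  sl_zero :: 'a
  sl_act :: "'g \<Rightarrow> 'a \<Rightarrow> 'a"
  covers :: "'a \<Rightarrow> 'a set set"

definition nz :: "('a, 'g) cov_semilattice \<Rightarrow> 'a set"
  where "nz P = carrier P - {sl_zero P}"

definition sl_le :: "('a, 'g) cov_semilattice \<Rightarrow> 'a \<Rightarrow> 'a \<Rightarrow> bool"
  where "sl_le P e f \<longleftrightarrow> sl_mult P e f = e"

definition is_semilattice :: "('a, 'g) cov_semilattice \<Rightarrow> bool"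
  where "is_semilattice P \<longleftrightarrow>
    sl_zero P \<in> carrier P \<and>
    (\<forall>e\<in>carrier P. \<forall>f\<in>carrier P. sl_mult P e f \<in> carrier P) \<and>
    (\<forall>e\<in>carrier P. \<forall>f\<in>carrier P. \<forall>h\<in>carrier P.
        sl_mult P (sl_mult P e f) h = sl_mult P e (sl_mult P f h)) \<and>
    (\<forall>e\<in>carrier P. \<forall>f\<in>carrier P. sl_mult P e f = sl_mult P f e) \<and>
    (\<forall>e\<in>carrier P. sl_mult P e e = e) \<and>
    (\<forall>e\<in>carrier P. sl_mult P (sl_zero P) e = sl_zero P)"

definition gamma_semilattice :: "('g, 'm) monoid_scheme \<Rightarrow> ('a, 'g) cov_semilattice \<Rightarrow> bool"
  where "gamma_semilattice \<Gamma> P \<longleftrightarrow>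
    is_semilattice P \<and>
    group_action \<Gamma> (carrier P) (sl_act P) \<and>
    (\<forall>g\<in>carrier \<Gamma>. \<forall>e\<in>carrier P. \<forall>f\<in>carrier P.
        sl_act P g (sl_mult P e f) = sl_mult P (sl_act P g e) (sl_act P g f))"


section \<open>Products of finite families in a semigroup\<close>

text \<open>Neither a semilattice nor its integral algebra need have an identity. A non-empty finite
  product is therefore computed by \<^const>\<open>finprod\<close> after adjoining a formal identity \<^term>\<open>None\<close>;
  the value is unspecified for the empty family.\<close>

definition adjoin_one :: "'a set \<Rightarrow> ('a \<Rightarrow> 'a \<Rightarrow> 'a) \<Rightarrow> 'a option monoid"
  where "adjoin_one S m =
    \<lparr>carrier = insert None (Some ` S),
     monoid.mult = (\<lambda>x y. case x of None \<Rightarrow> y | Some a \<Rightarrow>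
       (case y of None \<Rightarrow> Some a | Some b \<Rightarrow> Some (m a b))),
     one = None\<rparr>"

definition nprod :: "'a set \<Rightarrow> ('a \<Rightarrow> 'a \<Rightarrow> 'a) \<Rightarrow> ('i \<Rightarrow> 'a) \<Rightarrow> 'i set \<Rightarrow> 'a"
  where "nprod S m f J = the (finprod (adjoin_one S m) (\<lambda>j. Some (f j)) J)"

abbreviation sl_prod :: "('a, 'g) cov_semilattice \<Rightarrow> ('i \<Rightarrow> 'a) \<Rightarrow> 'i set \<Rightarrow> 'a"
  where "sl_prod P \<equiv> nprod (carrier P) (sl_mult P)"


section \<open>The algebra \<open>\<int>[E\<^sup>\<times>]\<close>\<close>

definition ZE :: "('a, 'g) cov_semilattice \<Rightarrow> ('a \<Rightarrow>\<^sub>0 int) monoid"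
  where "ZE P = free_Abelian_group (nz P)"

definition basis_elt :: "('a, 'g) cov_semilattice \<Rightarrow> 'a \<Rightarrow> 'a \<Rightarrow>\<^sub>0 int"
  where "basis_elt P e = (if e = sl_zero P then 0 else frag_of e)"

definition zmult :: "('a, 'g) cov_semilattice \<Rightarrow> ('a \<Rightarrow>\<^sub>0 int) \<Rightarrow> ('a \<Rightarrow>\<^sub>0 int) \<Rightarrow> ('a \<Rightarrow>\<^sub>0 int)"
  where "zmult P x y = frag_extend (\<lambda>a. frag_extend (\<lambda>b. basis_elt P (sl_mult P a b)) y) x"

abbreviation zprod :: "('a, 'g) cov_semilattice \<Rightarrow> ('i \<Rightarrow> 'a \<Rightarrow>\<^sub>0 int) \<Rightarrow> 'i set \<Rightarrow> 'a \<Rightarrow>\<^sub>0 int"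
  where "zprod P \<equiv> nprod (carrier (ZE P)) (zmult P)"

text \<open>Restricted to the carrier because \<^const>\<open>group_action\<close> requires extensional functions.\<close>

definition zact :: "('a, 'g) cov_semilattice \<Rightarrow> 'g \<Rightarrow> ('a \<Rightarrow>\<^sub>0 int) \<Rightarrow> ('a \<Rightarrow>\<^sub>0 int)"
  where "zact P g = restrict (frag_extend (\<lambda>e. frag_of (sl_act P g e))) (carrier (ZE P))"

definition zjoin :: "('a, 'g) cov_semilattice \<Rightarrow> ('i \<Rightarrow> 'a \<Rightarrow>\<^sub>0 int) \<Rightarrow> 'i set \<Rightarrow> 'a \<Rightarrow>\<^sub>0 int"
  where "zjoin P e J = (\<Sum>J' \<in> Pow J - {{}}. frag_cmul ((- 1) ^ (card J' - 1)) (zprod P e J'))"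

definition bigvee :: "('a, 'g) cov_semilattice \<Rightarrow> 'a set \<Rightarrow> 'a \<Rightarrow>\<^sub>0 int"
  where "bigvee P R = zjoin P frag_of R"


section \<open>Finite covers and the conditions (i), (ii), (iii)\<close>

definition finite_cover :: "('a, 'g) cov_semilattice \<Rightarrow> 'a \<Rightarrow> 'a set \<Rightarrow> bool"
  where "finite_cover P e R \<longleftrightarrow>
    finite R \<and> R \<subseteq> nz P \<and> (\<forall>f\<in>R. sl_le P f e) \<and>
    (\<forall>f'\<in>nz P. sl_le P f' e \<longrightarrow> (\<exists>f\<in>R. sl_mult P f' f \<noteq> sl_zero P))"

definition collection_of_finite_covers :: "('a, 'g) cov_semilattice \<Rightarrow> bool"
  where "collection_of_finite_covers P \<longleftrightarrow> (\<forall>e\<in>nz P. \<forall>R\<in>covers P e. finite_cover P e R)"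

definition restricted_cover :: "('a, 'g) cov_semilattice \<Rightarrow> 'a \<Rightarrow> 'a set \<Rightarrow> 'a set"
  where "restricted_cover P d R = (sl_mult P d ` R) \<inter> nz P"

definition cond_i :: "('a, 'g) cov_semilattice \<Rightarrow> bool"
  where "cond_i P \<longleftrightarrow>
    (\<forall>d\<in>nz P. \<forall>e\<in>nz P. \<forall>R\<in>covers P e. sl_mult P d e \<noteq> sl_zero P \<longrightarrow>
        sl_mult P d e \<in> restricted_cover P d R \<or>
        restricted_cover P d R \<in> covers P (sl_mult P d e))"

definition cond_ii :: "('a, 'g) cov_semilattice \<Rightarrow> bool"
  where "cond_ii P \<longleftrightarrow>
    (\<forall>e\<in>nz P. \<forall>(r::nat) R \<epsilon>.
        inj_on R {1..r} \<and> (\<forall>i\<in>{1..r}. R i \<in> covers P e \<and> \<epsilon> i \<in> Poly_Mapping.keys (bigvee P (R i)))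
        \<longrightarrow> (\<forall>j\<in>{1..r}.
              let p = sl_prod P \<epsilon> {1..r};
                  q = (if r = 1 then e else sl_prod P \<epsilon> ({1..r} - {j}))
              in q \<noteq> sl_zero P \<longrightarrow> sl_le P p q \<and> p \<noteq> q))"

definition cond_iii :: "('g, 'm) monoid_scheme \<Rightarrow> ('a, 'g) cov_semilattice \<Rightarrow> bool"
  where "cond_iii \<Gamma> P \<longleftrightarrow>
    (\<forall>g\<in>carrier \<Gamma>. \<forall>e\<in>nz P. (\<lambda>R. sl_act P g ` R) ` covers P e = covers P (sl_act P g e))"


section \<open>The ideal generated by the elements \<open>e - \<Or>R\<close>\<close>

text \<open>The algebra has no identity in general, so the ideals of the ring library do not apply.\<close>

definition zideal :: "('a, 'g) cov_semilattice \<Rightarrow> ('a \<Rightarrow>\<^sub>0 int) set \<Rightarrow> bool"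
  where "zideal P I \<longleftrightarrow>
    subgroup I (ZE P) \<and> (\<forall>x\<in>carrier (ZE P). \<forall>a\<in>I. zmult P x a \<in> I \<and> zmult P a x \<in> I)"

definition rel_ideal :: "('a, 'g) cov_semilattice \<Rightarrow> ('a \<Rightarrow>\<^sub>0 int) set"
  where "rel_ideal P =
    \<Inter> {I. zideal P I \<and> {frag_of e - bigvee P R | e R. e \<in> nz P \<and> R \<in> covers P e} \<subseteq> I}"

definition zquot :: "('a, 'g) cov_semilattice \<Rightarrow> ('a \<Rightarrow>\<^sub>0 int) set monoid"
  where "zquot P = ZE P Mod rel_ideal P"

definition zproj :: "('a, 'g) cov_semilattice \<Rightarrow> ('a \<Rightarrow>\<^sub>0 int) \<Rightarrow> ('a \<Rightarrow>\<^sub>0 int) set"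
  where "zproj P x = rel_ideal P #>\<^bsub>ZE P\<^esub> x"

definition quot_act :: "('a, 'g) cov_semilattice \<Rightarrow> 'g \<Rightarrow> ('a \<Rightarrow>\<^sub>0 int) set \<Rightarrow> ('a \<Rightarrow>\<^sub>0 int) set"
  where "quot_act P g = restrict (\<lambda>C. zact P g ` C) (carrier (zquot P))"


section \<open>The construction \<open>(E(E,R), R(E,R))\<close>\<close>

definition cov_diff :: "('a, 'g) cov_semilattice \<Rightarrow> 'a \<Rightarrow> 'a set set \<Rightarrow> 'a \<Rightarrow>\<^sub>0 int"
  where "cov_diff P e S = zprod P (\<lambda>R. frag_of e - bigvee P R) S"

definition admissible :: "('a, 'g) cov_semilattice \<Rightarrow> 'a \<Rightarrow> 'a set set \<Rightarrow> bool"
  where "admissible P e S \<longleftrightarrow> e \<in> nz P \<and> S \<noteq> {} \<and> finite S \<and> S \<subseteq> covers P e"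

definition derived_cover ::
    "('a, 'g) cov_semilattice \<Rightarrow> 'a \<Rightarrow> 'a set set \<Rightarrow> 'a set \<Rightarrow> ('a \<Rightarrow>\<^sub>0 int) set"
  where "derived_cover P e S R =
    {cov_diff P e (S \<union> {R})} \<union> ({zmult P (frag_of f) (cov_diff P e S) | f. f \<in> R} - {0})"

definition derived_carrier :: "('a, 'g) cov_semilattice \<Rightarrow> ('a \<Rightarrow>\<^sub>0 int) set"
  where "derived_carrier P = {cov_diff P e S | e S. admissible P e S} \<union> {0}"

text \<open>The covers of an element are collected over all its presentations as \<^term>\<open>cov_diff P e S\<close>.
  Under (ii) the presentation is unique.\<close>

definition derived :: "('a, 'g) cov_semilattice \<Rightarrow> ('a \<Rightarrow>\<^sub>0 int, 'g) cov_semilattice"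
  where "derived P =
    \<lparr>carrier = derived_carrier P,
     sl_mult = zmult P,
     sl_zero = 0,
     sl_act = (\<lambda>g. restrict (zact P g) (derived_carrier P)),
     covers = (\<lambda>x. {derived_cover P e S R | e S R.
                      admissible P e S \<and> x = cov_diff P e S \<and> R \<in> covers P e - S})\<rparr>"


section \<open>Iterating the construction\<close>

text \<open>Passing from \<open>E\<^sub>k\<close> to \<open>E\<^sub>k\<^sub>+\<^sub>1\<close> replaces the type \<^typ>\<open>'a\<close> by \<^typ>\<open>'a \<Rightarrow>\<^sub>0 int\<close>, so all \<open>E\<^sub>k\<close> with
  \<open>k \<ge> 1\<close> are placed in one type that contains its own finitely supported integer-valued functions:
  \<open>Lvl1\<close> encodes \<open>\<int>[E\<^sup>\<times>]\<close>, and \<open>Next\<close>, applied to the graph of a function on its support, encodes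
  \<open>\<int>[E\<^sub>k\<^sup>\<times>]\<close> for \<open>k \<ge> 1\<close>.\<close>

datatype 'a univ = Lvl1 "'a \<Rightarrow>\<^sub>0 int" | Next "('a univ \<times> int) fset"

definition encode :: "('a univ \<Rightarrow>\<^sub>0 int) \<Rightarrow> 'a univ"
  where "encode x = Next (Abs_fset ((\<lambda>u. (u, Poly_Mapping.lookup x u)) ` Poly_Mapping.keys x))"

lemma inj_Lvl1: "inj Lvl1"
  by (simp add: inj_def)

lemma inj_encode: "inj encode"
proof (rule injI)
  fix x y :: "'a univ \<Rightarrow>\<^sub>0 int"
  let ?G = "\<lambda>x. (\<lambda>u. (u, Poly_Mapping.lookup x u)) ` Poly_Mapping.keys x"
  assume "encode x = encode y"
  then have G: "?G x = ?G y"
    by (simp add: encode_def Abs_fset_inject)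
  have val: "Poly_Mapping.lookup z u = c \<longleftrightarrow> (u, c) \<in> ?G z" if "c \<noteq> 0"
    for z :: "'a univ \<Rightarrow>\<^sub>0 int" and u c
    using that by (auto simp: in_keys_iff)
  show "x = y"
  proof (rule poly_mapping_eqI)
    fix u
    show "Poly_Mapping.lookup x u = Poly_Mapping.lookup y u"
      using val[of "Poly_Mapping.lookup x u" x u] val[of "Poly_Mapping.lookup x u" y u]
        val[of "Poly_Mapping.lookup y u" x u] val[of "Poly_Mapping.lookup y u" y u] G
      by metis
  qed
qed

definition transport :: "('a \<Rightarrow> 'b) \<Rightarrow> ('a, 'g) cov_semilattice \<Rightarrow> ('b, 'g) cov_semilattice"
  where "transport c P =
    \<lparr>carrier = c ` carrier P,
     sl_mult = (\<lambda>u v. c (sl_mult P (the_inv c u) (the_inv c v))),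
     sl_zero = c (sl_zero P),
     sl_act = (\<lambda>g. restrict (\<lambda>u. c (sl_act P g (the_inv c u))) (c ` carrier P)),
     covers = (\<lambda>u. (\<lambda>R. c ` R) ` covers P (the_inv c u))\<rparr>"

text \<open>\<open>tower P k\<close> is the pair \<open>(E\<^sub>k\<^sub>+\<^sub>1, R\<^sub>k\<^sub>+\<^sub>1)\<close>: index 0 is the first derived pair.\<close>

primrec tower :: "('a, 'g) cov_semilattice \<Rightarrow> nat \<Rightarrow> ('a univ, 'g) cov_semilattice" where
  "tower P 0 = transport Lvl1 (derived P)"
| "tower P (Suc k) = transport encode (derived (tower P k))"

text \<open>The linear extension of the inclusion of \<open>E\<^sub>k\<^sub>+\<^sub>1\<close> into \<open>\<int>[E\<^sub>k\<^sup>\<times>]\<close>, where the elements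
  of \<open>E\<^sub>k\<^sub>+\<^sub>1\<close> are encoded by \<open>c\<close>.\<close>

definition induced_map :: "(('a \<Rightarrow>\<^sub>0 int) \<Rightarrow> 'b) \<Rightarrow> ('b \<Rightarrow>\<^sub>0 int) \<Rightarrow> ('a \<Rightarrow>\<^sub>0 int)"
  where "induced_map c = frag_extend (the_inv c)"


section \<open>Equivariant exactness\<close>

definition gamma_module ::
    "('g, 'm) monoid_scheme \<Rightarrow> ('x, 'n) monoid_scheme \<Rightarrow> ('g \<Rightarrow> 'x \<Rightarrow> 'x) \<Rightarrow> bool"
  where "gamma_module \<Gamma> M \<alpha> \<longleftrightarrow>
    comm_group M \<and> group_action \<Gamma> (carrier M) \<alpha> \<and> (\<forall>g\<in>carrier \<Gamma>. \<alpha> g \<in> hom M M)"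

definition equivariant_hom ::
    "('g, 'm) monoid_scheme \<Rightarrow> ('x, 'n) monoid_scheme \<Rightarrow> ('g \<Rightarrow> 'x \<Rightarrow> 'x) \<Rightarrow>
      ('y, 'k) monoid_scheme \<Rightarrow> ('g \<Rightarrow> 'y \<Rightarrow> 'y) \<Rightarrow> ('x \<Rightarrow> 'y) \<Rightarrow> bool"
  where "equivariant_hom \<Gamma> M \<alpha> N \<beta> f \<longleftrightarrow>
    gamma_module \<Gamma> M \<alpha> \<and> gamma_module \<Gamma> N \<beta> \<and> f \<in> hom M N \<and>
    (\<forall>g\<in>carrier \<Gamma>. \<forall>x\<in>carrier M. f (\<alpha> g x) = \<beta> g (f x))"

definition equivariant_alg_hom ::
    "('g, 'm) monoid_scheme \<Rightarrow> ('a, 'g) cov_semilattice \<Rightarrow> ('b, 'g) cov_semilattice \<Rightarrow>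
      (('a \<Rightarrow>\<^sub>0 int) \<Rightarrow> ('b \<Rightarrow>\<^sub>0 int)) \<Rightarrow> bool"
  where "equivariant_alg_hom \<Gamma> P Q f \<longleftrightarrow>
    equivariant_hom \<Gamma> (ZE P) (zact P) (ZE Q) (zact Q) f \<and>
    (\<forall>x\<in>carrier (ZE P). \<forall>y\<in>carrier (ZE P). f (zmult P x y) = zmult Q (f x) (f y))"

definition exact_at ::
    "('x, 'n) monoid_scheme \<Rightarrow> ('x \<Rightarrow> 'y) \<Rightarrow> ('y, 'k) monoid_scheme \<Rightarrow> ('y \<Rightarrow> 'z) \<Rightarrow>
      ('z, 'l) monoid_scheme \<Rightarrow> bool"
  where "exact_at A f B g C \<longleftrightarrow> f ` carrier A = kernel B C g"

end

theory Submission
  imports Defs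
begin

text \<open>
  The characters \<open>e \<mapsto> [d \<le> e]\<close> embed \<open>\<int>[E\<^sup>\<times>]\<close> into the integer-valued functions on \<open>E\<^sup>\<times>\<close>. Joins
  become unions and \<open>e(S)\<close> becomes the set of all \<open>d \<le> e\<close> lying below no member of a cover in \<open>S\<close>,
  so the derived semilattice is a semilattice of sets; independence of the covers, condition (ii),
  makes this set determine \<open>e\<close> and \<open>S\<close>, and lets (i)--(iii) pass to the derived pair.

  By (i) the ideal generated by the elements \<open>e - \<Or>R\<close> is the additive span of the \<open>e(S)\<close>, hence the
  image of the boundary map. It remains to see that a relation among the \<open>e(S)\<close> lies in the next
  ideal. Modulo that ideal, \<open>e(S)\<close> and \<open>e(S \<union> {R})\<close> differ by terms \<open>h e(S)\<close> with \<open>h < e\<close>. Inside a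
  finite sub-semilattice all basis elements over a maximal \<open>e\<close> can therefore be replaced by a single
  one \<open>e(M)\<close>; its coefficient is the coefficient of \<open>e\<close> in the boundary, which is zero, and induction
  on the number of elements finishes the argument.
\<close>

text \<open>Only one stage needs analysis: the boundary map into the algebra of a pair has as image
  the ideal of that pair and as kernel the ideal of the derived pair. Exactness everywhere compares
  these two descriptions, and iteration asks only that the hypotheses pass to the derived pair.

  Two obstacles shape the details. Condition (ii) speaks of supports of joins, whereas
  \<open>e(S)\<close> is cut out by members of covers. A member can cancel from the join, but a
  maximal member cannot, so a member is first replaced by a maximal one above it before (ii) is
  invoked.

  Secondly, the semilattice may have infinite descending chains and an element may have infinitely
  many covers. The kernel argument therefore stays inside a finite sub-semilattice \<open>F\<close>
  that contains the members of the covers as well as the elements \<open>e\<close>. It is closed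
  under passing from \<open>S\<close> to \<open>h \<cdot> S\<close> for \<open>h\<close> in
  \<open>F\<close>, and only finitely many covers of \<open>e\<close> consist of elements of
  \<open>F\<close>. Hence there is a largest set \<open>M\<close> of such covers, towards which
  every \<open>e(S)\<close> can be pushed.\<close>

lemma group_actionI:
  assumes "group G"
    and ext: "\<And>g. g \<in> carrier G \<Longrightarrow> \<phi> g \<in> extensional E"
    and closed: "\<And>g x. g \<in> carrier G \<Longrightarrow> x \<in> E \<Longrightarrow> \<phi> g x \<in> E"
    and one: "\<And>x. x \<in> E \<Longrightarrow> \<phi> \<one>\<^bsub>G\<^esub> x = x"
    and mult: "\<And>g h x. g \<in> carrier G \<Longrightarrow> h \<in> carrier G \<Longrightarrow> x \<in> E \<Longrightarrow> \<phi> (g \<otimes>\<^bsub>G\<^esub> h) x = \<phi> g (\<phi> h x)"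
  shows "group_action G E \<phi>"
proof -
  interpret group G by fact
  have Bij: "\<phi> g \<in> Bij E" if g: "g \<in> carrier G" for g
  proof -
    \<comment> \<open>Bijectivity comes from the group: the map of the inverse element is a
      two-sided inverse.\<close>
    have l: "\<phi> (inv\<^bsub>G\<^esub> g) (\<phi> g x) = x" "\<phi> g (\<phi> (inv\<^bsub>G\<^esub> g) x) = x" if "x \<in> E" for x
      using that g one mult[of "inv\<^bsub>G\<^esub> g" g x] mult[of g "inv\<^bsub>G\<^esub> g" x] by simp_all
    have "bij_betw (\<phi> g) E E"
      by (rule bij_betwI[where g = "\<phi> (inv\<^bsub>G\<^esub> g)"]) (use g l closed in auto)
    then show ?thesis
      using ext g by (simp add: Bij_def)
  qed
  have "\<phi> \<in> hom G (BijGroup E)"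
  proof (rule homI)
    fix g h assume gh: "g \<in> carrier G" "h \<in> carrier G"
    show "\<phi> (g \<otimes>\<^bsub>G\<^esub> h) = \<phi> g \<otimes>\<^bsub>BijGroup E\<^esub> \<phi> h"
      using gh Bij ext[of "g \<otimes>\<^bsub>G\<^esub> h"] mult
      by (auto simp: BijGroup_def compose_def extensional_def)
  qed (use Bij in \<open>simp add: BijGroup_def\<close>)
  then show ?thesis
    by (simp add: group_action_def group_hom_def group_hom_axioms_def group_BijGroup assms(1))
qed


section \<open>Non-empty products\<close>

text \<open>Instantiated for a semilattice and for its integral algebra, so that products in both
  follow the same rules.\<close>

locale comm_semigroup_on =
  fixes S :: "'a set" and m :: "'a \<Rightarrow> 'a \<Rightarrow> 'a"
  assumes closed: "a \<in> S \<Longrightarrow> b \<in> S \<Longrightarrow> m a b \<in> S"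
    and assoc: "a \<in> S \<Longrightarrow> b \<in> S \<Longrightarrow> d \<in> S \<Longrightarrow> m (m a b) d = m a (m b d)"
    and comm: "a \<in> S \<Longrightarrow> b \<in> S \<Longrightarrow> m a b = m b a"
begin

lemma adjoin_one_simps:
  "carrier (adjoin_one S m) = insert None (Some ` S)"
  "\<one>\<^bsub>adjoin_one S m\<^esub> = None"
  "Some a \<otimes>\<^bsub>adjoin_one S m\<^esub> None = Some a"
  "Some a \<otimes>\<^bsub>adjoin_one S m\<^esub> Some b = Some (m a b)"
  by (simp_all add: adjoin_one_def)

lemma comm_monoid_adjoin_one: "comm_monoid (adjoin_one S m)"
  by (rule comm_monoidI) (auto simp: adjoin_one_def assoc comm intro: closed split: option.splits)

text \<open>A product with at least one factor never equals the adjoined \<open>None\<close>, so the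
  \<open>the\<close> in \<open>nprod\<close> returns a genuine element.\<close>

lemma finprod_adjoin_one:
  assumes "finite J" "J \<noteq> {}" "\<And>j. j \<in> J \<Longrightarrow> f j \<in> S"
  shows "\<exists>a\<in>S. finprod (adjoin_one S m) (\<lambda>j. Some (f j)) J = Some a"
proof -
  interpret M: comm_monoid "adjoin_one S m" by (rule comm_monoid_adjoin_one)
  show ?thesis
    using assms
  proof (induction rule: finite_ne_induct)
    case (singleton j)
    then show ?case
      by (subst M.finprod_insert) (auto simp: adjoin_one_simps)
  next
    case (insert j J)
    then obtain a where "a \<in> S" "finprod (adjoin_one S m) (\<lambda>j. Some (f j)) J = Some a" by auto
    then show ?case
      using insert closed by (subst M.finprod_insert) (auto simp: adjoin_one_simps)
  qed
qed

lemma nprod_singleton: "f j \<in> S \<Longrightarrow> nprod S m f {j} = f j"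
proof -
  interpret M: comm_monoid "adjoin_one S m" by (rule comm_monoid_adjoin_one)
  show "nprod S m f {j} = f j" if "f j \<in> S"
    unfolding nprod_def using that by (subst M.finprod_insert) (auto simp: adjoin_one_simps)
qed

lemma nprod_insert:
  assumes "finite J" "J \<noteq> {}" "j \<notin> J" "f j \<in> S" "\<And>j. j \<in> J \<Longrightarrow> f j \<in> S"
  shows "nprod S m f (insert j J) = m (f j) (nprod S m f J)"
proof -
  interpret M: comm_monoid "adjoin_one S m" by (rule comm_monoid_adjoin_one)
  obtain a where "a \<in> S" "finprod (adjoin_one S m) (\<lambda>j. Some (f j)) J = Some a"
    using finprod_adjoin_one[of J f] assms by blast
  then show ?thesis
    unfolding nprod_def using assms by (subst M.finprod_insert) (auto simp: adjoin_one_simps)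
qed

text \<open>Any multiplicatively closed \<open>F\<close> is allowed, because this serves carriers,
  combinations with support in a given sub-semilattice, and ideals alike.\<close>

lemma nprod_mem:
  assumes "finite J" "J \<noteq> {}" "\<And>j. j \<in> J \<Longrightarrow> f j \<in> F" "F \<subseteq> S"
    and "\<And>a b. a \<in> F \<Longrightarrow> b \<in> F \<Longrightarrow> m a b \<in> F"
  shows "nprod S m f J \<in> F"
  using assms
proof (induction rule: finite_ne_induct)
  case (singleton j)
  then show ?case by (simp add: nprod_singleton subset_iff)
next
  case (insert j J)
  then have "nprod S m f (insert j J) = m (f j) (nprod S m f J)"
    by (intro nprod_insert) auto
  with insert show ?case by simp
qed

lemma nprod_hom:
  fixes \<psi> :: "'a \<Rightarrow> 'b::comm_monoid_mult"
  assumes "finite J" "J \<noteq> {}" "\<And>j. j \<in> J \<Longrightarrow> f j \<in> S"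
    and "\<And>a b. a \<in> S \<Longrightarrow> b \<in> S \<Longrightarrow> \<psi> (m a b) = \<psi> a * \<psi> b"
  shows "\<psi> (nprod S m f J) = (\<Prod>j\<in>J. \<psi> (f j))"
  using assms
proof (induction rule: finite_ne_induct)
  case (singleton j)
  then show ?case by (simp add: nprod_singleton)
next
  case (insert j J)
  then have "nprod S m f (insert j J) = m (f j) (nprod S m f J)"
    by (intro nprod_insert) auto
  moreover have "nprod S m f J \<in> S"
    using insert by (intro nprod_mem) (auto intro: closed)
  ultimately show ?case using insert by simp
qed

lemma nprod_pred:
  assumes "finite J" "J \<noteq> {}" "\<And>j. j \<in> J \<Longrightarrow> f j \<in> S"
    and "\<And>a b. a \<in> S \<Longrightarrow> b \<in> S \<Longrightarrow> \<chi> (m a b) \<longleftrightarrow> \<chi> a \<and> \<chi> b"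
  shows "\<chi> (nprod S m f J) \<longleftrightarrow> (\<forall>j\<in>J. \<chi> (f j))"
proof -
  \<comment> \<open>With truth values read as 0 and 1, conjunction is multiplication and
    \<open>nprod_hom\<close> applies.\<close>
  have "(of_bool (\<chi> (nprod S m f J)) :: int) = (\<Prod>j\<in>J. of_bool (\<chi> (f j)))"
    by (rule nprod_hom[OF assms(1-3)]) (auto simp: assms(4))
  also have "\<dots> = of_bool (\<forall>j\<in>J. \<chi> (f j))"
    using assms(1) by (induction rule: finite_induct) auto
  finally show ?thesis by (simp only: of_bool_eq_iff)
qed

end


section \<open>Evaluating integral combinations on predicates\<close>

text \<open>The linear extension of the indicator function of \<open>\<chi>\<close>. Its values are
  first taken in the free abelian group on one generator, which makes the calculus of
  \<open>frag_extend\<close> available.\<close>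

definition chr :: "('a \<Rightarrow> bool) \<Rightarrow> ('a \<Rightarrow>\<^sub>0 int) \<Rightarrow> int" where
  "chr \<chi> x = Poly_Mapping.lookup (frag_extend (\<lambda>e. if \<chi> e then frag_of () else 0) x) ()"

lemma chr_0 [simp]: "chr \<chi> 0 = 0"
  by (simp add: chr_def)

lemma chr_frag_of [simp]: "chr \<chi> (frag_of e) = of_bool (\<chi> e)"
  by (simp add: chr_def)

lemma chr_add [simp]: "chr \<chi> (x + y) = chr \<chi> x + chr \<chi> y"
  by (simp add: chr_def frag_extend_add lookup_add)

lemma chr_diff [simp]: "chr \<chi> (x - y) = chr \<chi> x - chr \<chi> y"
  by (simp add: chr_def frag_extend_diff lookup_minus)

lemma chr_cmul [simp]: "chr \<chi> (frag_cmul n x) = n * chr \<chi> x"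
  by (simp add: chr_def frag_extend_cmul)

lemma chr_sum: "chr \<chi> (sum f A) = (\<Sum>a\<in>A. chr \<chi> (f a))"
  by (induction A rule: infinite_finite_induct) auto

lemma chr_cong: "(\<And>e. e \<in> Poly_Mapping.keys x \<Longrightarrow> \<chi> e = \<chi>' e) \<Longrightarrow> chr \<chi> x = chr \<chi>' x"
  unfolding chr_def by (subst frag_extend_eq[where h = "\<lambda>e. if \<chi>' e then frag_of () else 0"]) auto

text \<open>Coefficients are evaluations too. If no other element of the support lies above
  \<open>d\<close>, this evaluation agrees with the one at the predicate of lying above
  \<open>d\<close>; that is how characters detect coefficients.\<close>

lemma chr_singleton: "chr (\<lambda>e. e = d) x = Poly_Mapping.lookup x d"
proof -
  have "Poly_Mapping.keys x \<subseteq> UNIV" by simp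
  then show ?thesis
    by (induction x rule: frag_induction) (auto simp: lookup_minus)
qed

text \<open>Evaluation after a linear map is evaluation at a pulled-back predicate, as soon as the
  basis elements that occur are sent to elements of value 0 or 1. This handles boundary maps, the
  group action and multiplication by \<open>e(S)\<close>.\<close>

lemma chr_frag_extend:
  "(\<And>e. e \<in> Poly_Mapping.keys x \<Longrightarrow> chr \<chi> (f e) = of_bool (\<chi>' e)) \<Longrightarrow> chr \<chi> (frag_extend f x) = chr \<chi>' x"
proof -
  assume *: "\<And>e. e \<in> Poly_Mapping.keys x \<Longrightarrow> chr \<chi> (f e) = of_bool (\<chi>' e)"
  have "Poly_Mapping.keys x \<subseteq> Poly_Mapping.keys x" by simp
  then show ?thesis
    by (induction x rule: frag_induction) (auto simp: * frag_extend_diff)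
qed

lemma chr_False [simp]: "chr (\<lambda>_. False) x = 0"
  unfolding chr_def by (subst frag_extend_eq_0) auto

text \<open>The product on the right is expanded over all subsets of \<open>J\<close>. The empty
  subset accounts for the 1, and on the others \<open>card J' - 1\<close> is a true
  predecessor.\<close>

lemma sum_prod_inclusion_exclusion:
  fixes g :: "'i \<Rightarrow> int"
  assumes "finite J"
  shows "(\<Sum>J'\<in>Pow J - {{}}. (- 1) ^ (card J' - 1) * (\<Prod>j\<in>J'. g j)) = 1 - (\<Prod>j\<in>J. 1 - g j)"
proof -
  have "(\<Prod>j\<in>J. 1 - g j) = (\<Sum>J'\<in>Pow J. (\<Prod>j\<in>J'. - g j))"
    using prod_add[OF assms, of "\<lambda>j. - g j" "\<lambda>_. 1"] by simp
  also have "\<dots> = 1 + (\<Sum>J'\<in>Pow J - {{}}. (\<Prod>j\<in>J'. - g j))"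
    using assms by (subst sum.remove[of _ "{}"]) auto
  also have "(\<Sum>J'\<in>Pow J - {{}}. (\<Prod>j\<in>J'. - g j)) =
      (\<Sum>J'\<in>Pow J - {{}}. - ((- 1) ^ (card J' - 1) * (\<Prod>j\<in>J'. g j)))"
  proof (rule sum.cong)
    fix J' assume J': "J' \<in> Pow J - {{}}"
    then have "card J' > 0" using assms by (auto simp: card_gt_0_iff intro: finite_subset)
    then have "(- 1 :: int) ^ card J' = - ((- 1) ^ (card J' - 1))"
      by (cases "card J'") auto
    then show "(\<Prod>j\<in>J'. - g j) = - ((- 1) ^ (card J' - 1) * (\<Prod>j\<in>J'. g j))"
      by (simp add: prod_uminus)
  qed simp
  finally show ?thesis by (simp add: sum_negf)
qed

text \<open>Reconciles the test \<open>r = 1\<close> in condition (ii) with the test for an empty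
  index set in \<open>pmeet\<close>.\<close>

lemma singleton_interval_iff:
  fixes r j :: nat
  assumes "j \<in> {1..r}"
  shows "r = 1 \<longleftrightarrow> {1..r} - {j} = {}"
proof -
  have "{1..r} - {j} = {} \<longleftrightarrow> card ({1..r} - {j}) = 0" by (subst card_0_eq) auto
  moreover have "card ({1..r} - {j}) = r - 1" "r \<ge> 1" using assms by auto
  ultimately show ?thesis by linarith
qed


section \<open>Semilattices and their integral algebras\<close>

locale semilattice_record =
  fixes P :: "('a, 'g) cov_semilattice"
  assumes is_semilattice: "is_semilattice P"
begin

abbreviation meet (infixl "\<^bold>\<cdot>" 70) where "meet \<equiv> sl_mult P"
abbreviation le (infix "\<preceq>" 50) where "le \<equiv> sl_le P"
abbreviation zer ("\<^bold>0") where "zer \<equiv> sl_zero P"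

lemma zer_closed [simp, intro]: "\<^bold>0 \<in> carrier P"
  and meet_closed [simp, intro]: "a \<in> carrier P \<Longrightarrow> b \<in> carrier P \<Longrightarrow> a \<^bold>\<cdot> b \<in> carrier P"
  and meet_assoc: "a \<in> carrier P \<Longrightarrow> b \<in> carrier P \<Longrightarrow> d \<in> carrier P \<Longrightarrow> a \<^bold>\<cdot> b \<^bold>\<cdot> d = a \<^bold>\<cdot> (b \<^bold>\<cdot> d)"
  and meet_comm: "a \<in> carrier P \<Longrightarrow> b \<in> carrier P \<Longrightarrow> a \<^bold>\<cdot> b = b \<^bold>\<cdot> a"
  and meet_idem [simp]: "a \<in> carrier P \<Longrightarrow> a \<^bold>\<cdot> a = a"
  and zer_meet [simp]: "a \<in> carrier P \<Longrightarrow> \<^bold>0 \<^bold>\<cdot> a = \<^bold>0"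
  using is_semilattice by (auto simp: is_semilattice_def)

lemma meet_zer [simp]: "a \<in> carrier P \<Longrightarrow> a \<^bold>\<cdot> \<^bold>0 = \<^bold>0"
  by (metis meet_comm zer_closed zer_meet)

lemma meet_left_comm:
  "a \<in> carrier P \<Longrightarrow> b \<in> carrier P \<Longrightarrow> d \<in> carrier P \<Longrightarrow> a \<^bold>\<cdot> (b \<^bold>\<cdot> d) = b \<^bold>\<cdot> (a \<^bold>\<cdot> d)"
  by (metis meet_assoc meet_comm)

sublocale meets: comm_semigroup_on "carrier P" "sl_mult P"
  by (rule comm_semigroup_on.intro) (rule meet_closed meet_assoc meet_comm; assumption)+

lemma nz_iff: "a \<in> nz P \<longleftrightarrow> a \<in> carrier P \<and> a \<noteq> \<^bold>0"
  by (auto simp: nz_def)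

lemma nz_carrier: "a \<in> nz P \<Longrightarrow> a \<in> carrier P"
  by (simp add: nz_iff)

lemma le_refl [simp]: "a \<in> carrier P \<Longrightarrow> a \<preceq> a"
  by (simp add: sl_le_def)

lemma le_trans:
  "a \<preceq> b \<Longrightarrow> b \<preceq> d \<Longrightarrow> a \<in> carrier P \<Longrightarrow> b \<in> carrier P \<Longrightarrow> d \<in> carrier P \<Longrightarrow> a \<preceq> d"
  unfolding sl_le_def by (metis meet_assoc)

lemma le_antisym: "a \<preceq> b \<Longrightarrow> b \<preceq> a \<Longrightarrow> a \<in> carrier P \<Longrightarrow> b \<in> carrier P \<Longrightarrow> a = b"
  unfolding sl_le_def by (metis meet_comm)

lemma le_meet_iff:
  assumes "a \<in> carrier P" "b \<in> carrier P" "d \<in> carrier P"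
  shows "d \<preceq> a \<^bold>\<cdot> b \<longleftrightarrow> d \<preceq> a \<and> d \<preceq> b"
proof -
  have left: "x \<preceq> y" if "x \<preceq> y \<^bold>\<cdot> z" "x \<in> carrier P" "y \<in> carrier P" "z \<in> carrier P" for x y z
  proof -
    have "y \<^bold>\<cdot> z \<preceq> y"
      using that by (simp add: sl_le_def meet_comm[of "y \<^bold>\<cdot> z" y] flip: meet_assoc)
    then show ?thesis using that le_trans by blast
  qed
  show ?thesis
  proof
    assume "d \<preceq> a \<^bold>\<cdot> b"
    then show "d \<preceq> a \<and> d \<preceq> b"
      using left[of d a b] left[of d b a] assms by (simp add: meet_comm)
  next
    assume "d \<preceq> a \<and> d \<preceq> b"
    then show "d \<preceq> a \<^bold>\<cdot> b" using assms by (simp add: sl_le_def flip: meet_assoc)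
  qed
qed

lemma meet_le: "a \<in> carrier P \<Longrightarrow> b \<in> carrier P \<Longrightarrow> a \<^bold>\<cdot> b \<preceq> a" "a \<in> carrier P \<Longrightarrow> b \<in> carrier P \<Longrightarrow> a \<^bold>\<cdot> b \<preceq> b"
  using le_meet_iff[of a b "a \<^bold>\<cdot> b"] by auto

lemma le_zer: "a \<in> carrier P \<Longrightarrow> a \<preceq> \<^bold>0 \<longleftrightarrow> a = \<^bold>0"
  by (auto simp: sl_le_def)

lemma ex_maximal:
  assumes "finite A" "a \<in> A" "A \<subseteq> carrier P"
  shows "\<exists>b\<in>A. a \<preceq> b \<and> (\<forall>d\<in>A. b \<preceq> d \<longrightarrow> d = b)"
proof -
  let ?r = "\<lambda>x y. x \<preceq> y \<and> x \<noteq> y"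
  have "\<exists>b\<in>{b\<in>A. a \<preceq> b}. \<forall>d\<in>{b\<in>A. a \<preceq> b}. d \<noteq> b \<longrightarrow> \<not> ?r b d"
  proof (rule Finite_Set.bex_max_element[where R = ?r])
    show "asymp_on {b \<in> A. a \<preceq> b} ?r"
      using assms(3) by (intro asymp_onI) (auto dest: le_antisym)
    show "transp_on {b \<in> A. a \<preceq> b} ?r"
      using assms(3) by (intro transp_onI) (auto dest: le_antisym intro: le_trans)
  qed (use assms in \<open>auto intro!: exI[of _ a]\<close>)
  then obtain b where b: "b \<in> A" "a \<preceq> b" "\<And>d. d \<in> A \<Longrightarrow> a \<preceq> d \<Longrightarrow> b \<preceq> d \<Longrightarrow> d = b"
    by auto
  have "d = b" if "d \<in> A" "b \<preceq> d" for d
    using b that assms by (meson le_trans subsetD)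
  with b show ?thesis by blast
qed

text \<open>The linear extension of such a predicate is multiplicative. Besides the principal
  predicates \<open>\<lambda>e. d \<preceq> e\<close>, the derived semilattice uses membership of a
  base point \<open>d\<close> in \<open>pts u\<close>, which evaluates boundaries.\<close>

definition character :: "('a \<Rightarrow> bool) \<Rightarrow> bool" where
  "character \<chi> \<longleftrightarrow> \<not> \<chi> \<^bold>0 \<and> (\<forall>a\<in>carrier P. \<forall>b\<in>carrier P. \<chi> (a \<^bold>\<cdot> b) \<longleftrightarrow> \<chi> a \<and> \<chi> b)"

lemma character_meet: "character \<chi> \<Longrightarrow> a \<in> carrier P \<Longrightarrow> b \<in> carrier P \<Longrightarrow> \<chi> (a \<^bold>\<cdot> b) \<longleftrightarrow> \<chi> a \<and> \<chi> b"
  by (simp add: character_def)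

lemma character_zer: "character \<chi> \<Longrightarrow> \<not> \<chi> \<^bold>0"
  by (simp add: character_def)

lemma character_mono: "character \<chi> \<Longrightarrow> \<chi> a \<Longrightarrow> a \<preceq> b \<Longrightarrow> a \<in> carrier P \<Longrightarrow> b \<in> carrier P \<Longrightarrow> \<chi> b"
  by (metis character_meet sl_le_def)

lemma character_le: "d \<in> nz P \<Longrightarrow> character (\<lambda>e. d \<preceq> e)"
  by (auto simp: character_def nz_iff le_zer le_meet_iff)

section \<open>The integral algebra of a semilattice and its evaluations\<close>

lemma carrier_ZE: "x \<in> carrier (ZE P) \<longleftrightarrow> Poly_Mapping.keys x \<subseteq> nz P"
  by (simp add: ZE_def)

lemma ZE_0 [simp]: "0 \<in> carrier (ZE P)"
  by (simp add: carrier_ZE)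

lemma ZE_frag_of [simp]: "frag_of e \<in> carrier (ZE P) \<longleftrightarrow> e \<in> nz P"
  by (simp add: carrier_ZE)

lemma ZE_add: "x \<in> carrier (ZE P) \<Longrightarrow> y \<in> carrier (ZE P) \<Longrightarrow> x + y \<in> carrier (ZE P)"
  using keys_add[of x y] by (auto simp: carrier_ZE)

lemma ZE_diff: "x \<in> carrier (ZE P) \<Longrightarrow> y \<in> carrier (ZE P) \<Longrightarrow> x - y \<in> carrier (ZE P)"
  using keys_diff[of x y] by (auto simp: carrier_ZE)

lemma ZE_cmul: "x \<in> carrier (ZE P) \<Longrightarrow> frag_cmul n x \<in> carrier (ZE P)"
  using keys_cmul[of n x] by (auto simp: carrier_ZE)

lemma ZE_sum: "(\<And>i. i \<in> A \<Longrightarrow> f i \<in> carrier (ZE P)) \<Longrightarrow> sum f A \<in> carrier (ZE P)"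
  by (induction A rule: infinite_finite_induct) (auto intro: ZE_add)

lemma ZE_frag_extend:
  assumes "\<And>e. e \<in> Poly_Mapping.keys x \<Longrightarrow> f e \<in> carrier (ZE P)"
  shows "frag_extend f x \<in> carrier (ZE P)"
  unfolding frag_extend_def using assms by (auto intro!: ZE_sum ZE_cmul)

lemma basis_elt_closed [simp]: "e \<in> carrier P \<Longrightarrow> basis_elt P e \<in> carrier (ZE P)"
  by (simp add: basis_elt_def nz_iff)

lemma chr_basis_elt: "\<not> \<chi> \<^bold>0 \<Longrightarrow> chr \<chi> (basis_elt P e) = of_bool (\<chi> e)"
  by (auto simp: basis_elt_def)

text \<open>Points of \<open>\<int>[E\<^sup>\<times>]\<close> are separated by the characters \<open>e \<mapsto> [d \<le> e]\<close>: evaluate at a maximal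
  element \<open>d\<close> of the support.\<close>

lemma ZE_eq_0I:
  assumes "x \<in> carrier (ZE P)" and "\<And>d. d \<in> nz P \<Longrightarrow> chr (\<lambda>e. d \<preceq> e) x = 0"
  shows "x = 0"
proof (rule ccontr)
  assume "x \<noteq> 0"
  then obtain a where a: "a \<in> Poly_Mapping.keys x" by (metis keys_eq_empty all_not_in_conv)
  have N: "Poly_Mapping.keys x \<subseteq> nz P" using assms(1) by (simp add: carrier_ZE)
  obtain d where d: "d \<in> Poly_Mapping.keys x" "\<forall>e\<in>Poly_Mapping.keys x. d \<preceq> e \<longrightarrow> e = d"
    using ex_maximal[OF finite_keys a] N nz_carrier by blast
  have "chr (\<lambda>e. d \<preceq> e) x = chr (\<lambda>e. e = d) x"
    using d N nz_carrier by (intro chr_cong) auto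
  then show False
    using assms(2)[of d] d N by (auto simp: chr_singleton in_keys_iff)
qed

lemma ZE_eqI:
  assumes "x \<in> carrier (ZE P)" "y \<in> carrier (ZE P)"
    and "\<And>d. d \<in> nz P \<Longrightarrow> chr (\<lambda>e. d \<preceq> e) x = chr (\<lambda>e. d \<preceq> e) y"
  shows "x = y"
  using ZE_eq_0I[of "x - y"] assms by (auto intro: ZE_diff)

lemma zmult_0 [simp]: "zmult P 0 y = 0" "zmult P x 0 = 0"
proof -
  show "zmult P 0 y = 0" by (simp add: zmult_def)
  show "zmult P x 0 = 0" unfolding zmult_def by (rule frag_extend_eq_0) simp
qed

lemma zmult_diff_left: "zmult P (x - y) z = zmult P x z - zmult P y z"
  by (simp add: zmult_def frag_extend_diff)

lemma zmult_frag_of: "zmult P (frag_of a) (frag_of b) = basis_elt P (a \<^bold>\<cdot> b)"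
  by (simp add: zmult_def)

lemma zmult_diff_right: "zmult P x (y - z) = zmult P x y - zmult P x z"
proof -
  have "Poly_Mapping.keys x \<subseteq> UNIV" by simp
  then show ?thesis
  proof (induction x rule: frag_induction)
    case (one a)
    then show ?case by (simp add: zmult_def frag_extend_diff)
  qed (auto simp: zmult_diff_left algebra_simps)
qed

lemma zmult_closed: "x \<in> carrier (ZE P) \<Longrightarrow> y \<in> carrier (ZE P) \<Longrightarrow> zmult P x y \<in> carrier (ZE P)"
  unfolding zmult_def by (intro ZE_frag_extend basis_elt_closed meet_closed) (auto simp: carrier_ZE nz_iff)

text \<open>By bilinearity this is the meet law on basis elements; a product that vanishes in the
  semilattice causes no defect, since characters fail at zero.\<close>

lemma chr_zmult:
  assumes "character \<chi>" "x \<in> carrier (ZE P)" "y \<in> carrier (ZE P)"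
  shows "chr \<chi> (zmult P x y) = chr \<chi> x * chr \<chi> y"
proof -
  have 1: "chr \<chi> (zmult P (frag_of a) y) = of_bool (\<chi> a) * chr \<chi> y" if "a \<in> nz P" for a
    using assms(3)[unfolded carrier_ZE]
    by (induction y rule: frag_induction)
      (use that assms(1) in \<open>auto simp: zmult_frag_of zmult_diff_right chr_basis_elt character_zer
        character_meet nz_iff right_diff_distrib\<close>)
  show ?thesis
    using assms(2)[unfolded carrier_ZE]
    by (induction x rule: frag_induction) (auto simp: 1 zmult_diff_left left_diff_distrib)
qed

text \<open>Associativity and commutativity are inherited from the integers, because characters
  separate points.\<close>

sublocale zmults: comm_semigroup_on "carrier (ZE P)" "zmult P"
proof
  fix x y z assume "x \<in> carrier (ZE P)" "y \<in> carrier (ZE P)" "z \<in> carrier (ZE P)"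
  then show "zmult P (zmult P x y) z = zmult P x (zmult P y z)"
    by (intro ZE_eqI) (simp_all add: chr_zmult zmult_closed character_le)
qed (auto intro!: ZE_eqI zmult_closed simp: chr_zmult character_le)

text \<open>The universal property of the algebra. The target multiplication is an arbitrary
  biadditive operation \<open>m\<close>, so that \<open>zmult\<close> of another pair can be
  inserted.\<close>

lemma frag_extend_zmult:
  assumes x: "x \<in> carrier (ZE P)" and y: "y \<in> carrier (ZE P)"
    and 0: "f \<^bold>0 = 0"
    and hom: "\<And>a b. a \<in> nz P \<Longrightarrow> b \<in> nz P \<Longrightarrow> f (a \<^bold>\<cdot> b) = m (f a) (f b)"
    and m: "\<And>u. m 0 u = 0" "\<And>u. m u 0 = 0" "\<And>u v w. m (u - v) w = m u w - m v w"
      "\<And>u v w. m u (v - w) = m u v - m u w"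
  shows "frag_extend f (zmult P x y) = m (frag_extend f x) (frag_extend f y)"
proof -
  have b: "frag_extend f (basis_elt P e) = f e" for e
    by (simp add: basis_elt_def 0)
  have 1: "frag_extend f (zmult P (frag_of a) y) = m (f a) (frag_extend f y)" if "a \<in> nz P" for a
    using y[unfolded carrier_ZE]
    by (induction y rule: frag_induction)
      (use that in \<open>auto simp: zmult_frag_of zmult_diff_right b hom m frag_extend_diff\<close>)
  show ?thesis
    using x[unfolded carrier_ZE]
    by (induction x rule: frag_induction) (auto simp: 1 zmult_diff_left m frag_extend_diff)
qed

lemma zprod_closed:
  assumes "finite J" "J \<noteq> {}" "\<And>j. j \<in> J \<Longrightarrow> f j \<in> carrier (ZE P)"
  shows "zprod P f J \<in> carrier (ZE P)"
  by (rule zmults.nprod_mem[OF assms]) (auto intro: zmult_closed)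

lemma chr_zprod:
  assumes "character \<chi>" "finite J" "J \<noteq> {}" "\<And>j. j \<in> J \<Longrightarrow> f j \<in> carrier (ZE P)"
  shows "chr \<chi> (zprod P f J) = (\<Prod>j\<in>J. chr \<chi> (f j))"
  by (rule zmults.nprod_hom[OF assms(2-4)]) (auto simp: chr_zmult assms(1))

section \<open>Joins of finite sets: supports and values\<close>

lemma bigvee_closed:
  assumes "finite R" "R \<subseteq> nz P"
  shows "bigvee P R \<in> carrier (ZE P)"
  unfolding bigvee_def zjoin_def using assms
  by (auto intro!: ZE_sum ZE_cmul zprod_closed intro: finite_subset[of _ R])

text \<open>Only products of members of \<open>R\<close> occur in the join. Applied to the set of
  elements below a member of \<open>R\<close>, and to finite sub-semilattices.\<close>

lemma keys_bigvee:
  assumes "finite R" "R \<subseteq> nz P" "R \<subseteq> F" "\<And>a b. a \<in> F \<Longrightarrow> b \<in> F \<Longrightarrow> a \<^bold>\<cdot> b \<in> F" "F \<subseteq> carrier P"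
  shows "Poly_Mapping.keys (bigvee P R) \<subseteq> F"
proof -
  have 1: "Poly_Mapping.keys (zprod P frag_of J) \<subseteq> F" if J: "J \<subseteq> R" "J \<noteq> {}" for J
  proof -
    have "zprod P frag_of J \<in> {x \<in> carrier (ZE P). Poly_Mapping.keys x \<subseteq> F}"
    proof (rule zmults.nprod_mem)
      fix x y assume xy: "x \<in> {x \<in> carrier (ZE P). Poly_Mapping.keys x \<subseteq> F}" "y \<in> {x \<in> carrier (ZE P). Poly_Mapping.keys x \<subseteq> F}"
      have "Poly_Mapping.keys (zmult P x y) \<subseteq>
          (\<Union>a\<in>Poly_Mapping.keys x. Poly_Mapping.keys (frag_extend (\<lambda>b. basis_elt P (a \<^bold>\<cdot> b)) y))"
        unfolding zmult_def by (rule keys_frag_extend)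
      also have "\<dots> \<subseteq> (\<Union>a\<in>Poly_Mapping.keys x. \<Union>b\<in>Poly_Mapping.keys y. Poly_Mapping.keys (basis_elt P (a \<^bold>\<cdot> b)))"
        by (intro UN_mono order_refl keys_frag_extend)
      also have "\<dots> \<subseteq> F"
        using xy assms(4) by (auto simp: basis_elt_def split: if_splits) blast
      finally show "zmult P x y \<in> {x \<in> carrier (ZE P). Poly_Mapping.keys x \<subseteq> F}"
        using xy by (auto intro: zmult_closed)
    qed (use that assms in \<open>auto intro: finite_subset[of _ R]\<close>)
    then show ?thesis by simp
  qed
  show ?thesis
    unfolding bigvee_def zjoin_def
  proof (rule order_trans[OF keys_sum] UN_least)+
    fix J assume "J \<in> Pow R - {{}}"
    then show "Poly_Mapping.keys (frag_cmul ((- 1) ^ (card J - 1)) (zprod P frag_of J)) \<subseteq> F"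
      using 1[of J] keys_cmul by blast
  qed
qed

lemma chr_bigvee:
  assumes "character \<chi>" "finite R" "R \<subseteq> nz P"
  shows "chr \<chi> (bigvee P R) = of_bool (\<exists>f\<in>R. \<chi> f)"
proof -
  have "chr \<chi> (bigvee P R) = (\<Sum>J\<in>Pow R - {{}}. (- 1) ^ (card J - 1) * (\<Prod>f\<in>J. of_bool (\<chi> f)))"
    unfolding bigvee_def zjoin_def chr_sum chr_cmul
  proof (rule sum.cong)
    fix J assume J: "J \<in> Pow R - {{}}"
    show "(- 1) ^ (card J - 1) * chr \<chi> (zprod P frag_of J) = (- 1) ^ (card J - 1) * (\<Prod>f\<in>J. of_bool (\<chi> f))"
      using assms J finite_subset[OF _ assms(2)] by (subst chr_zprod) auto
  qed simp
  also have "\<dots> = 1 - (\<Prod>f\<in>R. 1 - of_bool (\<chi> f))"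
    using assms(2) by (rule sum_prod_inclusion_exclusion)
  also have "(\<Prod>f\<in>R. 1 - of_bool (\<chi> f)) = (of_bool (\<forall>f\<in>R. \<not> \<chi> f) :: int)"
    using assms(2) by (induction rule: finite_induct) auto
  finally show ?thesis by auto
qed

lemma keys_bigvee_below:
  assumes "finite R" "R \<subseteq> nz P" "h \<in> Poly_Mapping.keys (bigvee P R)"
  shows "h \<in> nz P" "\<exists>f\<in>R. h \<preceq> f"
proof -
  have "Poly_Mapping.keys (bigvee P R) \<subseteq> {h \<in> carrier P. \<exists>f\<in>R. h \<preceq> f}"
  proof (rule keys_bigvee[OF assms(1,2)])
    show "R \<subseteq> {h \<in> carrier P. \<exists>f\<in>R. h \<preceq> f}" using assms(2) nz_carrier le_refl by blast
    show "a \<^bold>\<cdot> b \<in> {h \<in> carrier P. \<exists>f\<in>R. h \<preceq> f}"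
      if "a \<in> {h \<in> carrier P. \<exists>f\<in>R. h \<preceq> f}" "b \<in> {h \<in> carrier P. \<exists>f\<in>R. h \<preceq> f}" for a b
    proof -
      from that obtain f where "f \<in> R" "a \<preceq> f" "a \<in> carrier P" "b \<in> carrier P" by auto
      moreover have "f \<in> carrier P" using \<open>f \<in> R\<close> assms(2) nz_carrier by auto
      ultimately show ?thesis using le_trans[OF meet_le(1)[of a b], of f] by auto
    qed
  qed auto
  with assms(3) show "\<exists>f\<in>R. h \<preceq> f" by auto
  show "h \<in> nz P" using bigvee_closed[OF assms(1,2)] assms(3) by (auto simp: carrier_ZE)
qed

text \<open>Every element of the support lies below some member, so by maximality none but
  \<open>f\<close> lies above \<open>f\<close>. The coefficient of \<open>f\<close> is thus the
  value of the join at \<open>f\<close>, which is 1.\<close>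

lemma maximal_in_keys_bigvee:
  assumes "finite R" "R \<subseteq> nz P" "f \<in> R" "\<And>f'. f' \<in> R \<Longrightarrow> f \<preceq> f' \<Longrightarrow> f' = f"
  shows "f \<in> Poly_Mapping.keys (bigvee P R)"
proof -
  have f: "f \<in> nz P" using assms by auto
  have "chr (\<lambda>e. f \<preceq> e) (bigvee P R) = chr (\<lambda>e. e = f) (bigvee P R)"
  proof (rule chr_cong)
    fix h assume h: "h \<in> Poly_Mapping.keys (bigvee P R)"
    then obtain f' where "f' \<in> R" "h \<preceq> f'" "h \<in> nz P"
      using keys_bigvee_below[OF assms(1,2)] by blast
    then show "(f \<preceq> h) = (h = f)"
      using assms(2,4) f le_trans[of f h f'] le_antisym[of f h] nz_carrier[of f] nz_carrier[of h]
        nz_carrier[of f'] by auto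
  qed
  moreover have "chr (\<lambda>e. f \<preceq> e) (bigvee P R) = 1"
    using assms f nz_carrier le_refl[of f] by (subst chr_bigvee) (auto simp: character_le simp del: le_refl)
  ultimately show ?thesis by (simp add: chr_singleton in_keys_iff)
qed

text \<open>A product with default \<open>e\<close> for the empty family, as condition (ii)
  prescribes for \<open>r = 1\<close>. When all factors lie below \<open>e\<close>, the default
  behaves as a neutral element.\<close>

definition pmeet :: "'a \<Rightarrow> ('i \<Rightarrow> 'a) \<Rightarrow> 'i set \<Rightarrow> 'a" where
  "pmeet e \<epsilon> J = (if J = {} then e else sl_prod P \<epsilon> J)"

lemma pmeet_closed:
  assumes "e \<in> carrier P" "finite J" "\<And>j. j \<in> J \<Longrightarrow> \<epsilon> j \<in> carrier P"
  shows "pmeet e \<epsilon> J \<in> carrier P"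
  using assms by (auto simp: pmeet_def intro!: meets.nprod_mem)

lemma le_pmeet_iff:
  assumes "e \<in> carrier P" "finite J" "\<And>j. j \<in> J \<Longrightarrow> \<epsilon> j \<in> carrier P" "\<And>j. j \<in> J \<Longrightarrow> \<epsilon> j \<preceq> e"
    and d: "d \<in> carrier P"
  shows "d \<preceq> pmeet e \<epsilon> J \<longleftrightarrow> d \<preceq> e \<and> (\<forall>j\<in>J. d \<preceq> \<epsilon> j)"
proof (cases "J = {}")
  case False
  have "d \<preceq> sl_prod P \<epsilon> J \<longleftrightarrow> (\<forall>j\<in>J. d \<preceq> \<epsilon> j)"
    by (rule meets.nprod_pred) (use assms False in \<open>auto simp: le_meet_iff\<close>)
  moreover obtain j where "j \<in> J" using False by auto
  ultimately show ?thesis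
    using False assms(1) assms(3,4)[of j] d le_trans[of d "\<epsilon> j" e] by (auto simp: pmeet_def)
qed (simp add: pmeet_def)

lemma eq_by_le: "a \<in> carrier P \<Longrightarrow> b \<in> carrier P \<Longrightarrow> (\<And>d. d \<in> carrier P \<Longrightarrow> d \<preceq> a \<longleftrightarrow> d \<preceq> b) \<Longrightarrow> a = b"
  by (meson le_antisym le_refl)

end

section \<open>Pairs satisfying (i), (ii), (iii)\<close>

locale cover_pair = semilattice_record P
  for \<Gamma> :: "('g, 'm) monoid_scheme" and P :: "('a, 'g) cov_semilattice" +
  assumes group: "group \<Gamma>" and gamma: "gamma_semilattice \<Gamma> P"
    and fc: "collection_of_finite_covers P"
    and ci: "cond_i P" and cii: "cond_ii P" and ciii: "cond_iii \<Gamma> P"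
begin

section \<open>Covers and their independence\<close>

lemma cover_props:
  assumes "e \<in> nz P" "R \<in> covers P e"
  shows "finite R" "R \<subseteq> nz P" "f \<in> R \<Longrightarrow> f \<in> nz P" "f \<in> R \<Longrightarrow> f \<in> carrier P" "f \<in> R \<Longrightarrow> f \<preceq> e"
    and "f' \<in> nz P \<Longrightarrow> f' \<preceq> e \<Longrightarrow> \<exists>f\<in>R. f' \<^bold>\<cdot> f \<noteq> \<^bold>0"
  using fc assms by (auto simp: collection_of_finite_covers_def finite_cover_def nz_carrier subset_iff)

lemma cover_key_props:
  assumes "e \<in> nz P" "R \<in> covers P e" "h \<in> Poly_Mapping.keys (bigvee P R)"
  shows "h \<in> nz P" "h \<preceq> e"
proof -
  note R = cover_props[OF assms(1,2)]
  show h: "h \<in> nz P" using keys_bigvee_below[OF R(1,2) assms(3)] by simp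
  obtain f where f: "f \<in> R" "h \<preceq> f" using keys_bigvee_below[OF R(1,2) assms(3)] by auto
  show "h \<preceq> e"
    using le_trans[OF f(2) R(5)[OF f(1)]] h f R(4) assms(1) by (simp add: nz_carrier)
qed

text \<open>The bridge to (ii): a member may cancel from the join of its cover, but a maximal member
  above it survives in the support.\<close>

lemma cover_below_key:
  assumes "e \<in> nz P" "R \<in> covers P e" "f \<in> R"
  obtains f' where "f' \<in> R" "f \<preceq> f'" "f' \<in> Poly_Mapping.keys (bigvee P R)"
proof -
  note R = cover_props[OF assms(1,2)]
  obtain f' where "f' \<in> R" "f \<preceq> f'" "\<forall>d\<in>R. f' \<preceq> d \<longrightarrow> d = f'"
    using ex_maximal[OF R(1) assms(3)] R(4) by blast
  then show thesis using that maximal_in_keys_bigvee[OF R(1,2)] by blast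
qed

text \<open>The data of condition (ii), indexed by the covers themselves instead of by
  \<open>{1..r}\<close>.\<close>

definition selection :: "'a \<Rightarrow> ('a set \<Rightarrow> 'a) \<Rightarrow> 'a set set \<Rightarrow> bool" where
  "selection e \<eta> B \<longleftrightarrow>
    e \<in> nz P \<and> finite B \<and> B \<subseteq> covers P e \<and> (\<forall>R\<in>B. \<eta> R \<in> Poly_Mapping.keys (bigvee P R))"

lemma selection_props:
  assumes "selection e \<eta> B"
  shows "e \<in> nz P" "e \<in> carrier P" "finite B" "R \<in> B \<Longrightarrow> R \<in> covers P e"
    "R \<in> B \<Longrightarrow> \<eta> R \<in> Poly_Mapping.keys (bigvee P R)"
    "R \<in> B \<Longrightarrow> \<eta> R \<in> carrier P" "R \<in> B \<Longrightarrow> \<eta> R \<preceq> e"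
  using assms cover_key_props by (auto simp: selection_def nz_carrier)

lemma selection_pmeet:
  assumes "selection e \<eta> B"
  shows "pmeet e \<eta> B \<in> carrier P"
    "d \<in> carrier P \<Longrightarrow> d \<preceq> pmeet e \<eta> B \<longleftrightarrow> d \<preceq> e \<and> (\<forall>R\<in>B. d \<preceq> \<eta> R)"
proof -
  note s = selection_props[OF assms]
  show "pmeet e \<eta> B \<in> carrier P" by (rule pmeet_closed[OF s(2,3,6)])
  show "d \<preceq> pmeet e \<eta> B \<longleftrightarrow> d \<preceq> e \<and> (\<forall>R\<in>B. d \<preceq> \<eta> R)" if "d \<in> carrier P"
    by (rule le_pmeet_iff[OF s(2,3,6,7) that])
qed

text \<open>If the product over \<open>B\<close> were already below \<open>\<eta> R\<close>, the
  factor at \<open>R\<close> would leave the product unchanged, against the strict decrease that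
  (ii) demands at the index of \<open>R\<close>.\<close>

lemma selection_independent:
  assumes sel: "selection e \<eta> (insert R B)" and "R \<notin> B" and nonzero: "pmeet e \<eta> B \<noteq> \<^bold>0"
  shows "\<not> pmeet e \<eta> B \<preceq> \<eta> R"
proof
  assume le: "pmeet e \<eta> B \<preceq> \<eta> R"
  note s = selection_props[OF sel]
  have selB: "selection e \<eta> B" using sel by (auto simp: selection_def)
  note sB = selection_props[OF selB]
  define r where "r = card (insert R B)"
  obtain h where h: "bij_betw h {1..r} (insert R B)"
    using ex_bij_betw_nat_finite_1[OF s(3)] r_def by auto
  then obtain j where j: "j \<in> {1..r}" "h j = R" by (metis bij_betw_def imageE insertI1)
  have hB: "h ` ({1..r} - {j}) = B"
    using inj_on_image_set_diff[of h "{1..r}" "{1..r}" "{j}"] h j \<open>R \<notin> B\<close> by (simp add: bij_betw_def)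
  have hRB: "h ` {1..r} = insert R B" using h by (simp add: bij_betw_def)
  have hi: "h i \<in> insert R B" if "i \<in> {1..r}" for i using hRB that by auto
  let ?e = "\<lambda>i. \<eta> (h i)"
  have cl: "?e i \<in> carrier P" "?e i \<preceq> e" if "i \<in> {1..r}" for i using s(6,7) hi[OF that] by auto
  have q: "pmeet e ?e ({1..r} - {j}) = pmeet e \<eta> B"
  proof (rule eq_by_le)
    fix d assume d: "d \<in> carrier P"
    have "d \<preceq> pmeet e ?e ({1..r} - {j}) \<longleftrightarrow> d \<preceq> e \<and> (\<forall>i\<in>{1..r} - {j}. d \<preceq> ?e i)"
      by (rule le_pmeet_iff) (use s(2) cl d in auto)
    also have "\<dots> \<longleftrightarrow> d \<preceq> pmeet e \<eta> B"
    proof -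
      have "(\<forall>i\<in>{1..r} - {j}. d \<preceq> ?e i) \<longleftrightarrow> (\<forall>R\<in>B. d \<preceq> \<eta> R)"
        unfolding hB[symmetric] by blast
      then show ?thesis using selection_pmeet(2)[OF selB d] by simp
    qed
    finally show "d \<preceq> pmeet e ?e ({1..r} - {j}) \<longleftrightarrow> d \<preceq> pmeet e \<eta> B" .
  qed (use s(2) cl selection_pmeet(1)[OF selB] in \<open>auto intro!: pmeet_closed\<close>)
  \<comment> \<open>By the assumption \<open>le\<close> the additional factor
    \<open>\<eta> R\<close> is absorbed.\<close>
  have p: "pmeet e ?e {1..r} = pmeet e \<eta> B"
  proof (rule eq_by_le)
    fix d assume d: "d \<in> carrier P"
    have "d \<preceq> pmeet e ?e {1..r} \<longleftrightarrow> d \<preceq> e \<and> (\<forall>i\<in>{1..r}. d \<preceq> ?e i)"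
      by (rule le_pmeet_iff) (use s(2) cl d in auto)
    also have "\<dots> \<longleftrightarrow> d \<preceq> e \<and> (\<forall>R\<in>insert R B. d \<preceq> \<eta> R)"
      unfolding hRB[symmetric] by blast
    also have "\<dots> \<longleftrightarrow> d \<preceq> pmeet e \<eta> B"
      using le_trans[OF _ le d] s(6) selection_pmeet(1)[OF selB] selection_pmeet(2)[OF selB d] by auto
    finally show "d \<preceq> pmeet e ?e {1..r} \<longleftrightarrow> d \<preceq> pmeet e \<eta> B" .
  qed (use s(2) cl selection_pmeet(1)[OF selB] in \<open>auto intro!: pmeet_closed\<close>)
  have r1: "r = 1 \<longleftrightarrow> {1..r} - {j} = {}"
    using j(1) by (rule singleton_interval_iff)
  have q': "(if r = 1 then e else sl_prod P ?e ({1..r} - {j})) = pmeet e \<eta> B"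
    unfolding q[symmetric] r1 by (simp only: pmeet_def)
  have p': "sl_prod P ?e {1..r} = pmeet e \<eta> B"
  proof -
    have "{1..r} \<noteq> {}" using j(1) by blast
    then show ?thesis using p unfolding pmeet_def by (simp only: if_False)
  qed
  have "inj_on h {1..r} \<and> (\<forall>i\<in>{1..r}. h i \<in> covers P e \<and> ?e i \<in> Poly_Mapping.keys (bigvee P (h i)))"
    using h s(4,5) hi by (auto simp: bij_betw_def)
  then have "\<forall>j\<in>{1..r}. let p = sl_prod P ?e {1..r};
        q = (if r = 1 then e else sl_prod P ?e ({1..r} - {j}))
      in q \<noteq> \<^bold>0 \<longrightarrow> p \<preceq> q \<and> p \<noteq> q"
    by (rule cii[unfolded cond_ii_def, THEN bspec, OF s(1), THEN spec, THEN spec, THEN spec, THEN mp])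
  then show False
    using j(1) nonzero unfolding Let_def by (metis p' q')
qed

definition slice :: "'a \<Rightarrow> 'a set set \<Rightarrow> 'a set" where
  "slice e S = {d \<in> nz P. d \<preceq> e \<and> (\<forall>R\<in>S. \<forall>f\<in>R. \<not> d \<preceq> f)}"

text \<open>Independence in the form used later: a further cover \<open>R\<close> reaches into every
  nonzero product of selected elements, at a point that avoids all members of covers in
  \<open>A\<close>. Taking \<open>B\<close> empty separates sets of covers; general \<open>B\<close>
  is what (ii) for the derived pair requires.\<close>

lemma selection_cover_meets_slice:
  assumes sel: "selection e \<eta> B" and A: "A \<subseteq> covers P e" "A \<inter> B = {}"
    and R: "R \<in> covers P e" "R \<notin> A" "R \<notin> B" and nonzero: "pmeet e \<eta> B \<noteq> \<^bold>0"
  shows "\<exists>d\<in>slice e A. d \<preceq> pmeet e \<eta> B \<and> (\<exists>f\<in>R. d \<preceq> f)"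
proof -
  note s = selection_props[OF sel]
  define m where "m = pmeet e \<eta> B"
  have m: "m \<in> nz P" "m \<in> carrier P" "m \<preceq> e"
    using nonzero selection_pmeet(1)[OF sel] selection_pmeet(2)[OF sel, of "pmeet e \<eta> B"]
    by (auto simp: m_def nz_iff)
  note cR = cover_props[OF s(1) R(1)]
  obtain f0 where f0: "f0 \<in> R" "m \<^bold>\<cdot> f0 \<noteq> \<^bold>0" using cR(6)[OF m(1,3)] by auto
  \<comment> \<open>Condition (ii) accepts only elements of supports, so \<open>f0\<close> is
    enlarged to one; the product with \<open>m\<close> stays nonzero.\<close>
  obtain f where f: "f \<in> R" "f0 \<preceq> f" "f \<in> Poly_Mapping.keys (bigvee P R)"
    using cover_below_key[OF s(1) R(1) f0(1)] by blast
  have C: "f0 \<in> carrier P" "f \<in> carrier P" using cR(4) f f0 by auto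
  define d where "d = m \<^bold>\<cdot> f"
  have d: "d \<in> carrier P" "d \<preceq> m" "d \<preceq> f" using m C meet_le by (auto simp: d_def)
  have "m \<^bold>\<cdot> f0 \<preceq> d"
    using meet_le[of m f0] le_trans[of "m \<^bold>\<cdot> f0" f0 f] m C f by (auto simp: d_def le_meet_iff)
  then have dnz: "d \<in> nz P" using f0 d C m le_zer[of "m \<^bold>\<cdot> f0"] by (auto simp: nz_iff)
  have "\<not> d \<preceq> f'" if R': "R' \<in> A" "f' \<in> R'" for R' f'
  proof
    assume "d \<preceq> f'"
    have cR': "R' \<in> covers P e" using R' A by auto
    obtain f'' where f'': "f'' \<in> R'" "f' \<preceq> f''" "f'' \<in> Poly_Mapping.keys (bigvee P R')"
      using cover_below_key[OF s(1) cR' R'(2)] by blast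
    have df'': "d \<preceq> f''"
      using le_trans[OF \<open>d \<preceq> f'\<close> f''(2)] d cover_props(4)[OF s(1) cR'] R' f'' by auto
    let ?\<eta> = "\<eta>(R := f, R' := f'')"
    have ne: "R' \<noteq> R" "R' \<notin> B" using R' R A by auto
    have sel': "selection e ?\<eta> (insert R' (insert R B))"
      using sel R cR' f f'' ne by (auto simp: selection_def)
    then have selR: "selection e ?\<eta> (insert R B)" by (auto simp: selection_def)
    \<comment> \<open>The point \<open>d\<close> is itself a product of a selection, now over
      \<open>insert R B\<close>. Lying below \<open>f''\<close> would violate independence at
      \<open>R'\<close>.\<close>
    have eq: "pmeet e ?\<eta> (insert R B) = d"
    proof (rule eq_by_le)
      fix x assume x: "x \<in> carrier P"
      have "x \<preceq> pmeet e ?\<eta> (insert R B) \<longleftrightarrow> x \<preceq> e \<and> x \<preceq> f \<and> (\<forall>R\<in>B. x \<preceq> \<eta> R)"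
        using selection_pmeet(2)[OF selR x] ne R by auto
      also have "\<dots> \<longleftrightarrow> x \<preceq> d"
        using x C m selection_pmeet(2)[OF sel x] by (auto simp: d_def le_meet_iff m_def)
      finally show "x \<preceq> pmeet e ?\<eta> (insert R B) \<longleftrightarrow> x \<preceq> d" .
    qed (use selection_pmeet(1)[OF selR] d in auto)
    show False
      using selection_independent[OF sel'] ne dnz df'' by (simp add: eq nz_iff)
  qed
  moreover have "d \<preceq> e" using le_trans[OF d(2) m(3)] d m s(2) by auto
  ultimately have "d \<in> slice e A" using dnz by (auto simp: slice_def)
  then show ?thesis using d f by (auto simp: m_def)
qed

lemma selection_key_strict:
  assumes sel: "selection e \<eta> B" and R: "R \<in> covers P e" "R \<notin> B" "h \<in> Poly_Mapping.keys (bigvee P R)"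
    and nonzero: "pmeet e \<eta> B \<noteq> \<^bold>0"
  shows "\<not> pmeet e \<eta> B \<preceq> h"
proof -
  let ?\<eta> = "\<eta>(R := h)"
  have sel': "selection e ?\<eta> (insert R B)" using sel R by (auto simp: selection_def)
  then have selB: "selection e ?\<eta> B" by (auto simp: selection_def)
  have "pmeet e ?\<eta> B = pmeet e \<eta> B"
    by (rule eq_by_le)
      (use selection_pmeet[OF sel] selection_pmeet[OF selB] R in auto)
  then show ?thesis using selection_independent[OF sel' R(2)] nonzero by simp
qed

text \<open>The case of an empty selection, where the product is \<open>e\<close>. It provides the
  strict descent from \<open>e\<close> to \<open>h\<close> in the reduction of kernel
  elements.\<close>

lemma cover_key_strict:
  assumes "e \<in> nz P" "R \<in> covers P e" "h \<in> Poly_Mapping.keys (bigvee P R)"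
  shows "\<not> e \<preceq> h"
proof -
  have "selection e undefined {}" using assms by (simp add: selection_def)
  from selection_key_strict[OF this assms(2) _ assms(3)] show ?thesis
    using assms(1) by (simp add: pmeet_def nz_iff)
qed

lemma cover_strict:
  assumes "e \<in> nz P" "R \<in> covers P e" "f \<in> R"
  shows "\<not> e \<preceq> f"
proof -
  obtain f' where f': "f' \<in> R" "f \<preceq> f'" "f' \<in> Poly_Mapping.keys (bigvee P R)"
    using cover_below_key[OF assms] .
  then show ?thesis
    using cover_key_strict[OF assms(1,2) f'(3)] le_trans[of e f f'] assms cover_props(4)[OF assms(1,2)]
    by (auto simp: nz_carrier)
qed

section \<open>Slices, the point sets of the elements \<open>e(S)\<close>\<close>

lemma admissible_props:
  assumes "admissible P e S"
  shows "e \<in> nz P" "e \<in> carrier P" "finite S" "S \<noteq> {}" "R \<in> S \<Longrightarrow> R \<in> covers P e" "S \<subseteq> covers P e"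
  using assms by (auto simp: admissible_def nz_carrier)

lemma slice_top: "admissible P e S \<Longrightarrow> e \<in> slice e S"
  using cover_strict by (auto simp: slice_def admissible_def nz_carrier)

lemma slice_nz: "d \<in> slice e S \<Longrightarrow> d \<in> nz P" "d \<in> slice e S \<Longrightarrow> d \<in> carrier P" "d \<in> slice e S \<Longrightarrow> d \<preceq> e"
  by (auto simp: slice_def nz_carrier)

lemma slice_down:
  assumes "d \<in> slice e S" "e \<in> nz P" "S \<subseteq> covers P e" "d \<preceq> d'" "d' \<preceq> e" "d' \<in> carrier P"
  shows "d' \<in> slice e S"
proof -
  have d: "d \<in> nz P" "d \<in> carrier P" using assms slice_nz by auto
  then have "d' \<in> nz P" using assms le_zer by (auto simp: nz_iff)
  moreover have "\<not> d' \<preceq> f" if "R \<in> S" "f \<in> R" for R f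
  proof
    assume "d' \<preceq> f"
    then have "d \<preceq> f"
      using le_trans[OF assms(4)] d assms cover_props(4)[of e R f] that by auto
    then show False using assms(1) that by (auto simp: slice_def)
  qed
  ultimately show ?thesis using assms by (auto simp: slice_def)
qed

text \<open>A cover in \<open>S'\<close> but not in \<open>S\<close> would have a member above some
  point of \<open>slice e S\<close>, and such a point is missing from
  \<open>slice e S'\<close>.\<close>

lemma slice_eq_imp_subset:
  assumes "admissible P e S" "admissible P e S'" "slice e S = slice e S'"
  shows "S' \<subseteq> S"
proof
  fix R assume "R \<in> S'"
  note a = admissible_props[OF assms(1)]
  show "R \<in> S"
  proof (rule ccontr)
    assume "R \<notin> S"
    have "selection e undefined {}" using a by (simp add: selection_def)
    from selection_cover_meets_slice[OF this a(6) _ _ \<open>R \<notin> S\<close>]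
    obtain d f where "d \<in> slice e S" "f \<in> R" "d \<preceq> f"
      using a(1) admissible_props(5)[OF assms(2) \<open>R \<in> S'\<close>] by (auto simp: pmeet_def nz_iff)
    then show False using assms(3) \<open>R \<in> S'\<close> by (auto simp: slice_def)
  qed
qed

lemma slice_inject:
  assumes "admissible P e S" "admissible P e' S'" "slice e S = slice e' S'"
  shows "e = e'" "S = S'"
proof -
  show "e = e'"
    using slice_top[OF assms(1)] slice_top[OF assms(2)] assms slice_nz
    by (metis admissible_props(2) le_antisym)
  then show "S = S'" using slice_eq_imp_subset assms by blast
qed

lemma cond_i_cases:
  assumes "d \<in> nz P" "e \<in> nz P" "R \<in> covers P e" "d \<^bold>\<cdot> e \<noteq> \<^bold>0"
  obtains f where "f \<in> R" "d \<^bold>\<cdot> e = d \<^bold>\<cdot> f"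
  | "restricted_cover P d R \<in> covers P (d \<^bold>\<cdot> e)"
proof -
  have "d \<^bold>\<cdot> e \<in> restricted_cover P d R \<or> restricted_cover P d R \<in> covers P (d \<^bold>\<cdot> e)"
    using ci assms unfolding cond_i_def by blast
  then show thesis using that by (auto simp: restricted_cover_def)
qed

lemma le_restricted_cover:
  assumes "d \<in> nz P" "e \<in> nz P" "R \<in> covers P e" "x \<in> nz P" "x \<preceq> d"
  shows "(\<exists>f\<in>restricted_cover P d R. x \<preceq> f) \<longleftrightarrow> (\<exists>f\<in>R. x \<preceq> f)"
proof
  assume "\<exists>f\<in>restricted_cover P d R. x \<preceq> f"
  then show "\<exists>f\<in>R. x \<preceq> f"
    using assms cover_props(4)[OF assms(2,3)] by (auto simp: restricted_cover_def le_meet_iff nz_carrier)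
next
  assume "\<exists>f\<in>R. x \<preceq> f"
  then obtain f where f: "f \<in> R" "x \<preceq> f" by auto
  have C: "f \<in> carrier P" "x \<in> carrier P" "d \<in> carrier P"
    using f cover_props(4)[OF assms(2,3)] assms by (auto simp: nz_carrier)
  have le: "x \<preceq> d \<^bold>\<cdot> f" using C f assms by (simp add: le_meet_iff)
  \<comment> \<open>Restriction discards only zero products, and this one lies above the nonzero
    \<open>x\<close>.\<close>
  then have "d \<^bold>\<cdot> f \<in> nz P" using C assms(4) le_zer[of x] by (auto simp: nz_iff)
  then show "\<exists>f\<in>restricted_cover P d R. x \<preceq> f"
    using f le by (auto simp: restricted_cover_def)
qed

lemma slice_restrict:
  assumes d: "d \<in> nz P" and adm: "admissible P e S" and ne: "x \<in> slice e S" "x \<preceq> d"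
  shows "admissible P (d \<^bold>\<cdot> e) (restricted_cover P d ` S)"
    "{x \<in> slice e S. x \<preceq> d} = slice (d \<^bold>\<cdot> e) (restricted_cover P d ` S)"
proof -
  note a = admissible_props[OF adm]
  have C: "d \<in> carrier P" "e \<in> carrier P" "x \<in> carrier P" "x \<preceq> e" "x \<noteq> \<^bold>0"
    using d a ne(1) slice_nz nz_iff by auto
  have xde: "x \<preceq> d \<^bold>\<cdot> e" using C ne by (simp add: le_meet_iff)
  then have de: "d \<^bold>\<cdot> e \<noteq> \<^bold>0" using C le_zer[of x] by auto
  then have denz: "d \<^bold>\<cdot> e \<in> nz P" using C by (simp add: nz_iff)
  have "restricted_cover P d R \<in> covers P (d \<^bold>\<cdot> e)" if "R \<in> S" for R
  proof (rule cond_i_cases[OF d a(1) a(5)[OF that] de])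
    fix f assume f: "f \<in> R" "d \<^bold>\<cdot> e = d \<^bold>\<cdot> f"
    then have "x \<preceq> f"
      using xde C cover_props(4)[OF a(1) a(5)[OF that] f(1)] by (simp add: le_meet_iff)
    then show ?thesis using ne(1) that f by (auto simp: slice_def)
  qed
  then show "admissible P (d \<^bold>\<cdot> e) (restricted_cover P d ` S)"
    using denz a by (auto simp: admissible_def)
  show "{x \<in> slice e S. x \<preceq> d} = slice (d \<^bold>\<cdot> e) (restricted_cover P d ` S)"
    using le_restricted_cover[OF d a(1) a(5)] C
    by (fastforce simp: slice_def le_meet_iff nz_carrier)
qed

lemma slice_Int:
  assumes e: "admissible P e S" and d: "admissible P d T" and ne: "slice d T \<inter> slice e S \<noteq> {}"
  shows "admissible P (d \<^bold>\<cdot> e) (restricted_cover P e ` T \<union> restricted_cover P d ` S)"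
    "slice d T \<inter> slice e S = slice (d \<^bold>\<cdot> e) (restricted_cover P e ` T \<union> restricted_cover P d ` S)"
proof -
  obtain x where x: "x \<in> slice d T" "x \<in> slice e S" using ne by auto
  note ae = admissible_props[OF e] and ad = admissible_props[OF d]
  note 1 = slice_restrict[OF ad(1) e x(2) slice_nz(3)[OF x(1)]]
  note 2 = slice_restrict[OF ae(1) d x(1) slice_nz(3)[OF x(2)], unfolded meet_comm[OF ae(2) ad(2)]]
  show "admissible P (d \<^bold>\<cdot> e) (restricted_cover P e ` T \<union> restricted_cover P d ` S)"
    using 1(1) 2(1) by (auto simp: admissible_def)
  have "slice d T \<inter> slice e S = {x \<in> slice e S. x \<preceq> d} \<inter> {x \<in> slice d T. x \<preceq> e}"
    by (auto simp: slice_def)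
  also have "\<dots> = slice (d \<^bold>\<cdot> e) (restricted_cover P e ` T \<union> restricted_cover P d ` S)"
    unfolding 1(2) 2(2) by (auto simp: slice_def)
  finally show "slice d T \<inter> slice e S = slice (d \<^bold>\<cdot> e) (restricted_cover P e ` T \<union> restricted_cover P d ` S)" .
qed

section \<open>The elements \<open>e(S)\<close> of the algebra and their values\<close>

lemma cover_diff_factor_closed:
  "e \<in> nz P \<Longrightarrow> R \<in> covers P e \<Longrightarrow> frag_of e - bigvee P R \<in> carrier (ZE P)"
  using cover_props[of e R] by (auto intro!: ZE_diff bigvee_closed)

lemma cov_diff_closed: "admissible P e S \<Longrightarrow> cov_diff P e S \<in> carrier (ZE P)"
  unfolding cov_diff_def admissible_def by (auto intro!: zprod_closed cover_diff_factor_closed)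

lemma chr_cov_diff:
  assumes \<chi>: "character \<chi>" and adm: "admissible P e S"
  shows "chr \<chi> (cov_diff P e S) = of_bool (\<chi> e \<and> (\<forall>R\<in>S. \<forall>f\<in>R. \<not> \<chi> f))"
proof -
  note a = admissible_props[OF adm]
  have "chr \<chi> (cov_diff P e S) = (\<Prod>R\<in>S. chr \<chi> (frag_of e - bigvee P R))"
    unfolding cov_diff_def using a by (intro chr_zprod[OF \<chi>]) (auto intro: cover_diff_factor_closed)
  also have "\<dots> = (\<Prod>R\<in>S. of_bool (\<chi> e \<and> (\<forall>f\<in>R. \<not> \<chi> f)))"
  proof (rule prod.cong)
    fix R assume "R \<in> S"
    note R = cover_props[OF a(1) a(5)[OF this]]
    \<comment> \<open>Members of a cover lie below \<open>e\<close>, so each factor takes only the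
      values 0 and 1.\<close>
    have "\<chi> e" if "f \<in> R" "\<chi> f" for f
      using character_mono[OF \<chi>] R that a by blast
    then show "chr \<chi> (frag_of e - bigvee P R) = of_bool (\<chi> e \<and> (\<forall>f\<in>R. \<not> \<chi> f))"
      by (auto simp: chr_bigvee[OF \<chi> R(1,2)])
  qed simp
  also have "\<dots> = of_bool (\<forall>R\<in>S. \<chi> e \<and> (\<forall>f\<in>R. \<not> \<chi> f))"
    using a(3) by (induction rule: finite_induct) auto
  also have "(\<forall>R\<in>S. \<chi> e \<and> (\<forall>f\<in>R. \<not> \<chi> f)) \<longleftrightarrow> \<chi> e \<and> (\<forall>R\<in>S. \<forall>f\<in>R. \<not> \<chi> f)"
    using a(4) by auto
  finally show ?thesis .
qed

lemma chr_cov_diff_le: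
  "admissible P e S \<Longrightarrow> d \<in> nz P \<Longrightarrow> chr (\<lambda>e. d \<preceq> e) (cov_diff P e S) = of_bool (d \<in> slice e S)"
  by (subst chr_cov_diff) (auto simp: character_le slice_def)

end

section \<open>The derived pair\<close>

text \<open>The injection \<open>c\<close> stays abstract, so that one argument serves the first
  stage, with \<open>Lvl1\<close>, and all later stages, with \<open>encode\<close>.\<close>

locale derivation = cover_pair \<Gamma> P
  for \<Gamma> :: "('g, 'm) monoid_scheme" and P :: "('a, 'g) cov_semilattice" +
  fixes c :: "('a \<Rightarrow>\<^sub>0 int) \<Rightarrow> 'b"
  assumes inj_c: "inj c"
begin

abbreviation Q :: "('b, 'g) cov_semilattice" where
  "Q \<equiv> transport c (derived P)"

definition pt :: "'a \<Rightarrow> 'a set set \<Rightarrow> 'b" where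
  "pt e S = c (cov_diff P e S)"

definition low :: "'a \<Rightarrow> 'a \<Rightarrow> 'a set set \<Rightarrow> 'b" where
  "low d e S = c (zmult P (frag_of d) (cov_diff P e S))"

definition dcov :: "'a \<Rightarrow> 'a set set \<Rightarrow> 'a set \<Rightarrow> 'b set" where
  "dcov e S R = insert (pt e (insert R S)) ((\<lambda>f. low f e S) ` R - {c 0})"

text \<open>On the carrier of \<open>Q\<close> the values are only 0 and 1, so this set determines
  \<open>u\<close>; identities in \<open>Q\<close> are verified on it.\<close>

definition pts :: "'b \<Rightarrow> 'a set" where
  "pts u = {d \<in> nz P. chr (\<lambda>e. d \<preceq> e) (the_inv c u) = 1}"

lemma the_inv_c [simp]: "the_inv c (c x) = x"
  by (rule the_inv_f_f[OF inj_c])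

lemma c_eq_iff [simp]: "c x = c y \<longleftrightarrow> x = y"
  using inj_c by (auto dest: injD)

lemma Q_simps:
  "carrier Q = c ` derived_carrier P"
  "sl_mult Q u v = c (zmult P (the_inv c u) (the_inv c v))"
  "sl_zero Q = c 0"
  by (simp_all add: transport_def derived_def)

lemma cov_diff_nonzero: "admissible P e S \<Longrightarrow> cov_diff P e S \<noteq> 0"
proof
  assume adm: "admissible P e S" and "cov_diff P e S = 0"
  then have "chr (\<lambda>f. e \<preceq> f) (cov_diff P e S) = 0" by simp
  then show False
    using chr_cov_diff_le[OF adm admissible_props(1)[OF adm]] slice_top[OF adm] by simp
qed

section \<open>The derived semilattice as a semilattice of sets\<close>

lemma carrier_Q_cases:
  assumes "u \<in> carrier Q"
  obtains "u = c 0" | e S where "admissible P e S" "u = pt e S"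
  using assms that by (auto simp: Q_simps derived_carrier_def pt_def)

lemma zero_in_Q [simp]: "c 0 \<in> carrier Q"
  by (auto simp: Q_simps derived_carrier_def)

lemma pt_carrier [simp]: "admissible P e S \<Longrightarrow> pt e S \<in> carrier Q"
  by (auto simp: Q_simps derived_carrier_def pt_def)

lemma nz_Q_iff: "u \<in> nz Q \<longleftrightarrow> u \<in> carrier Q \<and> u \<noteq> c 0"
  by (simp add: nz_def Q_simps(3))

lemma pt_nz: "admissible P e S \<Longrightarrow> pt e S \<in> nz Q"
  using cov_diff_nonzero by (auto simp: nz_Q_iff) (simp add: pt_def)

lemma nz_Q_cases:
  assumes "u \<in> nz Q"
  obtains e S where "admissible P e S" "u = pt e S"
proof -
  have u: "u \<in> carrier Q" "u \<noteq> c 0" using assms by (simp_all add: nz_Q_iff)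
  show thesis by (rule carrier_Q_cases[OF u(1)]) (use u(2) that in blast)+
qed

lemma pts_zero [simp]: "pts (c 0) = {}"
  by (simp add: pts_def)

lemma pts_pt: "admissible P e S \<Longrightarrow> pts (pt e S) = slice e S"
  by (auto simp: pts_def pt_def chr_cov_diff_le slice_nz)

lemma pts_sub: "pts u \<subseteq> nz P"
  by (auto simp: pts_def)

lemma rep:
  assumes "u \<in> carrier Q"
  shows "the_inv c u \<in> carrier (ZE P)" "c (the_inv c u) = u"
    "d \<in> nz P \<Longrightarrow> chr (\<lambda>e. d \<preceq> e) (the_inv c u) = of_bool (d \<in> pts u)"
proof -
  show "the_inv c u \<in> carrier (ZE P)" "c (the_inv c u) = u"
    using assms by (cases rule: carrier_Q_cases; simp add: pt_def cov_diff_closed)+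
  show "chr (\<lambda>e. d \<preceq> e) (the_inv c u) = of_bool (d \<in> pts u)" if "d \<in> nz P"
    using assms
  proof (cases rule: carrier_Q_cases)
    case (2 e S)
    then show ?thesis using that by (simp only: pts_pt) (simp add: pt_def chr_cov_diff_le)
  qed simp
qed

lemma pts_eqI:
  assumes "x \<in> carrier (ZE P)" "u \<in> carrier Q"
    and "\<And>d. d \<in> nz P \<Longrightarrow> chr (\<lambda>e. d \<preceq> e) x = of_bool (d \<in> pts u)"
  shows "c x = u"
proof -
  have "x = the_inv c u"
    by (rule ZE_eqI) (use assms rep[OF assms(2)] in auto)
  then show ?thesis using rep(2)[OF assms(2)] by simp
qed

lemma pts_inject:
  assumes "u \<in> carrier Q" "v \<in> carrier Q" "pts u = pts v"
  shows "u = v"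
  using pts_eqI[OF rep(1)[OF assms(1)] assms(2)] rep(2,3)[OF assms(1)] assms(3) by simp

lemma pts_empty_iff: "u \<in> carrier Q \<Longrightarrow> pts u = {} \<longleftrightarrow> u = c 0"
  using pts_inject[of u "c 0"] by auto

lemma nz_Q_pts: "u \<in> nz Q \<longleftrightarrow> u \<in> carrier Q \<and> pts u \<noteq> {}"
  using pts_empty_iff by (auto simp: nz_Q_iff)

text \<open>Criterion for membership in the derived semilattice: it suffices that an algebra element
  takes the values of the indicator of a slice or of the empty set. Products, the elements
  \<open>d e(S)\<close> and translates by the group are all recognised this way.\<close>

lemma from_ZE:
  assumes x: "x \<in> carrier (ZE P)" and chr: "\<And>d. d \<in> nz P \<Longrightarrow> chr (\<lambda>e. d \<preceq> e) x = of_bool (d \<in> X)"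
    and X: "X \<subseteq> nz P" "X \<noteq> {} \<Longrightarrow> \<exists>e S. admissible P e S \<and> X = slice e S"
  shows "c x \<in> carrier Q" "pts (c x) = X"
proof -
  have "\<exists>u\<in>carrier Q. pts u = X"
    using X(2) pts_pt pt_carrier pts_zero zero_in_Q by (cases "X = {}") metis+
  then obtain u where "u \<in> carrier Q" "pts u = X" by blast
  moreover from this have "c x = u" using chr by (intro pts_eqI[OF x]) auto
  ultimately show "c x \<in> carrier Q" "pts (c x) = X" by auto
qed

lemma mult_Q:
  assumes "u \<in> carrier Q" "v \<in> carrier Q"
  shows "sl_mult Q u v \<in> carrier Q" "pts (sl_mult Q u v) = pts u \<inter> pts v"
proof -
  let ?x = "zmult P (the_inv c u) (the_inv c v)"
  have x: "?x \<in> carrier (ZE P)" using rep(1) assms zmult_closed by blast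
  have chr: "chr (\<lambda>e. d \<preceq> e) ?x = of_bool (d \<in> pts u \<inter> pts v)" if "d \<in> nz P" for d
    using that assms by (simp add: chr_zmult character_le rep)
  have ex: "\<exists>e S. admissible P e S \<and> pts u \<inter> pts v = slice e S" if "pts u \<inter> pts v \<noteq> {}"
  proof -
    have "u \<in> nz Q" "v \<in> nz Q" using assms that nz_Q_pts by auto
    then obtain e S d T where e: "admissible P e S" "u = pt e S" and d: "admissible P d T" "v = pt d T"
      by (elim nz_Q_cases) blast
    show ?thesis
      using slice_Int[OF d(1) e(1)] that e d by (auto simp: pts_pt)
  qed
  have sub: "pts u \<inter> pts v \<subseteq> nz P" using pts_sub by blast
  show "sl_mult Q u v \<in> carrier Q" "pts (sl_mult Q u v) = pts u \<inter> pts v"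
    unfolding Q_simps(2) by (rule from_ZE[OF x chr sub ex]; assumption)+
qed

lemma low_Q:
  assumes "d \<in> nz P" "admissible P e S"
  shows "low d e S \<in> carrier Q" "pts (low d e S) = {x \<in> slice e S. x \<preceq> d}"
proof -
  let ?x = "zmult P (frag_of d) (cov_diff P e S)"
  have x: "?x \<in> carrier (ZE P)" using assms by (intro zmult_closed) (auto simp: cov_diff_closed)
  have chr: "chr (\<lambda>e. y \<preceq> e) ?x = of_bool (y \<in> {x \<in> slice e S. x \<preceq> d})" if "y \<in> nz P" for y
    using that assms by (simp add: chr_zmult character_le cov_diff_closed chr_cov_diff_le conj_commute)
  have ex: "\<exists>e' S'. admissible P e' S' \<and> {x \<in> slice e S. x \<preceq> d} = slice e' S'"
    if "{x \<in> slice e S. x \<preceq> d} \<noteq> {}"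
    using slice_restrict[OF assms] that by blast
  have sub: "{x \<in> slice e S. x \<preceq> d} \<subseteq> nz P" by (auto simp: slice_def)
  show "low d e S \<in> carrier Q" "pts (low d e S) = {x \<in> slice e S. x \<preceq> d}"
    unfolding low_def by (rule from_ZE[OF x chr sub ex]; assumption)+
qed

lemma semilattice_Q: "is_semilattice Q"
proof -
  have assoc: "sl_mult Q (sl_mult Q u v) w = sl_mult Q u (sl_mult Q v w)"
    if "u \<in> carrier Q" "v \<in> carrier Q" "w \<in> carrier Q" for u v w
    by (rule pts_inject) (use that in \<open>auto simp: mult_Q\<close>)
  have comm: "sl_mult Q u v = sl_mult Q v u" if "u \<in> carrier Q" "v \<in> carrier Q" for u v
    by (rule pts_inject) (use that in \<open>auto simp: mult_Q\<close>)
  have idem: "sl_mult Q u u = u" if "u \<in> carrier Q" for u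
    by (rule pts_inject) (use that in \<open>auto simp: mult_Q\<close>)
  have zero: "sl_mult Q (c 0) u = c 0" if "u \<in> carrier Q" for u
    by (rule pts_inject) (use that in \<open>auto simp: mult_Q\<close>)
  show ?thesis
    unfolding is_semilattice_def Q_simps(3)
    by (intro conjI ballI zero_in_Q mult_Q(1) assoc comm idem zero)
qed

sublocale QS: semilattice_record Q
  by unfold_locales (rule semilattice_Q)

lemma le_Q_iff: "u \<in> carrier Q \<Longrightarrow> v \<in> carrier Q \<Longrightarrow> sl_le Q u v \<longleftrightarrow> pts u \<subseteq> pts v"
  unfolding sl_le_def by (metis inf.orderE inf_le2 mult_Q pts_inject)

lemma pt_inject:
  "admissible P e S \<Longrightarrow> admissible P e' S' \<Longrightarrow> pt e S = pt e' S' \<longleftrightarrow> e = e' \<and> S = S'"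
  using slice_inject[of e S e' S'] pts_pt[of e S] pts_pt[of e' S'] by auto

section \<open>Derived covers and conditions (i) and (ii)\<close>

lemma dcov_alt: "c ` derived_cover P e S R = dcov e S R"
  unfolding derived_cover_def dcov_def pt_def low_def by auto

text \<open>\<open>derived\<close> collects covers over all presentations of an element;
  \<open>pt_inject\<close> leaves only one presentation.\<close>

lemma covers_Q:
  assumes "admissible P e S"
  shows "covers Q (pt e S) = {dcov e S R | R. R \<in> covers P e - S}"
proof -
  have "covers Q (pt e S) = {dcov e' S' R | e' S' R. admissible P e' S' \<and> pt e S = pt e' S' \<and> R \<in> covers P e' - S'}"
    by (auto simp: transport_def derived_def pt_def simp flip: dcov_alt)
  also have "\<dots> = {dcov e S R | R. R \<in> covers P e - S}"
    using assms by (auto simp: pt_inject)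
  finally show ?thesis .
qed

lemma admissible_insert: "admissible P e S \<Longrightarrow> R \<in> covers P e \<Longrightarrow> admissible P e (insert R S)"
  by (auto simp: admissible_def)

lemma slice_insert: "slice e (insert R S) = {x \<in> slice e S. \<forall>f\<in>R. \<not> x \<preceq> f}"
  by (auto simp: slice_def)

lemma mem_dcov_iff:
  assumes adm: "admissible P e S" and R: "R \<in> covers P e"
  shows "v \<in> dcov e S R \<longleftrightarrow> v \<in> nz Q \<and>
    (pts v = slice e (insert R S) \<or> (\<exists>f\<in>R. pts v = {x \<in> slice e S. x \<preceq> f}))"
proof -
  note a = admissible_props[OF adm]
  note adm' = admissible_insert[OF adm R]
  have 1: "v = pt e (insert R S) \<longleftrightarrow> v \<in> nz Q \<and> pts v = slice e (insert R S)"
    using pt_nz[OF adm'] pts_pt[OF adm'] pts_inject[of v "pt e (insert R S)"] by (auto simp: nz_Q_iff)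
  have 2: "v = low f e S \<longleftrightarrow> v \<in> carrier Q \<and> pts v = {x \<in> slice e S. x \<preceq> f}" if "f \<in> R" for f
    using low_Q[OF cover_props(3)[OF a(1) R that] adm] pts_inject[of v "low f e S"] by auto
  have "v \<in> dcov e S R \<longleftrightarrow> v = pt e (insert R S) \<or> v \<noteq> c 0 \<and> (\<exists>f\<in>R. v = low f e S)"
    by (auto simp: dcov_def)
  also have "\<dots> \<longleftrightarrow> v \<in> nz Q \<and>
      (pts v = slice e (insert R S) \<or> (\<exists>f\<in>R. pts v = {x \<in> slice e S. x \<preceq> f}))"
    unfolding 1 using 2 nz_Q_iff[of v] by blast
  finally show ?thesis .
qed

text \<open>A point of the slice either lies below a member of \<open>R\<close> or survives in
  \<open>slice e (insert R S)\<close>. This gives the covering property and also the vanishing of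
  the boundary on the next relations.\<close>

lemma pts_dcov:
  assumes adm: "admissible P e S" and R: "R \<in> covers P e"
  shows "(\<exists>v\<in>dcov e S R. d \<in> pts v) \<longleftrightarrow> d \<in> slice e S"
proof
  assume "\<exists>v\<in>dcov e S R. d \<in> pts v"
  then show "d \<in> slice e S" using mem_dcov_iff[OF adm R] by (auto simp: slice_insert)
next
  assume d: "d \<in> slice e S"
  show "\<exists>v\<in>dcov e S R. d \<in> pts v"
  proof (cases "\<exists>f\<in>R. d \<preceq> f")
    case True
    then obtain f where f: "f \<in> R" "d \<preceq> f" by auto
    note l = low_Q[OF cover_props(3)[OF admissible_props(1)[OF adm] R f(1)] adm]
    have "low f e S \<in> dcov e S R"
      unfolding mem_dcov_iff[OF adm R] using l f d by (auto simp: nz_Q_pts)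
    then show ?thesis using l(2) f d by auto
  next
    case False
    then have "d \<in> pts (pt e (insert R S))"
      using d by (simp add: pts_pt[OF admissible_insert[OF adm R]] slice_insert)
    then show ?thesis unfolding dcov_def by blast
  qed
qed

lemma dcov_finite_cover:
  assumes adm: "admissible P e S" and R: "R \<in> covers P e"
  shows "finite_cover Q (pt e S) (dcov e S R)"
proof -
  note a = admissible_props[OF adm]
  note m = mem_dcov_iff[OF adm R]
  have "finite (dcov e S R)"
    unfolding dcov_def using cover_props(1)[OF a(1) R] by simp
  moreover have "dcov e S R \<subseteq> nz Q" using m by blast
  moreover have "sl_le Q v (pt e S)" if "v \<in> dcov e S R" for v
    using that adm unfolding m by (subst le_Q_iff) (auto simp: nz_Q_iff pts_pt slice_insert)
  moreover have "\<exists>v\<in>dcov e S R. sl_mult Q w v \<noteq> sl_zero Q" if w: "w \<in> nz Q" "sl_le Q w (pt e S)" for w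
  proof -
    have wC: "w \<in> carrier Q" "pts w \<noteq> {}" using w by (auto simp: nz_Q_pts)
    then obtain x where x: "x \<in> pts w" by auto
    have "pts w \<subseteq> slice e S" using w adm wC by (simp add: le_Q_iff pts_pt)
    with x have xs: "x \<in> slice e S" by auto
    then have "\<exists>v\<in>dcov e S R. x \<in> pts v" using pts_dcov[OF adm R] by simp
    then obtain v where v: "v \<in> dcov e S R" "x \<in> pts v" by auto
    have vC: "v \<in> carrier Q" using v m nz_Q_iff by blast
    have "x \<in> pts (sl_mult Q w v)" using mult_Q(2)[OF wC(1) vC] x v by simp
    then have "sl_mult Q w v \<noteq> sl_zero Q" by (auto simp: Q_simps(3))
    then show ?thesis using v by blast
  qed
  ultimately show ?thesis unfolding finite_cover_def by blast
qed

lemma collection_Q: "collection_of_finite_covers Q"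
  unfolding collection_of_finite_covers_def
proof (intro ballI)
  fix u R' assume "u \<in> nz Q" "R' \<in> covers Q u"
  then show "finite_cover Q u R'"
    by (elim nz_Q_cases) (auto simp: covers_Q intro: dcov_finite_cover)
qed

text \<open>With \<open>u = d(T)\<close> and \<open>v = e(S)\<close>, condition (i) is applied to
  \<open>d\<close>, \<open>e\<close> and \<open>R\<close>. If \<open>d e = d f\<close> with
  \<open>f\<close> in \<open>R\<close>, then \<open>u v\<close> is the product of \<open>u\<close>
  with \<open>f e(S)\<close>. Otherwise \<open>d \<cdot> R\<close> covers \<open>d e\<close> and
  gives rise to the restricted cover, unless it already belongs to the set \<open>S'\<close>
  presenting \<open>u v\<close>.\<close>

lemma cond_i_Q: "cond_i Q"
  unfolding cond_i_def
proof (intro ballI impI)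
  fix u v R'
  assume u: "u \<in> nz Q" and v: "v \<in> nz Q" and R': "R' \<in> covers Q v" and uv: "sl_mult Q u v \<noteq> sl_zero Q"
  obtain d T where d: "admissible P d T" "u = pt d T" using u by (rule nz_Q_cases)
  obtain e S where e: "admissible P e S" "v = pt e S" using v by (rule nz_Q_cases)
  obtain R where R: "R \<in> covers P e" "R' = dcov e S R" using R' covers_Q[OF e(1)] e(2) by auto
  note ad = admissible_props[OF d(1)] and ae = admissible_props[OF e(1)]
  have C: "u \<in> carrier Q" "v \<in> carrier Q" using u v by (auto simp: nz_Q_iff)
  note uvQ = mult_Q[OF C]
  have pu: "pts u = slice d T" and pv: "pts v = slice e S" using d e by (simp_all add: pts_pt)
  have ne: "slice d T \<inter> slice e S \<noteq> {}"
    using uv uvQ pts_empty_iff[OF uvQ(1)] by (simp add: pu pv Q_simps(3))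
  define S' where "S' = restricted_cover P e ` T \<union> restricted_cover P d ` S"
  have adm': "admissible P (d \<^bold>\<cdot> e) S'" and sl': "slice d T \<inter> slice e S = slice (d \<^bold>\<cdot> e) S'"
    using slice_Int[OF e(1) d(1) ne] by (simp_all add: S'_def)
  have puv: "pts (sl_mult Q u v) = slice (d \<^bold>\<cdot> e) S'" using uvQ(2) pu pv sl' by simp
  have uvpt: "sl_mult Q u v = pt (d \<^bold>\<cdot> e) S'"
    using puv uvQ(1) adm' by (intro pts_inject) (simp_all add: pts_pt)
  have de: "d \<^bold>\<cdot> e \<noteq> \<^bold>0" using admissible_props(1)[OF adm'] by (simp add: nz_iff)
  note mR = mem_dcov_iff[OF e(1) R(1)]
  have memI: "w \<in> restricted_cover Q u R'"
    if "w \<in> nz Q" "v' \<in> R'" "pts w = slice d T \<inter> pts v'" for w v'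
  proof -
    have v'C: "v' \<in> carrier Q" using that(2) mR R(2) by (auto simp: nz_Q_iff)
    have "w = sl_mult Q u v'"
      using that pu mult_Q[OF C(1) v'C] by (intro pts_inject) (auto simp: nz_Q_iff)
    then show ?thesis using that unfolding restricted_cover_def by blast
  qed
  have uvnz: "sl_mult Q u v \<in> nz Q" using uv uvQ by (simp add: nz_def)
  have lowR: "low f e S \<in> R'" if "f \<in> R" "slice d T \<inter> {x \<in> slice e S. x \<preceq> f} \<noteq> {}" for f
    using that R(2) low_Q[OF cover_props(3)[OF ae(1) R(1) that(1)] e(1)] mR by (auto simp: nz_Q_pts)
  have ptR: "pt e (insert R S) \<in> R'" using R(2) by (simp add: dcov_def)
  have ptp: "pts (pt e (insert R S)) = slice e (insert R S)"
    by (rule pts_pt[OF admissible_insert[OF e(1) R(1)]])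
  have below: "x \<in> nz P" "x \<in> carrier P" "x \<preceq> d" "x \<preceq> e" "x \<preceq> d \<^bold>\<cdot> e" if "x \<in> slice d T" "x \<in> slice e S" for x
    using that ad(2) ae(2) slice_nz by (auto simp: le_meet_iff)
  show "sl_mult Q u v \<in> restricted_cover Q u R' \<or> restricted_cover Q u R' \<in> covers Q (sl_mult Q u v)"
  proof (rule cond_i_cases[OF ad(1) ae(1) R(1) de])
    fix f assume f: "f \<in> R" "d \<^bold>\<cdot> e = d \<^bold>\<cdot> f"
    have fC: "f \<in> carrier P" using cover_props(4)[OF ae(1) R(1) f(1)] .
    have eq: "slice d T \<inter> slice e S = slice d T \<inter> {x \<in> slice e S. x \<preceq> f}"
      using below f(2) ad(2) fC by (auto simp: le_meet_iff)
    then have "pts (sl_mult Q u v) = slice d T \<inter> pts (low f e S)"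
      using low_Q[OF cover_props(3)[OF ae(1) R(1) f(1)] e(1)] uvQ pu pv by simp
    then show ?thesis using memI[OF uvnz lowR[OF f(1)]] ne eq by simp
  next
    define R0 where "R0 = restricted_cover P d R"
    assume "restricted_cover P d R \<in> covers P (d \<^bold>\<cdot> e)"
    then have R0: "R0 \<in> covers P (d \<^bold>\<cdot> e)" by (simp add: R0_def)
    have leR: "(\<exists>f\<in>R0. x \<preceq> f) \<longleftrightarrow> (\<exists>f\<in>R. x \<preceq> f)" if "x \<in> slice d T" "x \<in> slice e S" for x
      unfolding R0_def by (rule le_restricted_cover[OF ad(1) ae(1) R(1)]) (use below that in auto)
    have i1: "slice d T \<inter> slice e (insert R S) = slice (d \<^bold>\<cdot> e) (insert R0 S')"
      unfolding slice_insert sl'[symmetric] using leR by blast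
    have i2: "slice d T \<inter> {x \<in> slice e S. x \<preceq> f} = {x \<in> slice (d \<^bold>\<cdot> e) S'. x \<preceq> d \<^bold>\<cdot> f}" if "f \<in> R" for f
      unfolding sl'[symmetric] using below cover_props(4)[OF ae(1) R(1) that] ad(2)
      by (auto simp: le_meet_iff)
    show ?thesis
    proof (cases "R0 \<in> S'")
      case True
      \<comment> \<open>Removing the points below \<open>R\<close> takes nothing away from
        \<open>u v\<close>, so \<open>u v\<close> is the product of \<open>u\<close> with
        \<open>e(S \<union> {R})\<close>, a member of the cover.\<close>
      then have "insert R0 S' = S'" by auto
      then have "pts (sl_mult Q u v) = slice d T \<inter> pts (pt e (insert R S))"
        using i1 puv ptp by simp
      then show ?thesis using memI[OF uvnz ptR] by simp
    next
      case False
      note mR0 = mem_dcov_iff[OF adm' R0]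
      have "restricted_cover Q u R' = dcov (d \<^bold>\<cdot> e) S' R0"
      proof (intro equalityI subsetI)
        fix w assume "w \<in> restricted_cover Q u R'"
        then obtain v' where v': "v' \<in> R'" "w = sl_mult Q u v'" "w \<in> nz Q"
          by (auto simp: restricted_cover_def)
        have v'C: "v' \<in> carrier Q" using v'(1) mR R(2) by (auto simp: nz_Q_iff)
        have pw: "pts w = slice d T \<inter> pts v'" using v'(2) mult_Q(2)[OF C(1) v'C] pu by simp
        consider "pts v' = slice e (insert R S)" | f where "f \<in> R" "pts v' = {x \<in> slice e S. x \<preceq> f}"
          using v'(1) mR R(2) by auto
        then show "w \<in> dcov (d \<^bold>\<cdot> e) S' R0"
        proof cases
          case 1
          then show ?thesis unfolding mR0 using pw i1 v'(3) by simp
        next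
          case 2
          then have pw': "pts w = {x \<in> slice (d \<^bold>\<cdot> e) S'. x \<preceq> d \<^bold>\<cdot> f}" using pw i2 by simp
          have fC: "f \<in> carrier P" using cover_props(4)[OF ae(1) R(1) 2(1)] .
          obtain x where "x \<in> pts w" using v'(3) by (auto simp: nz_Q_pts)
          then have "x \<in> nz P" "x \<preceq> d \<^bold>\<cdot> f" using pw' slice_nz by auto
          then have "d \<^bold>\<cdot> f \<in> nz P" using fC ad(2) le_zer[of x] by (auto simp: nz_iff)
          then have "d \<^bold>\<cdot> f \<in> R0" using 2(1) by (simp add: R0_def restricted_cover_def)
          then show ?thesis unfolding mR0 using pw' v'(3) by blast
        qed
      next
        fix w assume "w \<in> dcov (d \<^bold>\<cdot> e) S' R0"
        then have w: "w \<in> nz Q" and "pts w = slice (d \<^bold>\<cdot> e) (insert R0 S') \<or>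
            (\<exists>g\<in>R0. pts w = {x \<in> slice (d \<^bold>\<cdot> e) S'. x \<preceq> g})"
          unfolding mR0 by auto
        then consider "pts w = slice (d \<^bold>\<cdot> e) (insert R0 S')"
          | f where "f \<in> R" "pts w = {x \<in> slice (d \<^bold>\<cdot> e) S'. x \<preceq> d \<^bold>\<cdot> f}"
          unfolding R0_def restricted_cover_def by auto
        then show "w \<in> restricted_cover Q u R'"
        proof cases
          case 1
          then show ?thesis using memI[OF w ptR] i1 ptp by simp
        next
          case 2
          then have pw: "pts w = slice d T \<inter> {x \<in> slice e S. x \<preceq> f}" using i2 by simp
          moreover have "pts w \<noteq> {}" using w nz_Q_pts by simp
          ultimately show ?thesis
            using memI[OF w lowR[OF 2(1)]] low_Q(2)[OF cover_props(3)[OF ae(1) R(1) 2(1)] e(1)] by simp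
        qed
      qed
      then have "restricted_cover Q u R' \<in> covers Q (sl_mult Q u v)"
        unfolding uvpt covers_Q[OF adm'] using R0 False by blast
      then show ?thesis ..
    qed
  qed
qed

text \<open>The element \<open>e(S \<union> {R})\<close> is orthogonal to all \<open>f e(S)\<close>
  with \<open>f\<close> in \<open>R\<close>, so it splits off the join as a summand; multiplication
  by \<open>e(S)\<close> carries \<open>\<Or>R\<close> to the join of the rest. Both (ii) for the
  derived pair and the reduction modulo its ideal rest on this formula.\<close>

lemma bigvee_dcov:
  assumes adm: "admissible P e S" and R: "R \<in> covers P e"
  shows "bigvee Q (dcov e S R) =
    frag_of (pt e (insert R S)) + frag_extend (\<lambda>h. basis_elt Q (low h e S)) (bigvee P R)"
proof (rule QS.ZE_eqI)
  note a = admissible_props[OF adm]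
  note cR = cover_props[OF a(1) R]
  have fin: "finite (dcov e S R)" "dcov e S R \<subseteq> nz Q"
    using dcov_finite_cover[OF adm R] by (auto simp: finite_cover_def)
  show "bigvee Q (dcov e S R) \<in> carrier (ZE Q)"
    by (rule QS.bigvee_closed[OF fin])
  have lowC: "low h e S \<in> carrier Q" "pts (low h e S) = {x \<in> slice e S. x \<preceq> h}"
    if "h \<in> Poly_Mapping.keys (bigvee P R)" for h
    using low_Q[OF cover_key_props(1)[OF a(1) R that] adm] .
  have ptnz: "pt e (insert R S) \<in> nz Q" by (rule pt_nz[OF admissible_insert[OF adm R]])
  show "frag_of (pt e (insert R S)) + frag_extend (\<lambda>h. basis_elt Q (low h e S)) (bigvee P R) \<in> carrier (ZE Q)"
    using lowC ptnz by (intro QS.ZE_add QS.ZE_frag_extend QS.basis_elt_closed) auto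
  fix w assume w: "w \<in> nz Q"
  then have wC: "w \<in> carrier Q" by (simp add: nz_Q_iff)
  obtain g T where g: "admissible P g T" "w = pt g T" using w by (rule nz_Q_cases)
  have pw: "pts w = slice g T" using g by (simp add: pts_pt)
  note gg = admissible_props[OF g(1)] slice_top[OF g(1)]
  let ?L = "pts w \<subseteq> slice e S"
  \<comment> \<open>Since \<open>g\<close> is the largest point of \<open>w\<close>, all points of
    \<open>w\<close> lie below \<open>h\<close> as soon as \<open>g\<close> does.\<close>
  have lw: "sl_le Q w v \<longleftrightarrow> ?L \<and> g \<preceq> h"
    if "v \<in> carrier Q" "pts v = {x \<in> slice e S. x \<preceq> h}" "h \<in> carrier P" for v h
    unfolding le_Q_iff[OF wC that(1)] that(2) pw using gg that(3) slice_nz le_trans by blast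
  have lt: "sl_le Q w (pt e (insert R S)) \<longleftrightarrow> pts w \<subseteq> slice e (insert R S)"
    using le_Q_iff[OF wC] pts_pt pt_carrier admissible_insert[OF adm R] by simp
  have charw: "QS.character (sl_le Q w)" by (rule QS.character_le[OF w])
  have "chr (sl_le Q w) (frag_extend (\<lambda>h. basis_elt Q (low h e S)) (bigvee P R)) =
      chr (\<lambda>h. ?L \<and> g \<preceq> h) (bigvee P R)"
  proof (rule chr_frag_extend)
    fix h assume h: "h \<in> Poly_Mapping.keys (bigvee P R)"
    show "chr (sl_le Q w) (basis_elt Q (low h e S)) = of_bool (?L \<and> g \<preceq> h)"
      using lw[OF lowC[OF h] nz_carrier[OF cover_key_props(1)[OF a(1) R h]]] QS.character_zer[OF charw]
      by (simp add: QS.chr_basis_elt)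
  qed
  also have "\<dots> = of_bool (?L \<and> (\<exists>f\<in>R. g \<preceq> f))"
    using chr_bigvee[OF character_le[OF gg(1)] cR(1,2)] by (cases ?L) simp_all
  finally have 1: "chr (sl_le Q w) (frag_extend (\<lambda>h. basis_elt Q (low h e S)) (bigvee P R)) =
      of_bool (?L \<and> (\<exists>f\<in>R. g \<preceq> f))" .
  have 2: "(\<exists>v\<in>dcov e S R. sl_le Q w v) \<longleftrightarrow>
      pts w \<subseteq> slice e (insert R S) \<or> ?L \<and> (\<exists>f\<in>R. g \<preceq> f)" (is "?l \<longleftrightarrow> ?r")
  proof
    assume ?l
    then obtain v where v: "v \<in> dcov e S R" "sl_le Q w v" by auto
    then have vC: "v \<in> carrier Q" using fin(2) nz_Q_iff by blast
    consider "pts v = slice e (insert R S)" | f where "f \<in> R" "pts v = {x \<in> slice e S. x \<preceq> f}"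
      using v(1) mem_dcov_iff[OF adm R] by auto
    then show ?r
    proof cases
      case 1
      then show ?thesis using le_Q_iff[OF wC vC] v(2) by simp
    next
      case (2 f)
      then show ?thesis using lw[OF vC 2(2) cR(4)[OF 2(1)]] v(2) by auto
    qed
  next
    assume ?r
    then show ?l
    proof
      assume "pts w \<subseteq> slice e (insert R S)"
      then have "sl_le Q w (pt e (insert R S))" using lt by simp
      then show ?l unfolding dcov_def by blast
    next
      assume "?L \<and> (\<exists>f\<in>R. g \<preceq> f)"
      then obtain f where f: ?L "f \<in> R" "g \<preceq> f" by auto
      note l = low_Q[OF cR(3)[OF f(2)] adm]
      have le: "sl_le Q w (low f e S)" using lw[OF l cR(4)[OF f(2)]] f by simp
      then have "low f e S \<noteq> c 0"
        using le_Q_iff[OF wC l(1)] w nz_Q_pts by auto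
      then show ?l using f(2) le unfolding dcov_def by blast
    qed
  qed
  \<comment> \<open>Orthogonality of the two summands, tested at the largest point
    \<open>g\<close>.\<close>
  have 3: "\<not> (pts w \<subseteq> slice e (insert R S) \<and> (\<exists>f\<in>R. g \<preceq> f))"
    using gg(7) by (auto simp: pw slice_insert)
  show "chr (sl_le Q w) (bigvee Q (dcov e S R)) =
    chr (sl_le Q w) (frag_of (pt e (insert R S)) + frag_extend (\<lambda>h. basis_elt Q (low h e S)) (bigvee P R))"
    unfolding QS.chr_bigvee[OF charw fin] chr_add 1 2 chr_frag_of lt using 3 by auto
qed

lemma keys_bigvee_dcov:
  assumes adm: "admissible P e S" and R: "R \<in> covers P e" and v: "v \<in> Poly_Mapping.keys (bigvee Q (dcov e S R))"
  shows "v = pt e (insert R S) \<or> (\<exists>h\<in>Poly_Mapping.keys (bigvee P R). v = low h e S)"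
proof -
  let ?x = "frag_extend (\<lambda>h. basis_elt Q (low h e S)) (bigvee P R)"
  have "v \<in> Poly_Mapping.keys (frag_of (pt e (insert R S))) \<union> Poly_Mapping.keys ?x"
    using v[unfolded bigvee_dcov[OF adm R]] by (rule subsetD[OF keys_add])
  moreover have "\<exists>h\<in>Poly_Mapping.keys (bigvee P R). v = low h e S" if v': "v \<in> Poly_Mapping.keys ?x"
  proof -
    obtain h where h: "h \<in> Poly_Mapping.keys (bigvee P R)" "v \<in> Poly_Mapping.keys (basis_elt Q (low h e S))"
      using subsetD[OF keys_frag_extend v'] by (rule UN_E)
    then have "v = low h e S" by (auto simp: basis_elt_def split: if_splits)
    with h show ?thesis by blast
  qed
  ultimately show ?thesis by (simp only: Un_iff keys_frag_of singleton_iff) blast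
qed

lemma mem_pts_pmeet:
  assumes "u \<in> carrier Q" "finite J" "\<And>j. j \<in> J \<Longrightarrow> \<epsilon> j \<in> carrier Q" "\<And>j. j \<in> J \<Longrightarrow> pts (\<epsilon> j) \<subseteq> pts u"
  shows "x \<in> pts (QS.pmeet u \<epsilon> J) \<longleftrightarrow> x \<in> pts u \<and> (\<forall>j\<in>J. x \<in> pts (\<epsilon> j))"
proof (cases "J = {}")
  case False
  have "x \<in> pts (sl_prod Q \<epsilon> J) \<longleftrightarrow> (\<forall>j\<in>J. x \<in> pts (\<epsilon> j))"
    by (rule QS.meets.nprod_pred[where \<chi> = "\<lambda>u. x \<in> pts u"]) (use assms False mult_Q(2) in auto)
  then show ?thesis using False assms(4) by (auto simp: QS.pmeet_def)
qed (simp add: QS.pmeet_def)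

text \<open>A factor \<open>\<epsilon>\<^sub>i\<close> is either \<open>e(S \<union> {R\<^sub>i})\<close> or \<open>h\<^sub>i e(S)\<close> with \<open>h\<^sub>i\<close> in the support of \<open>\<Or>R\<^sub>i\<close>;
  these index sets are \<open>A\<close> and \<open>B\<close> below.\<close>

lemma cond_ii_Q: "cond_ii Q"
  unfolding cond_ii_def
proof (intro ballI allI impI)
  fix u r j and R' :: "nat \<Rightarrow> 'b set" and \<epsilon>
  assume u: "u \<in> nz Q"
    and *: "inj_on R' {1..r} \<and> (\<forall>i\<in>{1..r}. R' i \<in> covers Q u \<and> \<epsilon> i \<in> Poly_Mapping.keys (bigvee Q (R' i)))"
    and j: "j \<in> {1..r}"
  have uC: "u \<in> carrier Q" using u by (simp add: nz_Q_iff)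
  obtain e S where e: "admissible P e S" "u = pt e S" using u by (rule nz_Q_cases)
  note a = admissible_props[OF e(1)]
  have pu: "pts u = slice e S" using e by (simp add: pts_pt)
  have "\<forall>i\<in>{1..r}. \<exists>R. R \<in> covers P e - S \<and> R' i = dcov e S R"
    using * covers_Q[OF e(1)] e(2) by auto
  then obtain R where R: "\<And>i. i \<in> {1..r} \<Longrightarrow> R i \<in> covers P e" "\<And>i. i \<in> {1..r} \<Longrightarrow> R i \<notin> S"
      "\<And>i. i \<in> {1..r} \<Longrightarrow> R' i = dcov e S (R i)"
    by (metis DiffD1 DiffD2)
  have injR: "inj_on R {1..r}"
    using * R(3) by (metis inj_on_def)
  have eps: "\<epsilon> i = pt e (insert (R i) S) \<or> (\<exists>h\<in>Poly_Mapping.keys (bigvee P (R i)). \<epsilon> i = low h e S)"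
    if i: "i \<in> {1..r}" for i
  proof (rule keys_bigvee_dcov[OF e(1) R(1)[OF i]])
    show "\<epsilon> i \<in> Poly_Mapping.keys (bigvee Q (dcov e S (R i)))" using * i R(3)[OF i] by metis
  qed
  define A where "A = {i \<in> {1..r}. \<epsilon> i = pt e (insert (R i) S)}"
  define B where "B = {1..r} - A"
  have "\<forall>i\<in>B. \<exists>h. h \<in> Poly_Mapping.keys (bigvee P (R i)) \<and> \<epsilon> i = low h e S"
    using eps unfolding B_def A_def by blast
  then obtain h where h: "\<And>i. i \<in> B \<Longrightarrow> h i \<in> Poly_Mapping.keys (bigvee P (R i))"
      "\<And>i. i \<in> B \<Longrightarrow> \<epsilon> i = low (h i) e S"
    by metis
  have AB: "A \<subseteq> {1..r}" "B \<subseteq> {1..r}" "A \<union> B = {1..r}" by (auto simp: A_def B_def)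
  have hN: "h i \<in> nz P" if "i \<in> B" for i
    using cover_key_props(1)[OF a(1) R(1) h(1)[OF that]] that AB by blast
  have pA: "pts (\<epsilon> i) = {x \<in> slice e S. \<forall>f\<in>R i. \<not> x \<preceq> f}" if "i \<in> A" for i
    using that pts_pt[OF admissible_insert[OF e(1) R(1)[of i]]] by (auto simp: A_def slice_insert)
  have pB: "pts (\<epsilon> i) = {x \<in> slice e S. x \<preceq> h i}" if "i \<in> B" for i
    using low_Q(2)[OF hN[OF that] e(1)] h(2)[OF that] by simp
  have eC: "\<epsilon> i \<in> carrier Q" "pts (\<epsilon> i) \<subseteq> pts u" if "i \<in> {1..r}" for i
  proof -
    have "i \<in> A \<or> i \<in> B" using that AB by auto
    then show "pts (\<epsilon> i) \<subseteq> pts u" using pA pB pu by auto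
    show "\<epsilon> i \<in> carrier Q"
      using \<open>i \<in> A \<or> i \<in> B\<close> admissible_insert[OF e(1) R(1)[OF that]] low_Q(1)[OF hN e(1)] h(2)
      by (auto simp: A_def)
  qed
  let ?K = "{1..r} - {j}"
  define p where "p = QS.pmeet u \<epsilon> {1..r}"
  define q where "q = QS.pmeet u \<epsilon> ?K"
  have pq: "p \<in> carrier Q" "q \<in> carrier Q"
    unfolding p_def q_def using uC eC by (auto intro!: QS.pmeet_closed)
  have mp: "x \<in> pts p \<longleftrightarrow> x \<in> pts q \<and> x \<in> pts (\<epsilon> j)" for x
  proof -
    have "x \<in> pts p \<longleftrightarrow> x \<in> pts u \<and> (\<forall>i\<in>{1..r}. x \<in> pts (\<epsilon> i))"
      unfolding p_def by (rule mem_pts_pmeet) (use uC eC in auto)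
    moreover have "x \<in> pts q \<longleftrightarrow> x \<in> pts u \<and> (\<forall>i\<in>?K. x \<in> pts (\<epsilon> i))"
      unfolding q_def by (rule mem_pts_pmeet) (use uC eC in auto)
    ultimately show ?thesis using j by auto
  qed
  \<comment> \<open>The product \<open>q\<close> without the factor \<open>j\<close> consists of the
    points of \<open>slice e AA\<close> below a product of selected elements: \<open>AA\<close>
    holds the covers whose members are avoided, \<open>BB\<close> those from which an element is
    selected.\<close>
  define AA where "AA = S \<union> R ` (?K \<inter> A)"
  define BB where "BB = R ` (?K \<inter> B)"
  \<comment> \<open>Selections are indexed by covers, so the index of a cover is recovered through
    injectivity of \<open>R\<close>.\<close>
  define \<eta> where "\<eta> X = h (the_inv_into {1..r} R X)" for X
  have \<eta>: "\<eta> (R i) = h i" if "i \<in> {1..r}" for i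
    using the_inv_into_f_f[OF injR that] by (simp add: \<eta>_def)
  have sel: "selection e \<eta> BB"
    unfolding selection_def
  proof (intro conjI ballI)
    show "BB \<subseteq> covers P e" using R(1) AB by (auto simp: BB_def)
    fix X assume "X \<in> BB"
    then show "\<eta> X \<in> Poly_Mapping.keys (bigvee P X)"
      using \<eta> h(1) AB by (auto simp: BB_def)
  qed (use a in \<open>auto simp: BB_def\<close>)
  have mq: "x \<in> pts q \<longleftrightarrow> x \<in> slice e AA \<and> x \<preceq> pmeet e \<eta> BB" for x
  proof (cases "x \<in> slice e S")
    case False
    moreover have "x \<in> slice e S" if "x \<in> slice e AA" using that by (auto simp: slice_def AA_def)
    moreover have "x \<in> pts u" if "x \<in> pts q"
      using that mem_pts_pmeet[of u ?K \<epsilon> x] uC eC unfolding q_def by auto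
    ultimately show ?thesis using pu by auto
  next
    case True
    have "x \<in> pts q \<longleftrightarrow> x \<in> pts u \<and> (\<forall>i\<in>?K. x \<in> pts (\<epsilon> i))"
      unfolding q_def by (rule mem_pts_pmeet) (use uC eC in auto)
    also have "\<dots> \<longleftrightarrow> (\<forall>i\<in>?K \<inter> A. x \<in> pts (\<epsilon> i)) \<and> (\<forall>i\<in>?K \<inter> B. x \<in> pts (\<epsilon> i))"
      using True pu AB by blast
    also have "(\<forall>i\<in>?K \<inter> A. x \<in> pts (\<epsilon> i)) \<longleftrightarrow> (\<forall>i\<in>?K \<inter> A. \<forall>f\<in>R i. \<not> x \<preceq> f)"
      using pA True by auto
    also have "(\<forall>i\<in>?K \<inter> B. x \<in> pts (\<epsilon> i)) \<longleftrightarrow> (\<forall>i\<in>?K \<inter> B. x \<preceq> h i)"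
      using pB True by auto
    also have "(\<forall>i\<in>?K \<inter> A. \<forall>f\<in>R i. \<not> x \<preceq> f) \<longleftrightarrow> x \<in> slice e AA"
      using True by (auto simp: slice_def AA_def)
    also have "(\<forall>i\<in>?K \<inter> B. x \<preceq> h i) \<longleftrightarrow> (\<forall>X\<in>BB. x \<preceq> \<eta> X)"
      using \<eta> by (auto simp: BB_def)
    also have "\<dots> \<longleftrightarrow> x \<preceq> pmeet e \<eta> BB"
      using selection_pmeet(2)[OF sel] slice_nz[OF True] by auto
    finally show ?thesis .
  qed
  have Rj: "R j \<in> covers P e" "R j \<notin> AA" "R j \<notin> BB"
    using R(1,2)[OF j] inj_onD[OF injR _ j] AB by (auto simp: AA_def BB_def)
  have "R ` (?K \<inter> A) \<inter> R ` (?K \<inter> B) = {}"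
    by (subst inj_on_image_Int[OF injR, symmetric]) (auto simp: B_def)
  then have AA: "AA \<subseteq> covers P e" "AA \<inter> BB = {}"
    using a(6) R(1,2) by (auto simp: AA_def BB_def)
  have main: "sl_le Q p q \<and> p \<noteq> q" if q0: "q \<noteq> c 0"
  proof
    show "sl_le Q p q" using le_Q_iff[OF pq] mp by auto
    obtain x where x: "x \<in> pts q" using q0 pts_empty_iff[OF pq(2)] by auto
    define m where "m = pmeet e \<eta> BB"
    have mC: "m \<in> carrier P" "m \<preceq> e" 
      using selection_pmeet(1)[OF sel] selection_pmeet(2)[OF sel, of m] by (auto simp: m_def)
    have xm: "x \<in> slice e AA" "x \<preceq> m" using x mq by (simp_all add: m_def)
    have m0: "m \<noteq> \<^bold>0" using xm le_zer[of x] slice_nz by (auto simp: nz_iff)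
    have "j \<in> A \<or> j \<in> B" using AB j by auto
    \<comment> \<open>Strictness needs a point of \<open>q\<close> outside the factor
      \<open>j\<close>. If that factor avoids \<open>R j\<close>, a point below a member of
      \<open>R j\<close> is taken; if it is \<open>h j\<close> times \<open>e(S)\<close>, the
      largest candidate \<open>m\<close> itself will do.\<close>
    then have "\<exists>y\<in>pts q. y \<notin> pts (\<epsilon> j)"
    proof
      assume "j \<in> A"
      obtain d f where d: "d \<in> slice e AA" "d \<preceq> m" "f \<in> R j" "d \<preceq> f"
        using selection_cover_meets_slice[OF sel AA Rj] m0 by (auto simp: m_def)
      then show ?thesis using mq[of d] pA[OF \<open>j \<in> A\<close>] by (auto simp: m_def)
    next
      assume "j \<in> B"
      have "m \<in> slice e AA" by (rule slice_down[OF xm(1) a(1) AA(1) xm(2) mC(2,1)])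
      moreover have "\<not> m \<preceq> h j"
        using selection_key_strict[OF sel Rj(1,3) h(1)[OF \<open>j \<in> B\<close>]] m0 by (simp add: m_def)
      ultimately show ?thesis
        using mq[of m] pB[OF \<open>j \<in> B\<close>] mC by (auto simp: m_def)
    qed
    then show "p \<noteq> q" using mp by auto
  qed
  have "sl_prod Q \<epsilon> {1..r} = p"
  proof -
    have "{1..r} \<noteq> {}" using j by blast
    then show ?thesis unfolding p_def QS.pmeet_def by (simp only: if_False)
  qed
  moreover have "(if r = 1 then u else sl_prod Q \<epsilon> ?K) = q"
    unfolding q_def singleton_interval_iff[OF j] by (simp only: QS.pmeet_def)
  ultimately show "let p = sl_prod Q \<epsilon> {1..r};
        q = (if r = 1 then u else sl_prod Q \<epsilon> ?K)
      in q \<noteq> sl_zero Q \<longrightarrow> sl_le Q p q \<and> p \<noteq> q"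
    unfolding Let_def Q_simps(3) using main by simp
qed

end


section \<open>Equivariance\<close>

context cover_pair
begin

lemma act_group_action: "group_action \<Gamma> (carrier P) (sl_act P)"
  using gamma by (simp add: gamma_semilattice_def)

lemma inv_closed [simp]: "g \<in> carrier \<Gamma> \<Longrightarrow> inv\<^bsub>\<Gamma>\<^esub> g \<in> carrier \<Gamma>"
  using group by (rule group.inv_closed)

lemma act_closed [simp]: "g \<in> carrier \<Gamma> \<Longrightarrow> e \<in> carrier P \<Longrightarrow> sl_act P g e \<in> carrier P"
  using group_action.element_image[OF act_group_action] by blast

lemma act_meet:
  "g \<in> carrier \<Gamma> \<Longrightarrow> e \<in> carrier P \<Longrightarrow> f \<in> carrier P \<Longrightarrow>
    sl_act P g (e \<^bold>\<cdot> f) = sl_act P g e \<^bold>\<cdot> sl_act P g f"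
  using gamma by (simp add: gamma_semilattice_def)

lemma act_inv_act [simp]:
  "g \<in> carrier \<Gamma> \<Longrightarrow> e \<in> carrier P \<Longrightarrow> sl_act P (inv\<^bsub>\<Gamma>\<^esub> g) (sl_act P g e) = e"
  using group_action.orbit_sym_aux[OF act_group_action] by blast

lemma act_act_inv [simp]:
  "g \<in> carrier \<Gamma> \<Longrightarrow> e \<in> carrier P \<Longrightarrow> sl_act P g (sl_act P (inv\<^bsub>\<Gamma>\<^esub> g) e) = e"
  using act_inv_act[of "inv\<^bsub>\<Gamma>\<^esub> g" e] group.inv_inv[OF group, of g] by simp

lemma act_mult:
  "g \<in> carrier \<Gamma> \<Longrightarrow> h \<in> carrier \<Gamma> \<Longrightarrow> e \<in> carrier P \<Longrightarrow>
    sl_act P (g \<otimes>\<^bsub>\<Gamma>\<^esub> h) e = sl_act P g (sl_act P h e)"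
  using group_action.composition_rule[OF act_group_action] by blast

lemma act_one [simp]: "e \<in> carrier P \<Longrightarrow> sl_act P \<one>\<^bsub>\<Gamma>\<^esub> e = e"
  using group_action.id_eq_one[OF act_group_action] by (metis restrict_apply')

lemma act_le_iff:
  assumes "g \<in> carrier \<Gamma>" "d \<in> carrier P" "e \<in> carrier P"
  shows "d \<preceq> sl_act P g e \<longleftrightarrow> sl_act P (inv\<^bsub>\<Gamma>\<^esub> g) d \<preceq> e"
proof -
  have mono: "sl_act P h a \<preceq> sl_act P h b" if "h \<in> carrier \<Gamma>" "a \<preceq> b" "a \<in> carrier P" "b \<in> carrier P" for h a b
    using that unfolding sl_le_def by (metis act_meet)
  show ?thesis
    using mono[of "inv\<^bsub>\<Gamma>\<^esub> g" d "sl_act P g e"] mono[of g "sl_act P (inv\<^bsub>\<Gamma>\<^esub> g) d" e] assms by auto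
qed

lemma act_zer [simp]: "g \<in> carrier \<Gamma> \<Longrightarrow> sl_act P g \<^bold>0 = \<^bold>0"
  using act_meet[of g "sl_act P (inv\<^bsub>\<Gamma>\<^esub> g) \<^bold>0" "\<^bold>0"] by simp

lemma act_nz [simp]: "g \<in> carrier \<Gamma> \<Longrightarrow> e \<in> nz P \<Longrightarrow> sl_act P g e \<in> nz P"
  by (metis act_closed act_inv_act act_zer inv_closed nz_iff)

lemma zact_eq: "x \<in> carrier (ZE P) \<Longrightarrow> zact P g x = frag_extend (\<lambda>e. frag_of (sl_act P g e)) x"
  by (simp add: zact_def)

lemma zact_closed: "g \<in> carrier \<Gamma> \<Longrightarrow> x \<in> carrier (ZE P) \<Longrightarrow> zact P g x \<in> carrier (ZE P)"
  unfolding zact_eq by (rule ZE_frag_extend) (auto simp: carrier_ZE)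

text \<open>The action moves the point of evaluation by the inverse, so equivariance can be checked
  on points.\<close>

lemma chr_zact:
  assumes "g \<in> carrier \<Gamma>" "x \<in> carrier (ZE P)" "d \<in> nz P"
  shows "chr (\<lambda>e. d \<preceq> e) (zact P g x) = chr (\<lambda>e. sl_act P (inv\<^bsub>\<Gamma>\<^esub> g) d \<preceq> e) x"
  unfolding zact_eq[OF assms(2)]
  by (rule chr_frag_extend) (use assms act_le_iff nz_carrier in \<open>auto simp: carrier_ZE subset_iff\<close>)

lemma zact_diff:
  "x \<in> carrier (ZE P) \<Longrightarrow> y \<in> carrier (ZE P) \<Longrightarrow> zact P g (x - y) = zact P g x - zact P g y"
  by (simp add: zact_eq ZE_diff frag_extend_diff)

lemma zact_add:
  "x \<in> carrier (ZE P) \<Longrightarrow> y \<in> carrier (ZE P) \<Longrightarrow> zact P g (x + y) = zact P g x + zact P g y"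
  by (simp add: zact_eq ZE_add frag_extend_add)

lemma zact_one: "x \<in> carrier (ZE P) \<Longrightarrow> zact P \<one>\<^bsub>\<Gamma>\<^esub> x = x"
proof -
  assume x: "x \<in> carrier (ZE P)"
  then have "zact P \<one>\<^bsub>\<Gamma>\<^esub> x = frag_extend frag_of x"
    unfolding zact_eq[OF x] by (intro frag_extend_eq) (auto simp: carrier_ZE nz_carrier subset_iff)
  then show ?thesis using frag_expansion[of x] by simp
qed

lemma zact_mult:
  assumes "g \<in> carrier \<Gamma>" "h \<in> carrier \<Gamma>" "x \<in> carrier (ZE P)"
  shows "zact P (g \<otimes>\<^bsub>\<Gamma>\<^esub> h) x = zact P g (zact P h x)"
proof -
  have x: "Poly_Mapping.keys x \<subseteq> nz P" using assms(3) by (simp add: carrier_ZE)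
  have "zact P (g \<otimes>\<^bsub>\<Gamma>\<^esub> h) x = frag_extend (\<lambda>e. frag_of (sl_act P g (sl_act P h e))) x"
    unfolding zact_eq[OF assms(3)]
    using assms x by (intro frag_extend_eq) (auto simp: act_mult nz_carrier subset_iff)
  also have "\<dots> = frag_extend (\<lambda>e. frag_of (sl_act P g e)) (frag_extend (\<lambda>e. frag_of (sl_act P h e)) x)"
    using frag_extend_compose[of "\<lambda>e. frag_of (sl_act P g e)" "sl_act P h" x] by (simp add: o_def)
  finally show ?thesis
    using zact_eq[OF assms(3)] zact_eq[OF zact_closed[OF assms(2,3)]] by simp
qed

lemma ZE_mult: "x \<otimes>\<^bsub>ZE P\<^esub> y = x + y"
  by (simp add: ZE_def)

lemma gamma_module_ZE: "gamma_module \<Gamma> (ZE P) (zact P)"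
  unfolding gamma_module_def
proof (intro conjI ballI)
  show "comm_group (ZE P)" unfolding ZE_def by (rule abelian_free_Abelian_group)
  show "group_action \<Gamma> (carrier (ZE P)) (zact P)"
  proof (rule group_actionI[OF group])
    show "zact P g \<in> extensional (carrier (ZE P))" for g by (simp add: zact_def)
  qed (simp_all add: zact_closed zact_one zact_mult)
  fix g assume "g \<in> carrier \<Gamma>"
  then show "zact P g \<in> hom (ZE P) (ZE P)"
    by (intro homI) (simp_all add: zact_closed zact_add ZE_mult)
qed

lemma covers_act:
  assumes "g \<in> carrier \<Gamma>" "e \<in> nz P"
  shows "(`) (sl_act P g) ` covers P e = covers P (sl_act P g e)"
  using ciii assms by (auto simp: cond_iii_def)

text \<open>Derived covers are indexed by covers outside \<open>S\<close>; injectivity keeps their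
  translates outside the translate of \<open>S\<close>.\<close>

lemma inj_on_cover_act: "g \<in> carrier \<Gamma> \<Longrightarrow> e \<in> nz P \<Longrightarrow> inj_on ((`) (sl_act P g)) (covers P e)"
proof (rule inj_onI)
  fix R R' assume g: "g \<in> carrier \<Gamma>" "e \<in> nz P" and R: "R \<in> covers P e" "R' \<in> covers P e"
    and eq: "sl_act P g ` R = sl_act P g ` R'"
  have "inj_on (sl_act P g) (carrier P)"
    by (rule group_action.inj_prop[OF act_group_action g(1)])
  then show "R = R'"
    using eq cover_props(4)[OF g(2)] R by (metis inj_on_image_eq_iff subsetI)
qed

definition act_sets :: "'g \<Rightarrow> 'a set set \<Rightarrow> 'a set set" where
  "act_sets g S = (`) (sl_act P g) ` S"

lemma admissible_act:
  "g \<in> carrier \<Gamma> \<Longrightarrow> admissible P e S \<Longrightarrow> admissible P (sl_act P g e) (act_sets g S)"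
  using covers_act[of g e] by (auto simp: admissible_def act_sets_def)

lemma slice_act:
  assumes g: "g \<in> carrier \<Gamma>" and e: "e \<in> nz P" "S \<subseteq> covers P e"
  shows "d \<in> slice (sl_act P g e) (act_sets g S) \<longleftrightarrow> d \<in> nz P \<and> sl_act P (inv\<^bsub>\<Gamma>\<^esub> g) d \<in> slice e S"
proof (cases "d \<in> nz P")
  case True
  have 1: "d \<preceq> sl_act P g f \<longleftrightarrow> sl_act P (inv\<^bsub>\<Gamma>\<^esub> g) d \<preceq> f" if "f \<in> carrier P" for f
    using act_le_iff[OF g _ that] True nz_carrier by blast
  have 2: "\<not> d \<preceq> sl_act P g f \<longleftrightarrow> \<not> sl_act P (inv\<^bsub>\<Gamma>\<^esub> g) d \<preceq> f" if "f \<in> R" "R \<in> S" for f R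
    using 1 cover_props(4)[OF e(1) _ that(1)] that(2) e(2) by blast
  show ?thesis
    using True g 1[OF nz_carrier[OF e(1)]] 2 by (auto simp: slice_def act_sets_def)
qed (auto simp: slice_def)

end

section \<open>The group action on the derived pair\<close>

context derivation
begin

lemma act_Q:
  assumes "g \<in> carrier \<Gamma>" "u \<in> carrier Q"
  shows "sl_act Q g u \<in> carrier Q" "pts (sl_act Q g u) = {d \<in> nz P. sl_act P (inv\<^bsub>\<Gamma>\<^esub> g) d \<in> pts u}"
    "the_inv c (sl_act Q g u) = zact P g (the_inv c u)"
proof -
  have eq: "sl_act Q g u = c (zact P g (the_inv c u))"
    using assms(2) by (auto simp: transport_def derived_def)
  then show "the_inv c (sl_act Q g u) = zact P g (the_inv c u)" by simp
  let ?X = "{d \<in> nz P. sl_act P (inv\<^bsub>\<Gamma>\<^esub> g) d \<in> pts u}"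
  have x: "zact P g (the_inv c u) \<in> carrier (ZE P)" using rep(1)[OF assms(2)] assms(1) zact_closed by blast
  have chr: "chr (\<lambda>e. d \<preceq> e) (zact P g (the_inv c u)) = of_bool (d \<in> ?X)" if "d \<in> nz P" for d
    using chr_zact[OF assms(1) rep(1)[OF assms(2)] that] rep(3)[OF assms(2)] assms(1) that by simp
  have ex: "\<exists>e S. admissible P e S \<and> ?X = slice e S" if "?X \<noteq> {}"
  proof -
    have "u \<in> nz Q" using that assms(2) nz_Q_pts by auto
    then obtain e S where e: "admissible P e S" "u = pt e S" by (rule nz_Q_cases)
    have "?X = slice (sl_act P g e) (act_sets g S)"
      using slice_act[OF assms(1) admissible_props(1,6)[OF e(1)]] pts_pt[OF e(1)] e(2) by auto
    then show ?thesis using admissible_act[OF assms(1) e(1)] by blast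
  qed
  have sub: "?X \<subseteq> nz P" by auto
  show "sl_act Q g u \<in> carrier Q" "pts (sl_act Q g u) = ?X"
    unfolding eq by (rule from_ZE[OF x chr sub ex]; assumption)+
qed

lemma act_pt:
  assumes "g \<in> carrier \<Gamma>" "admissible P e S"
  shows "sl_act Q g (pt e S) = pt (sl_act P g e) (act_sets g S)"
proof (rule pts_inject)
  show "pts (sl_act Q g (pt e S)) = pts (pt (sl_act P g e) (act_sets g S))"
    using slice_act[OF assms(1) admissible_props(1,6)[OF assms(2)]] assms
    by (auto simp: act_Q pts_pt admissible_act)
qed (use assms admissible_act act_Q in auto)

lemma gamma_semilattice_Q: "gamma_semilattice \<Gamma> Q"
  unfolding gamma_semilattice_def
proof (intro conjI ballI)
  show "is_semilattice Q" by (rule semilattice_Q)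
  show "group_action \<Gamma> (carrier Q) (sl_act Q)"
  proof (rule group_actionI[OF group])
    fix g u assume "g \<in> carrier \<Gamma>" "u \<in> carrier Q"
    then show "sl_act Q g u \<in> carrier Q" by (rule act_Q(1))
  next
    fix g
    show "sl_act Q g \<in> extensional (carrier Q)" by (auto simp: transport_def)
  next
    fix u assume u: "u \<in> carrier Q"
    have 1: "\<one>\<^bsub>\<Gamma>\<^esub> \<in> carrier \<Gamma>" "inv\<^bsub>\<Gamma>\<^esub> \<one>\<^bsub>\<Gamma>\<^esub> = \<one>\<^bsub>\<Gamma>\<^esub>"
      using group by (auto simp: group.is_monoid monoid.one_closed monoid.inv_one)
    show "sl_act Q \<one>\<^bsub>\<Gamma>\<^esub> u = u"
      by (rule pts_inject) (use 1 u act_Q pts_sub[of u] nz_carrier in auto)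
  next
    fix g h u assume gh: "g \<in> carrier \<Gamma>" "h \<in> carrier \<Gamma>" and u: "u \<in> carrier Q"
    have m: "g \<otimes>\<^bsub>\<Gamma>\<^esub> h \<in> carrier \<Gamma>" "inv\<^bsub>\<Gamma>\<^esub> (g \<otimes>\<^bsub>\<Gamma>\<^esub> h) = inv\<^bsub>\<Gamma>\<^esub> h \<otimes>\<^bsub>\<Gamma>\<^esub> inv\<^bsub>\<Gamma>\<^esub> g"
      using group gh by (auto simp: group.inv_mult_group group.is_monoid intro: monoid.m_closed)
    show "sl_act Q (g \<otimes>\<^bsub>\<Gamma>\<^esub> h) u = sl_act Q g (sl_act Q h u)"
      by (rule pts_inject) (use m gh u nz_carrier in \<open>auto simp: act_Q act_mult\<close>)
  qed
next
  fix g u v assume g: "g \<in> carrier \<Gamma>" and uv: "u \<in> carrier Q" "v \<in> carrier Q"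
  show "sl_act Q g (sl_mult Q u v) = sl_mult Q (sl_act Q g u) (sl_act Q g v)"
    by (rule pts_inject) (use g uv in \<open>auto simp: act_Q mult_Q\<close>)
qed

lemma act_dcov:
  assumes g: "g \<in> carrier \<Gamma>" and adm: "admissible P e S" and R: "R \<in> covers P e"
  shows "sl_act Q g ` dcov e S R = dcov (sl_act P g e) (act_sets g S) (sl_act P g ` R)"
proof -
  note a = admissible_props[OF adm]
  have fN: "f \<in> nz P" if "f \<in> R" for f using cover_props(3)[OF a(1) R that] .
  have low: "sl_act Q g (low f e S) = low (sl_act P g f) (sl_act P g e) (act_sets g S)" if "f \<in> R" for f
  proof (rule pts_inject)
    show "pts (sl_act Q g (low f e S)) = pts (low (sl_act P g f) (sl_act P g e) (act_sets g S))"
      using slice_act[OF g a(1,6)] g adm fN[OF that]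
      by (auto simp: act_Q low_Q admissible_act act_le_iff nz_carrier)
  qed (use g adm fN[OF that] in \<open>auto simp: act_Q low_Q admissible_act\<close>)
  interpret GA: group_action \<Gamma> "carrier Q" "sl_act Q"
    using gamma_semilattice_Q by (simp add: gamma_semilattice_def)
  have lowC: "(\<lambda>f. low f e S) ` R \<subseteq> carrier Q" using low_Q(1)[OF fN adm] by auto
  have zero: "sl_act Q g (c 0) = c 0"
    by (rule pts_inject) (use g in \<open>auto simp: act_Q\<close>)
  \<comment> \<open>Deleting zero commutes with taking images because the action is injective and
    fixes zero.\<close>
  have "sl_act Q g ` ((\<lambda>f. low f e S) ` R - {c 0}) = sl_act Q g ` (\<lambda>f. low f e S) ` R - {c 0}"
    using inj_on_image_set_diff[OF GA.inj_prop[OF g], of "(\<lambda>f. low f e S) ` R" "{c 0}"] lowC zero by auto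
  also have "sl_act Q g ` (\<lambda>f. low f e S) ` R =
      (\<lambda>f. low f (sl_act P g e) (act_sets g S)) ` sl_act P g ` R"
    unfolding image_image by (rule image_cong) (simp_all add: low)
  finally show ?thesis
    unfolding dcov_def image_insert act_pt[OF g admissible_insert[OF adm R]]
    by (simp add: act_sets_def)
qed

lemma cond_iii_Q: "cond_iii \<Gamma> Q"
  unfolding cond_iii_def
proof (intro ballI)
  fix g u assume g: "g \<in> carrier \<Gamma>" and u: "u \<in> nz Q"
  interpret GA: group_action \<Gamma> "carrier Q" "sl_act Q"
    using gamma_semilattice_Q by (simp add: gamma_semilattice_def)
  \<comment> \<open>Proved for all group elements, so that the reverse inclusion follows by applying
    it to the inverse.\<close>
  have sub: "sl_act Q g ` R' \<in> covers Q (sl_act Q g u)"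
    if g: "g \<in> carrier \<Gamma>" and u: "u \<in> nz Q" and R': "R' \<in> covers Q u" for g u R'
  proof -
    obtain e S where e: "admissible P e S" "u = pt e S" using u by (rule nz_Q_cases)
    note a = admissible_props[OF e(1)]
    obtain R where R: "R \<in> covers P e" "R \<notin> S" "R' = dcov e S R"
      using R' covers_Q[OF e(1)] e(2) by auto
    have gR: "sl_act P g ` R \<in> covers P (sl_act P g e)" using covers_act[OF g a(1)] R(1) by blast
    have "sl_act P g ` R \<notin> act_sets g S"
      using inj_on_cover_act[OF g a(1)] R(1,2) a(6) unfolding act_sets_def inj_on_def by blast
    then show ?thesis
      unfolding e(2) act_pt[OF g e(1)] covers_Q[OF admissible_act[OF g e(1)]] R(3) act_dcov[OF g e(1) R(1)]
      using gR by blast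
  qed
  have uC: "u \<in> carrier Q" using u by (simp add: nz_Q_iff)
  have gu: "sl_act Q g u \<in> nz Q"
  proof -
    obtain e S where "admissible P e S" "u = pt e S" using u by (rule nz_Q_cases)
    then show ?thesis using act_pt[OF g] pt_nz[OF admissible_act[OF g]] by simp
  qed
  have ig: "inv\<^bsub>\<Gamma>\<^esub> g \<in> carrier \<Gamma>" using g by simp
  have gig: "sl_act Q (inv\<^bsub>\<Gamma>\<^esub> g) (sl_act Q g u) = u" by (rule GA.orbit_sym_aux[OF g uC refl])
  show "(\<lambda>R. sl_act Q g ` R) ` covers Q u = covers Q (sl_act Q g u)"
  proof (intro equalityI subsetI)
    fix R' assume R': "R' \<in> covers Q (sl_act Q g u)"
    then have "sl_act Q (inv\<^bsub>\<Gamma>\<^esub> g) ` R' \<in> covers Q u"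
      using sub[OF ig gu] gig by simp
    moreover have "sl_act Q g ` sl_act Q (inv\<^bsub>\<Gamma>\<^esub> g) ` R' = R'"
    proof -
      have "R' \<subseteq> carrier Q"
        using collection_Q gu R' nz_Q_iff
        unfolding collection_of_finite_covers_def finite_cover_def by blast
      moreover have "sl_act Q g (sl_act Q (inv\<^bsub>\<Gamma>\<^esub> g) v) = v" if "v \<in> carrier Q" for v
        using GA.orbit_sym_aux[OF ig that refl] group.inv_inv[OF group g] by simp
      ultimately have "(\<lambda>v. sl_act Q g (sl_act Q (inv\<^bsub>\<Gamma>\<^esub> g) v)) ` R' = (\<lambda>v. v) ` R'"
        by (intro image_cong) auto
      then show ?thesis by (simp add: image_image)
    qed
    ultimately show "R' \<in> (\<lambda>R. sl_act Q g ` R) ` covers Q u" by (metis image_eqI)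
  qed (use sub[OF g u] in auto)
qed

theorem cover_pair_Q: "cover_pair \<Gamma> Q"
  by (intro cover_pair.intro QS.semilattice_record_axioms cover_pair_axioms.intro group
    gamma_semilattice_Q collection_Q cond_i_Q cond_ii_Q cond_iii_Q)

end

section \<open>Ideals\<close>

context semilattice_record
begin

lemma ZE_one: "\<one>\<^bsub>ZE P\<^esub> = 0"
  by (simp add: ZE_def)

lemma comm_group_ZE: "comm_group (ZE P)"
  unfolding ZE_def by (rule abelian_free_Abelian_group)

text \<open>Closure under differences is the form that \<open>frag_induction\<close> consumes;
  commutativity leaves only multiplication from the left.\<close>

lemma zideal_iff:
  "zideal P I \<longleftrightarrow> I \<subseteq> carrier (ZE P) \<and> 0 \<in> I \<and> (\<forall>x\<in>I. \<forall>y\<in>I. x - y \<in> I) \<and>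
    (\<forall>x\<in>carrier (ZE P). \<forall>a\<in>I. zmult P x a \<in> I)" (is "_ \<longleftrightarrow> ?R")
proof
  interpret Z: comm_group "ZE P" by (rule comm_group_ZE)
  have inv: "inv\<^bsub>ZE P\<^esub> x = - x" if "x \<in> carrier (ZE P)" for x
    using that unfolding ZE_def by (intro inv_free_Abelian_group) simp
  show ?R if I: "zideal P I"
  proof -
    have sg: "subgroup I (ZE P)" using I by (simp add: zideal_def)
    have "x - y \<in> I" if "x \<in> I" "y \<in> I" for x y
    proof -
      have "x \<otimes>\<^bsub>ZE P\<^esub> inv\<^bsub>ZE P\<^esub> y \<in> I"
        using that sg by (intro subgroup.m_closed[OF sg] subgroup.m_inv_closed[OF sg])
      then show ?thesis
        using inv[OF subgroup.mem_carrier[OF sg that(2)]] by (simp add: ZE_def)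
    qed
    then show ?thesis
      using I subgroup.subset[OF sg] subgroup.one_closed[OF sg] by (auto simp: zideal_def ZE_one)
  qed
  show "zideal P I" if R: ?R
  proof -
    have neg: "- x \<in> I" if "x \<in> I" for x
    proof -
      have "0 - x \<in> I" using R that by blast
      then show ?thesis by simp
    qed
    have add: "x + y \<in> I" if "x \<in> I" "y \<in> I" for x y
    proof -
      have "x - (- y) \<in> I" using R that neg by blast
      then show ?thesis by simp
    qed
    have "subgroup I (ZE P)"
    proof (rule subgroup.intro)
      show "x \<otimes>\<^bsub>ZE P\<^esub> y \<in> I" if "x \<in> I" "y \<in> I" for x y using add that by (simp add: ZE_def)
      show "inv\<^bsub>ZE P\<^esub> x \<in> I" if "x \<in> I" for x
        using neg[OF that] inv[of x] that R by (simp add: subset_iff)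
    qed (use R in \<open>auto simp: ZE_one\<close>)
    then show ?thesis
      using R zmults.comm by (auto simp: zideal_def subset_iff)
  qed
qed

lemma zideal_rel_ideal:
  assumes "{frag_of e - bigvee P R | e R. e \<in> nz P \<and> R \<in> covers P e} \<subseteq> carrier (ZE P)"
  shows "zideal P (rel_ideal P)"
proof -
  \<comment> \<open>The whole algebra belongs to the family being intersected, which keeps
    \<open>rel_ideal\<close> inside the carrier.\<close>
  have "zideal P (carrier (ZE P))"
    by (auto simp: zideal_iff intro: ZE_diff zmult_closed)
  then have "rel_ideal P \<subseteq> carrier (ZE P)" using assms unfolding rel_ideal_def by blast
  then show ?thesis
    unfolding zideal_iff[of "rel_ideal P"] by (auto simp: rel_ideal_def zideal_iff)
qed

lemma rel_ideal_least:
  assumes "zideal P I" and "\<And>e R. e \<in> nz P \<Longrightarrow> R \<in> covers P e \<Longrightarrow> frag_of e - bigvee P R \<in> I"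
  shows "rel_ideal P \<subseteq> I"
  using assms unfolding rel_ideal_def by blast

lemma rel_ideal_gen: "e \<in> nz P \<Longrightarrow> R \<in> covers P e \<Longrightarrow> frag_of e - bigvee P R \<in> rel_ideal P"
  unfolding rel_ideal_def by blast

lemma zideal_frag_extend:
  assumes I: "zideal P I" and f: "\<And>u. u \<in> Poly_Mapping.keys x \<Longrightarrow> f u \<in> I"
  shows "frag_extend f x \<in> I"
proof -
  have "Poly_Mapping.keys x \<subseteq> Poly_Mapping.keys x" by simp
  then show ?thesis
    by (induction x rule: frag_induction) (use I f in \<open>auto simp: zideal_iff frag_extend_diff\<close>)
qed

text \<open>Induction over finite sub-semilattices replaces well-foundedness of \<open>E\<close>.\<close>

definition subsemilattice :: "'a set \<Rightarrow> bool" where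
  "subsemilattice F \<longleftrightarrow> finite F \<and> F \<subseteq> carrier P \<and> (\<forall>a\<in>F. \<forall>b\<in>F. a \<^bold>\<cdot> b \<in> F)"

lemma ex_subsemilattice:
  assumes "finite G" "G \<subseteq> carrier P"
  shows "\<exists>F. subsemilattice F \<and> G \<subseteq> F"
  using assms
proof (induction rule: finite_induct)
  case empty
  show ?case by (auto simp: subsemilattice_def intro: exI[of _ "{}"])
next
  case (insert a G)
  then obtain F where F: "subsemilattice F" "G \<subseteq> F" by auto
  have a: "a \<in> carrier P" using insert by simp
  have FC: "x \<in> carrier P" if "x \<in> F" for x using F that by (auto simp: subsemilattice_def)
  have Fm: "x \<^bold>\<cdot> y \<in> F" if "x \<in> F" "y \<in> F" for x y using F that by (auto simp: subsemilattice_def)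
  \<comment> \<open>Closing up after adjoining \<open>a\<close> adds only \<open>a\<close> and its
    products with \<open>F\<close>, so finiteness survives.\<close>
  let ?F = "insert a F \<union> meet a ` F"
  have 1: "a \<^bold>\<cdot> (a \<^bold>\<cdot> y) = a \<^bold>\<cdot> y" if "y \<in> F" for y
    using a FC[OF that] by (simp flip: meet_assoc)
  have 2: "a \<^bold>\<cdot> y \<^bold>\<cdot> a = a \<^bold>\<cdot> y" if "y \<in> F" for y
    using 1[OF that] a FC[OF that] by (simp add: meet_comm)
  have 3: "x \<^bold>\<cdot> (a \<^bold>\<cdot> y) = a \<^bold>\<cdot> (x \<^bold>\<cdot> y)" if "x \<in> F" "y \<in> F" for x y
    using a FC[OF that(1)] FC[OF that(2)] by (simp add: meet_left_comm)
  have 4: "a \<^bold>\<cdot> x \<^bold>\<cdot> y = a \<^bold>\<cdot> (x \<^bold>\<cdot> y)" if "x \<in> F" "y \<in> F" for x y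
    using a FC[OF that(1)] FC[OF that(2)] by (simp add: meet_assoc)
  have 5: "a \<^bold>\<cdot> x \<^bold>\<cdot> (a \<^bold>\<cdot> y) = a \<^bold>\<cdot> (x \<^bold>\<cdot> y)" if "x \<in> F" "y \<in> F" for x y
    using 3[OF that] 1[OF Fm[OF that]] a FC[OF that(1)] FC[OF that(2)] by (simp add: meet_assoc)
  have 6: "x \<^bold>\<cdot> a = a \<^bold>\<cdot> x" if "x \<in> F" for x using a FC[OF that] by (rule meet_comm[rotated])
  have "subsemilattice ?F"
    unfolding subsemilattice_def
  proof (intro conjI ballI)
    show "finite ?F" using F by (simp add: subsemilattice_def)
    show "?F \<subseteq> carrier P" using a FC by auto
    fix x y assume xy: "x \<in> ?F" "y \<in> ?F"
    then show "x \<^bold>\<cdot> y \<in> ?F"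
      using Fm a by (auto simp: 1 2 3 4 5 6)
  qed
  then show ?case using F by blast
qed

end


section \<open>The quotient by the ideal\<close>

context cover_pair
begin

lemma zideal_rel: "zideal P (rel_ideal P)"
  by (rule zideal_rel_ideal) (auto intro: cover_diff_factor_closed)

lemma rel_ideal_sub: "rel_ideal P \<subseteq> carrier (ZE P)"
  using zideal_rel by (simp add: zideal_iff)

lemma zact_zmult:
  assumes g: "g \<in> carrier \<Gamma>" and x: "x \<in> carrier (ZE P)" and y: "y \<in> carrier (ZE P)"
  shows "zact P g (zmult P x y) = zmult P (zact P g x) (zact P g y)"
proof (rule ZE_eqI)
  fix d assume d: "d \<in> nz P"
  then have "sl_act P (inv\<^bsub>\<Gamma>\<^esub> g) d \<in> nz P" using g by simp
  then show "chr (\<lambda>e. d \<preceq> e) (zact P g (zmult P x y)) = chr (\<lambda>e. d \<preceq> e) (zmult P (zact P g x) (zact P g y))"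
    using d g x y by (simp add: chr_zact chr_zmult character_le zmult_closed zact_closed)
qed (use g x y in \<open>auto intro!: zact_closed zmult_closed\<close>)

lemma zact_cover_diff:
  assumes g: "g \<in> carrier \<Gamma>" and e: "e \<in> nz P" "R \<in> covers P e"
  shows "zact P g (frag_of e - bigvee P R) = frag_of (sl_act P g e) - bigvee P (sl_act P g ` R)"
proof (rule ZE_eqI)
  have gR: "sl_act P g ` R \<in> covers P (sl_act P g e)" using covers_act[OF g e(1)] e(2) by blast
  note R = cover_props[OF e] and R' = cover_props[OF act_nz[OF g e(1)] gR]
  note cl = cover_diff_factor_closed[OF e]
  show "zact P g (frag_of e - bigvee P R) \<in> carrier (ZE P)" by (rule zact_closed[OF g cl])
  show "frag_of (sl_act P g e) - bigvee P (sl_act P g ` R) \<in> carrier (ZE P)"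
    by (rule cover_diff_factor_closed[OF act_nz[OF g e(1)] gR])
  fix d assume d: "d \<in> nz P"
  then have d': "sl_act P (inv\<^bsub>\<Gamma>\<^esub> g) d \<in> nz P" using g by simp
  have "(\<exists>f\<in>sl_act P g ` R. d \<preceq> f) \<longleftrightarrow> (\<exists>f\<in>R. sl_act P (inv\<^bsub>\<Gamma>\<^esub> g) d \<preceq> f)"
    using act_le_iff[OF g nz_carrier[OF d] R(4)] by blast
  then show "chr (\<lambda>e. d \<preceq> e) (zact P g (frag_of e - bigvee P R)) =
      chr (\<lambda>e. d \<preceq> e) (frag_of (sl_act P g e) - bigvee P (sl_act P g ` R))"
    using act_le_iff[OF g nz_carrier[OF d] nz_carrier[OF e(1)]]
    by (simp add: chr_zact[OF g cl d] chr_bigvee[OF character_le[OF d'] R(1,2)]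
        chr_bigvee[OF character_le[OF d] R'(1,2)])
qed

text \<open>The preimage of the ideal under the action is an ideal, and by (iii) it contains the
  generators; minimality does the rest.\<close>

lemma zact_rel_ideal_sub:
  assumes g: "g \<in> carrier \<Gamma>"
  shows "zact P g ` rel_ideal P \<subseteq> rel_ideal P"
proof -
  have 0: "zact P g 0 = 0" by (simp add: zact_eq)
  have "rel_ideal P \<subseteq> {x \<in> carrier (ZE P). zact P g x \<in> rel_ideal P}"
  proof (rule rel_ideal_least)
    show "zideal P {x \<in> carrier (ZE P). zact P g x \<in> rel_ideal P}"
      using zideal_rel g by (auto simp: zideal_iff 0 zact_diff zact_zmult zact_closed intro: ZE_diff zmult_closed)
    fix e R assume e: "e \<in> nz P" "R \<in> covers P e"
    have "sl_act P g ` R \<in> covers P (sl_act P g e)" using covers_act[OF g e(1)] e(2) by blast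
    then show "frag_of e - bigvee P R \<in> {x \<in> carrier (ZE P). zact P g x \<in> rel_ideal P}"
      using zact_cover_diff[OF g e] cover_diff_factor_closed[OF e] rel_ideal_gen act_nz[OF g e(1)] by simp
  qed
  then show ?thesis by auto
qed

lemma zact_rel_ideal:
  assumes g: "g \<in> carrier \<Gamma>"
  shows "zact P g ` rel_ideal P = rel_ideal P"
proof
  show "rel_ideal P \<subseteq> zact P g ` rel_ideal P"
  proof
    fix x assume x: "x \<in> rel_ideal P"
    then have xC: "x \<in> carrier (ZE P)" using rel_ideal_sub by auto
    have "x = zact P (g \<otimes>\<^bsub>\<Gamma>\<^esub> inv\<^bsub>\<Gamma>\<^esub> g) x"
      using zact_one[OF xC] group.r_inv[OF group g] by simp
    also have "\<dots> = zact P g (zact P (inv\<^bsub>\<Gamma>\<^esub> g) x)"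
      by (rule zact_mult[OF g inv_closed[OF g] xC])
    finally show "x \<in> zact P g ` rel_ideal P"
      using zact_rel_ideal_sub[OF inv_closed[OF g]] x by blast
  qed
qed (rule zact_rel_ideal_sub[OF g])

lemma subgroup_rel_ideal: "subgroup (rel_ideal P) (ZE P)"
  using zideal_rel by (simp add: zideal_def)

lemma normal_rel_ideal: "normal (rel_ideal P) (ZE P)"
  using comm_group.normal_iff_subgroup[OF comm_group_ZE] subgroup_rel_ideal by blast

lemma carrier_zquot: "carrier (zquot P) = zproj P ` carrier (ZE P)"
  unfolding zquot_def carrier_FactGroup zproj_def ..

text \<open>The image of a coset is a priori a coset of the translated ideal; invariance identifies
  that with the ideal itself.\<close>

lemma quot_act_zproj:
  assumes g: "g \<in> carrier \<Gamma>" and x: "x \<in> carrier (ZE P)"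
  shows "quot_act P g (zproj P x) = zproj P (zact P g x)"
proof -
  have coset: "zproj P y = (\<lambda>h. h + y) ` rel_ideal P" for y
    by (auto simp: zproj_def r_coset_def ZE_mult)
  have "quot_act P g (zproj P x) = zact P g ` zproj P x"
    using x by (simp add: quot_act_def carrier_zquot)
  also have "\<dots> = (\<lambda>h. h + zact P g x) ` zact P g ` rel_ideal P"
    unfolding coset image_image using rel_ideal_sub x by (intro image_cong) (auto simp: zact_add)
  also have "\<dots> = zproj P (zact P g x)" unfolding zact_rel_ideal[OF g] coset ..
  finally show ?thesis .
qed

lemma zproj_hom: "zproj P \<in> hom (ZE P) (zquot P)"
  unfolding zquot_def zproj_def[abs_def] by (rule normal.r_coset_hom_Mod[OF normal_rel_ideal])

lemma gamma_module_zquot: "gamma_module \<Gamma> (zquot P) (quot_act P)"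
  unfolding gamma_module_def
proof (intro conjI ballI)
  show "comm_group (zquot P)"
    unfolding zquot_def by (rule comm_group.abelian_FactGroup[OF comm_group_ZE subgroup_rel_ideal])
  have one: "\<one>\<^bsub>\<Gamma>\<^esub> \<in> carrier \<Gamma>" using group by (simp add: group.is_monoid monoid.one_closed)
  have m: "g \<otimes>\<^bsub>\<Gamma>\<^esub> h \<in> carrier \<Gamma>" if "g \<in> carrier \<Gamma>" "h \<in> carrier \<Gamma>" for g h
    using group that by (simp add: group.is_monoid monoid.m_closed)
  show "group_action \<Gamma> (carrier (zquot P)) (quot_act P)"
  proof (rule group_actionI[OF group])
    show "quot_act P g \<in> extensional (carrier (zquot P))" for g by (simp add: quot_act_def)
  qed (auto simp: carrier_zquot quot_act_zproj zact_closed zact_one zact_mult one m)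
  fix g assume g: "g \<in> carrier \<Gamma>"
  show "quot_act P g \<in> hom (zquot P) (zquot P)"
  proof (rule homI)
    fix C D assume "C \<in> carrier (zquot P)" "D \<in> carrier (zquot P)"
    then obtain x y where xy: "x \<in> carrier (ZE P)" "C = zproj P x" "y \<in> carrier (ZE P)" "D = zproj P y"
      by (auto simp: carrier_zquot)
    have add: "zproj P a \<otimes>\<^bsub>zquot P\<^esub> zproj P b = zproj P (a + b)"
      if "a \<in> carrier (ZE P)" "b \<in> carrier (ZE P)" for a b
      using hom_mult[OF zproj_hom that] by (simp add: ZE_mult)
    show "quot_act P g (C \<otimes>\<^bsub>zquot P\<^esub> D) = quot_act P g C \<otimes>\<^bsub>zquot P\<^esub> quot_act P g D"
      using xy g by (simp add: add quot_act_zproj ZE_add zact_closed zact_add)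
  qed (use g in \<open>auto simp: carrier_zquot quot_act_zproj zact_closed\<close>)
qed

lemma equivariant_hom_zproj: "equivariant_hom \<Gamma> (ZE P) (zact P) (zquot P) (quot_act P) (zproj P)"
  unfolding equivariant_hom_def
  using gamma_module_ZE gamma_module_zquot zproj_hom quot_act_zproj by simp

lemma kernel_zproj: "kernel (ZE P) (zquot P) (zproj P) = rel_ideal P"
proof -
  have g: "Group.group (ZE P)" using comm_group_ZE by (simp add: comm_group_def)
  have "zproj P x = rel_ideal P \<longleftrightarrow> x \<in> rel_ideal P" if "x \<in> carrier (ZE P)" for x
    using group.coset_join1[OF g _ that subgroup_rel_ideal] group.coset_join2[OF g that subgroup_rel_ideal]
    unfolding zproj_def by blast
  then show ?thesis
    using rel_ideal_sub by (auto simp: kernel_def zquot_def)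
qed

end


section \<open>Exactness\<close>

context derivation
begin

sublocale QC: cover_pair \<Gamma> Q
  by (rule cover_pair_Q)

abbreviation bdry :: "('b \<Rightarrow>\<^sub>0 int) \<Rightarrow> ('a \<Rightarrow>\<^sub>0 int)" where
  "bdry \<equiv> induced_map c"

lemma bdry_closed: "x \<in> carrier (ZE Q) \<Longrightarrow> bdry x \<in> carrier (ZE P)"
  unfolding induced_map_def by (rule ZE_frag_extend) (auto simp: QS.carrier_ZE nz_Q_iff intro!: rep(1))

lemma bdry_diff: "bdry (x - y) = bdry x - bdry y"
  by (simp add: induced_map_def frag_extend_diff)

lemma bdry_add: "bdry (x + y) = bdry x + bdry y"
  by (simp add: induced_map_def frag_extend_add)

lemma bdry_frag_of: "bdry (frag_of u) = the_inv c u"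
  by (simp add: induced_map_def)

lemma bdry_0 [simp]: "bdry 0 = 0"
  by (simp add: induced_map_def)

lemma bdry_cmul: "bdry (frag_cmul n x) = frag_cmul n (bdry x)"
  by (simp add: induced_map_def frag_extend_cmul)

lemma bdry_basis_elt: "bdry (basis_elt Q v) = the_inv c v"
  by (simp add: basis_elt_def Q_simps(3) bdry_frag_of)

lemma chr_bdry:
  assumes "x \<in> carrier (ZE Q)" "d \<in> nz P"
  shows "chr (\<lambda>e. d \<preceq> e) (bdry x) = chr (\<lambda>u. d \<in> pts u) x"
  unfolding induced_map_def
  by (rule chr_frag_extend) (use assms rep(3) in \<open>auto simp: QS.carrier_ZE nz_Q_iff subset_iff\<close>)

lemma bdry_zmult:
  assumes "x \<in> carrier (ZE Q)" "y \<in> carrier (ZE Q)"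
  shows "bdry (zmult Q x y) = zmult P (bdry x) (bdry y)"
  unfolding induced_map_def
  by (rule QS.frag_extend_zmult[OF assms])
    (simp_all add: Q_simps(2,3) zmult_diff_left zmult_diff_right)

lemma bdry_zact:
  assumes g: "g \<in> carrier \<Gamma>" and x: "x \<in> carrier (ZE Q)"
  shows "bdry (zact Q g x) = zact P g (bdry x)"
proof (rule ZE_eqI)
  show "bdry (zact Q g x) \<in> carrier (ZE P)" "zact P g (bdry x) \<in> carrier (ZE P)"
    using g x by (simp_all add: bdry_closed zact_closed QC.zact_closed)
  fix d assume d: "d \<in> nz P"
  then have d': "sl_act P (inv\<^bsub>\<Gamma>\<^esub> g) d \<in> nz P" using g by simp
  have "chr (\<lambda>e. d \<preceq> e) (bdry (zact Q g x)) = chr (\<lambda>u. d \<in> pts u) (zact Q g x)"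
    by (rule chr_bdry[OF QC.zact_closed[OF g x] d])
  also have "\<dots> = chr (\<lambda>u. sl_act P (inv\<^bsub>\<Gamma>\<^esub> g) d \<in> pts u) x"
    unfolding QC.zact_eq[OF x]
    by (rule chr_frag_extend)
      (use x d g in \<open>auto simp: QS.carrier_ZE nz_Q_iff subset_iff act_Q(2)\<close>)
  also have "\<dots> = chr (\<lambda>e. d \<preceq> e) (zact P g (bdry x))"
    using chr_zact[OF g bdry_closed[OF x] d] chr_bdry[OF x d'] by simp
  finally show "chr (\<lambda>e. d \<preceq> e) (bdry (zact Q g x)) = chr (\<lambda>e. d \<preceq> e) (zact P g (bdry x))" .
qed

lemma equivariant_alg_hom_bdry: "equivariant_alg_hom \<Gamma> Q P bdry"
  unfolding equivariant_alg_hom_def equivariant_hom_def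
proof (intro conjI ballI)
  show "bdry \<in> hom (ZE Q) (ZE P)"
    by (rule homI) (simp_all add: bdry_closed bdry_add ZE_mult QC.ZE_mult)
qed (simp_all add: gamma_module_ZE QC.gamma_module_ZE bdry_zact bdry_zmult)

theorem image_bdry: "bdry ` carrier (ZE Q) = rel_ideal P"
proof
  show "bdry ` carrier (ZE Q) \<subseteq> rel_ideal P"
  proof (rule image_subsetI)
    fix x assume x: "x \<in> carrier (ZE Q)"
    show "bdry x \<in> rel_ideal P"
      unfolding induced_map_def
    proof (rule zideal_frag_extend[OF zideal_rel])
      fix u assume "u \<in> Poly_Mapping.keys x"
      then have "u \<in> nz Q" using x by (auto simp: QS.carrier_ZE)
      then obtain e S where e: "admissible P e S" "u = pt e S" by (rule nz_Q_cases)
      note a = admissible_props[OF e(1)]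
      have "cov_diff P e S \<in> rel_ideal P"
        unfolding cov_diff_def
        by (rule zmults.nprod_mem[OF a(3,4)])
          (use rel_ideal_gen[OF a(1) a(5)] rel_ideal_sub zideal_rel in \<open>auto simp: zideal_iff subset_iff\<close>)
      then show "the_inv c u \<in> rel_ideal P" using e(2) by (simp add: pt_def)
    qed
  qed
  show "rel_ideal P \<subseteq> bdry ` carrier (ZE Q)"
  proof (rule rel_ideal_least)
    have diff: "a - b \<in> bdry ` carrier (ZE Q)" if "a \<in> bdry ` carrier (ZE Q)" "b \<in> bdry ` carrier (ZE Q)" for a b
      using that by (auto simp flip: bdry_diff intro!: imageI QS.ZE_diff)
    have zero: "0 \<in> bdry ` carrier (ZE Q)" by (rule image_eqI[of _ _ 0]) simp_all
    \<comment> \<open>By (i), \<open>d e(S)\<close> again belongs to the derived semilattice. If it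
      vanishes, \<open>basis_elt\<close> supplies 0, so both cases are treated at once.\<close>
    have 1: "zmult P (frag_of d) (the_inv c u) \<in> bdry ` carrier (ZE Q)" if d: "d \<in> nz P" and "u \<in> nz Q" for d u
    proof -
      obtain e S where e: "admissible P e S" "u = pt e S" using \<open>u \<in> nz Q\<close> by (rule nz_Q_cases)
      have "zmult P (frag_of d) (the_inv c u) = bdry (basis_elt Q (low d e S))"
        using e(2) by (simp add: bdry_basis_elt low_def pt_def)
      then show ?thesis using QS.basis_elt_closed[OF low_Q(1)[OF d e(1)]] by blast
    qed
    have 2: "zmult P (frag_of d) (bdry y) \<in> bdry ` carrier (ZE Q)" if d: "d \<in> nz P" and "y \<in> carrier (ZE Q)" for d y
      using that(2)[unfolded QS.carrier_ZE]
      by (induction y rule: frag_induction)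
        (auto simp: zero bdry_frag_of bdry_diff zmult_diff_right intro: 1[OF d] diff)
    have 3: "zmult P x (bdry y) \<in> bdry ` carrier (ZE Q)" if "x \<in> carrier (ZE P)" and "y \<in> carrier (ZE Q)" for x y
      using that(1)[unfolded carrier_ZE]
      by (induction x rule: frag_induction) (auto simp: zero zmult_diff_left intro: 2 that(2) diff)
    show "zideal P (bdry ` carrier (ZE Q))"
      unfolding zideal_iff
    proof (intro conjI ballI)
      show "bdry ` carrier (ZE Q) \<subseteq> carrier (ZE P)" using bdry_closed by auto
    qed (use zero diff 3 in auto)
    fix e R assume e: "e \<in> nz P" "R \<in> covers P e"
    \<comment> \<open>A single cover gives back the generator \<open>e - \<Or>R\<close>.\<close>
    have adm: "admissible P e {R}" using e by (simp add: admissible_def)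
    have "bdry (frag_of (pt e {R})) = frag_of e - bigvee P R"
      using zmults.nprod_singleton[where f = "\<lambda>R. frag_of e - bigvee P R" and j = R, OF cover_diff_factor_closed[OF e]]
      by (simp add: bdry_frag_of pt_def cov_diff_def)
    then show "frag_of e - bigvee P R \<in> bdry ` carrier (ZE Q)"
      using pt_nz[OF adm] by (metis QS.ZE_frag_of image_eqI)
  qed
qed

section \<open>The kernel of the boundary map\<close>

lemma character_pts: "QS.character (\<lambda>u. d \<in> pts u)"
  unfolding QS.character_def using mult_Q(2) by (simp add: Q_simps(3))

text \<open>The kernel is an ideal since the boundary is multiplicative. A generator is killed
  because an element of \<open>Q\<close> and the join of any of its covers have the same value at
  every base point.\<close>

lemma rel_ideal_sub_kernel: "rel_ideal Q \<subseteq> {x \<in> carrier (ZE Q). bdry x = 0}"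
proof (rule QS.rel_ideal_least)
  show "zideal Q {x \<in> carrier (ZE Q). bdry x = 0}"
    by (auto simp: QS.zideal_iff bdry_diff bdry_zmult intro: QS.ZE_diff QS.zmult_closed)
  fix u R' assume u: "u \<in> nz Q" and R': "R' \<in> covers Q u"
  obtain e S where e: "admissible P e S" "u = pt e S" using u by (rule nz_Q_cases)
  obtain R where R: "R \<in> covers P e" "R' = dcov e S R" using R' covers_Q[OF e(1)] e(2) by auto
  have cl: "frag_of u - bigvee Q R' \<in> carrier (ZE Q)" by (rule QC.cover_diff_factor_closed[OF u R'])
  have "bdry (frag_of u - bigvee Q R') = 0"
  proof (rule ZE_eq_0I[OF bdry_closed[OF cl]])
    fix d assume d: "d \<in> nz P"
    show "chr (\<lambda>e. d \<preceq> e) (bdry (frag_of u - bigvee Q R')) = 0"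
      unfolding chr_bdry[OF cl d] chr_diff QS.chr_bigvee[OF character_pts QC.cover_props(1,2)[OF u R']]
      using pts_dcov[OF e(1) R(1)] e pts_pt[OF e(1)] R(2) by simp
  qed
  then show "frag_of u - bigvee Q R' \<in> {x \<in> carrier (ZE Q). bdry x = 0}" using cl by simp
qed

text \<open>\<open>F\<close> confines the members of covers and stays fixed; \<open>D\<close>
  confines the elements \<open>e\<close> and loses a maximal element at each step of the
  induction.\<close>

definition supported :: "'a set \<Rightarrow> 'a set \<Rightarrow> ('b \<Rightarrow>\<^sub>0 int) \<Rightarrow> bool" where
  "supported F D x \<longleftrightarrow> Poly_Mapping.keys x \<subseteq> {pt e S | e S. admissible P e S \<and> e \<in> D \<and> \<Union>S \<subseteq> F}"

lemma supported_0 [simp]: "supported F D 0"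
  by (simp add: supported_def)

lemma supported_diff: "supported F D x \<Longrightarrow> supported F D y \<Longrightarrow> supported F D (x - y)"
  unfolding supported_def using keys_diff[of x y] by blast

lemma supported_add: "supported F D x \<Longrightarrow> supported F D y \<Longrightarrow> supported F D (x + y)"
  unfolding supported_def using keys_add[of x y] by blast

lemma supported_ZE: "supported F D x \<Longrightarrow> x \<in> carrier (ZE Q)"
  unfolding supported_def QS.carrier_ZE using pt_nz by blast

lemma rel_ideal_Q_diff: "x \<in> rel_ideal Q \<Longrightarrow> y \<in> rel_ideal Q \<Longrightarrow> x - y \<in> rel_ideal Q"
  using QC.zideal_rel by (simp add: QS.zideal_iff)

lemma rel_ideal_Q_0: "0 \<in> rel_ideal Q"
  using QC.zideal_rel by (simp add: QS.zideal_iff)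

lemma rel_ideal_Q_add: "x \<in> rel_ideal Q \<Longrightarrow> y \<in> rel_ideal Q \<Longrightarrow> x + y \<in> rel_ideal Q"
  using rel_ideal_Q_diff[OF _ rel_ideal_Q_diff[OF rel_ideal_Q_0], of x y] by simp

text \<open>For \<open>R\<close> outside \<open>S\<close>, the derived cover given by
  \<open>R\<close> is a relation of the next ideal that trades \<open>e(S)\<close> for
  \<open>e(S \<union> {R})\<close> plus multiples of elements \<open>h e(S)\<close>, with
  \<open>h\<close> in the support of \<open>\<Or>R\<close>.\<close>

lemma reduce_insert:
  assumes F: "subsemilattice F" and D: "D \<subseteq> F" "\<forall>a\<in>D. \<forall>b\<in>F. b \<preceq> a \<longrightarrow> b \<in> D"
    and e: "e \<in> D" and adm: "admissible P e S" and S: "\<Union>S \<subseteq> F" and R: "R \<in> covers P e" "R \<subseteq> F"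
  shows "\<exists>y. supported F (D - {e}) y \<and> frag_of (pt e S) - frag_of (pt e (insert R S)) - y \<in> rel_ideal Q"
proof (cases "R \<in> S")
  case True
  then have "insert R S = S" by auto
  then show ?thesis using rel_ideal_Q_0 by (intro exI[of _ 0]) simp
next
  case False
  note a = admissible_props[OF adm]
  note cR = cover_props[OF a(1) R(1)]
  let ?y = "frag_extend (\<lambda>h. basis_elt Q (low h e S)) (bigvee P R)"
  have "dcov e S R \<in> covers Q (pt e S)" using covers_Q[OF adm] R(1) False by blast
  then have "frag_of (pt e S) - bigvee Q (dcov e S R) \<in> rel_ideal Q"
    by (rule QS.rel_ideal_gen[OF pt_nz[OF adm]])
  then have "frag_of (pt e S) - frag_of (pt e (insert R S)) - ?y \<in> rel_ideal Q"
    unfolding bigvee_dcov[OF adm R(1)] by (simp add: algebra_simps)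
  moreover have "supported F (D - {e}) ?y"
    unfolding supported_def
  proof
    fix v assume v: "v \<in> Poly_Mapping.keys ?y"
    obtain h where h: "h \<in> Poly_Mapping.keys (bigvee P R)" "v \<in> Poly_Mapping.keys (basis_elt Q (low h e S))"
      using subsetD[OF keys_frag_extend v] by (rule UN_E)
    then have vl: "v = low h e S" and v0: "low h e S \<noteq> c 0"
      by (auto simp: basis_elt_def Q_simps(3) split: if_splits)
    note hN = cover_key_props[OF a(1) R(1) h(1)]
    note l = low_Q[OF hN(1) adm]
    \<comment> \<open>Elements of the support of the join are products of members of
      \<open>R\<close>, which is why \<open>F\<close> has to be closed under products.\<close>
    have hF: "h \<in> F"
      using keys_bigvee[OF cR(1,2) R(2)] F h(1) by (auto simp: subsemilattice_def)
    have hD: "h \<in> D - {e}"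
      using D(2) e hF hN(2) cover_key_strict[OF a(1) R(1) h(1)] a(2) by auto
    have he: "h \<^bold>\<cdot> e = h" using hN(2) by (simp add: sl_le_def)
    obtain x where x: "x \<in> slice e S" "x \<preceq> h" using v0 pts_empty_iff[OF l(1)] l(2) by auto
    note sr = slice_restrict[OF hN(1) adm x, unfolded he]
    \<comment> \<open>The correction term is a basis element over \<open>h\<close>, strictly below
      \<open>e\<close>, presented by restricted covers that still consist of elements of
      \<open>F\<close>.\<close>
    have "v = pt h (restricted_cover P h ` S)"
      unfolding vl by (rule pts_inject) (use l sr in \<open>simp_all add: pts_pt\<close>)
    moreover have "\<Union>(restricted_cover P h ` S) \<subseteq> F"
      using S F hF by (auto simp: restricted_cover_def subsemilattice_def)
    ultimately show "v \<in> {pt e' S |e' S. admissible P e' S \<and> e' \<in> D - {e} \<and> \<Union>S \<subseteq> F}"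
      using sr(1) hD by blast
  qed
  ultimately show ?thesis by blast
qed

lemma reduce_union:
  assumes F: "subsemilattice F" and D: "D \<subseteq> F" "\<forall>a\<in>D. \<forall>b\<in>F. b \<preceq> a \<longrightarrow> b \<in> D"
    and e: "e \<in> D" and adm: "admissible P e S" and S: "\<Union>S \<subseteq> F"
    and T: "finite T" "T \<subseteq> covers P e" "\<Union>T \<subseteq> F"
  shows "\<exists>y. supported F (D - {e}) y \<and> frag_of (pt e S) - frag_of (pt e (T \<union> S)) - y \<in> rel_ideal Q"
  using T
proof (induction rule: finite_induct)
  case empty
  then show ?case using rel_ideal_Q_0 by (intro exI[of _ 0]) simp
next
  case (insert R T)
  then obtain y where y: "supported F (D - {e}) y"
      "frag_of (pt e S) - frag_of (pt e (T \<union> S)) - y \<in> rel_ideal Q"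
    by auto
  have adm': "admissible P e (T \<union> S)" using adm insert by (auto simp: admissible_def)
  have TS: "\<Union>(T \<union> S) \<subseteq> F" "R \<in> covers P e" "R \<subseteq> F" using insert.prems S by auto
  obtain z where z: "supported F (D - {e}) z"
      "frag_of (pt e (T \<union> S)) - frag_of (pt e (insert R (T \<union> S))) - z \<in> rel_ideal Q"
    using reduce_insert[OF F D e adm' TS] by blast
  have "(frag_of (pt e S) - frag_of (pt e (T \<union> S)) - y) +
      (frag_of (pt e (T \<union> S)) - frag_of (pt e (insert R (T \<union> S))) - z) \<in> rel_ideal Q"
    by (rule rel_ideal_Q_add[OF y(2) z(2)])
  also have "(frag_of (pt e S) - frag_of (pt e (T \<union> S)) - y) +
      (frag_of (pt e (T \<union> S)) - frag_of (pt e (insert R (T \<union> S))) - z) =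
      frag_of (pt e S) - frag_of (pt e (insert R T \<union> S)) - (y + z)"
    by (simp add: algebra_simps)
  finally show ?case using supported_add[OF y(1) z(1)] by blast
qed

text \<open>Every \<open>S\<close> that occurs over \<open>e\<close> is contained in
  \<open>M\<close>, so \<open>reduce_union\<close> pushes all basis elements over \<open>e\<close>
  to the same representative.\<close>

lemma reduce_supported:
  assumes F: "subsemilattice F" and D: "D \<subseteq> F" "\<forall>a\<in>D. \<forall>b\<in>F. b \<preceq> a \<longrightarrow> b \<in> D"
    and e: "e \<in> D" and M: "M = {R \<in> covers P e. R \<subseteq> F}" and x: "supported F D x"
  shows "\<exists>n y. supported F (D - {e}) y \<and> x - frag_cmul n (frag_of (pt e M)) - y \<in> rel_ideal Q"
proof -
  let ?m = "frag_of (pt e M)"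
  have finM: "finite M" using F unfolding M subsemilattice_def by (auto intro: finite_subset[of _ "Pow F"])
  show ?thesis
    using x[unfolded supported_def]
  proof (induction x rule: frag_induction)
    case zero
    show ?case using rel_ideal_Q_0 by (intro exI[of _ 0]) simp
  next
    case (one u)
    then obtain e' S where u: "admissible P e' S" "u = pt e' S" "e' \<in> D" "\<Union>S \<subseteq> F" by auto
    show ?case
    proof (cases "e' = e")
      case False
      then have "supported F (D - {e}) (frag_of u)" unfolding supported_def using u by auto
      then show ?thesis using rel_ideal_Q_0 by (intro exI[of _ 0] exI[of _ "frag_of u"]) simp
    next
      case True
      then have "M \<union> S = M" using u by (auto simp: M admissible_def)
      moreover have "M \<subseteq> covers P e" "\<Union>M \<subseteq> F" by (auto simp: M)
      ultimately obtain y where "supported F (D - {e}) y" "frag_of (pt e S) - ?m - y \<in> rel_ideal Q"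
        using reduce_union[OF F D e _ u(4) finM] u(1) True by auto
      then show ?thesis using u(2) True by (intro exI[of _ 1] exI[of _ y]) simp
    qed
  next
    case (diff a b)
    then obtain n y k z where nk: "supported F (D - {e}) y" "a - frag_cmul n ?m - y \<in> rel_ideal Q"
      "supported F (D - {e}) z" "b - frag_cmul k ?m - z \<in> rel_ideal Q" by blast
    have "a - b - frag_cmul (n - k) ?m - (y - z) = (a - frag_cmul n ?m - y) - (b - frag_cmul k ?m - z)"
      by (simp add: frag_cmul_diff_distrib algebra_simps)
    then have "a - b - frag_cmul (n - k) ?m - (y - z) \<in> rel_ideal Q"
      using rel_ideal_Q_diff[OF nk(2,4)] by (simp only:)
    then show ?case using supported_diff[OF nk(1,3)] by blast
  qed
qed

text \<open>The reduction leaves one multiple \<open>n\<close> of \<open>e(M)\<close> and a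
  remainder over \<open>D - {e}\<close>. The value of the boundary at \<open>e\<close> forces
  \<open>n = 0\<close>, and the remainder falls to the induction hypothesis.\<close>

lemma kernel_supported:
  assumes F: "subsemilattice F" and "D \<subseteq> F" "\<forall>a\<in>D. \<forall>b\<in>F. b \<preceq> a \<longrightarrow> b \<in> D"
    and "supported F D x" "bdry x = 0"
  shows "x \<in> rel_ideal Q"
  using assms(2-)
proof (induction "card D" arbitrary: D x rule: less_induct)
  case (less D)
  have finD: "finite D" using less.prems(1) F by (auto simp: subsemilattice_def intro: finite_subset)
  have FC: "F \<subseteq> carrier P" using F by (simp add: subsemilattice_def)
  show ?case
  proof (cases "D = {}")
    case True
    then have "x = 0" using less.prems(3) by (simp add: supported_def)
    then show ?thesis using rel_ideal_Q_0 by simp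
  next
    case False
    then obtain e where e: "e \<in> D" "\<And>d. d \<in> D \<Longrightarrow> e \<preceq> d \<Longrightarrow> d = e"
      using ex_maximal[OF finD] less.prems(1) FC by blast
    have IH: "y \<in> rel_ideal Q" if "supported F (D - {e}) y" "bdry y = 0" for y
    proof (rule less.hyps[OF _ _ _ that])
      show "card (D - {e}) < card D" using finD e(1) by (intro psubset_card_mono) auto
      show "D - {e} \<subseteq> F" using less.prems(1) by auto
      \<comment> \<open>Removing \<open>e\<close> keeps \<open>D\<close> closed downwards in
        \<open>F\<close> because \<open>e\<close> is maximal.\<close>
      show "\<forall>a\<in>D - {e}. \<forall>b\<in>F. b \<preceq> a \<longrightarrow> b \<in> D - {e}" using less.prems(2) e(2) by auto
    qed
    define M where "M = {R \<in> covers P e. R \<subseteq> F}"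
    have finM: "finite M" using F unfolding M_def subsemilattice_def by (auto intro: finite_subset[of _ "Pow F"])
    show ?thesis
    proof (cases "admissible P e M")
      case False
      \<comment> \<open>Here \<open>e\<close> is zero or \<open>M\<close> is empty, so no basis
        element over \<open>e\<close> occurs in \<open>x\<close> and \<open>e\<close> may simply be
        dropped from \<open>D\<close>.\<close>
      have "\<not> admissible P e S" if "\<Union>S \<subseteq> F" for S
      proof
        assume S: "admissible P e S"
        then have "S \<subseteq> M" using that by (auto simp: M_def admissible_def)
        then show False using False S finM by (auto simp: admissible_def M_def)
      qed
      then have "{pt e' S | e' S. admissible P e' S \<and> e' \<in> D \<and> \<Union>S \<subseteq> F} \<subseteq>
          {pt e' S | e' S. admissible P e' S \<and> e' \<in> D - {e} \<and> \<Union>S \<subseteq> F}"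
        by blast
      then have "supported F (D - {e}) x"
        using less.prems(3) unfolding supported_def by (rule order_trans[rotated])
      then show ?thesis using IH less.prems(4) by blast
    next
      case True
      note a = admissible_props[OF True]
      let ?m = "frag_of (pt e M)"
      obtain n y where y: "supported F (D - {e}) y" "x - frag_cmul n ?m - y \<in> rel_ideal Q"
        using reduce_supported[OF F less.prems(1,2) e(1) M_def less.prems(3)] by blast
      have "bdry (x - frag_cmul n ?m - y) = 0" using y(2) rel_ideal_sub_kernel by auto
      then have "bdry x - (frag_cmul n (bdry ?m) + bdry y) = 0"
        by (simp only: bdry_diff bdry_add bdry_cmul diff_diff_eq)
      then have by': "frag_cmul n (bdry ?m) + bdry y = 0"
        by (simp only: less.prems(4) diff_0 neg_equal_0_iff_equal)
      \<comment> \<open>All points of an element over \<open>e'\<close> lie below \<open>e'\<close>,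
        and by maximality \<open>e\<close> is below no other element of \<open>D\<close>. Evaluation
        at \<open>e\<close> therefore sees nothing of \<open>y\<close>.\<close>
      have "chr (\<lambda>u. e \<in> pts u) y = chr (\<lambda>_. False) y"
      proof (rule chr_cong)
        fix u assume "u \<in> Poly_Mapping.keys y"
        then obtain e' S where u: "admissible P e' S" "u = pt e' S" "e' \<in> D" "e' \<noteq> e"
          using y(1) by (auto simp: supported_def)
        have "\<not> e \<preceq> e'" using e(2)[OF u(3)] u(4) by auto
        then show "(e \<in> pts u) = False" using u pts_pt[OF u(1)] by (auto simp: slice_def)
      qed
      then have "chr (\<lambda>f. e \<preceq> f) (bdry y) = 0"
        using chr_bdry[OF supported_ZE[OF y(1)] a(1)] by simp
      moreover have "chr (\<lambda>f. e \<preceq> f) (bdry ?m) = 1"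
        using chr_bdry[OF _ a(1), of ?m] pt_nz[OF True] pts_pt[OF True] slice_top[OF True] by simp
      moreover have "chr (\<lambda>f. e \<preceq> f) (frag_cmul n (bdry ?m) + bdry y) = 0" unfolding by' by simp
      ultimately have n: "n = 0" by simp
      then have "bdry y = 0" using by' by simp
      then have "y \<in> rel_ideal Q" using IH y(1) by blast
      from rel_ideal_Q_add[OF y(2) this] show ?thesis using n by simp
    qed
  qed
qed

theorem kernel_bdry: "kernel (ZE Q) (ZE P) bdry = rel_ideal Q"
proof -
  have "x \<in> rel_ideal Q" if x: "x \<in> carrier (ZE Q)" "bdry x = 0" for x
  proof -
    have "\<forall>u\<in>Poly_Mapping.keys x. \<exists>e S. admissible P e S \<and> u = pt e S"
      using x(1) nz_Q_cases unfolding QS.carrier_ZE by (metis subsetD)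
    then obtain e S where eS: "\<And>u. u \<in> Poly_Mapping.keys x \<Longrightarrow> admissible P (e u) (S u)"
        "\<And>u. u \<in> Poly_Mapping.keys x \<Longrightarrow> u = pt (e u) (S u)"
      by metis
    \<comment> \<open>One presentation is chosen for each of the finitely many basis elements;
      \<open>F\<close> must contain the elements \<open>e\<close> and all members of the covers
      used. The induction starts with \<open>D = F\<close>.\<close>
    let ?G = "\<Union>u\<in>Poly_Mapping.keys x. insert (e u) (\<Union>(S u))"
    have "finite (insert (e u) (\<Union>(S u)))" "insert (e u) (\<Union>(S u)) \<subseteq> carrier P"
      if "u \<in> Poly_Mapping.keys x" for u
      using admissible_props[OF eS(1)[OF that]] cover_props(1,4) by auto
    then have "finite ?G" "?G \<subseteq> carrier P" by auto
    then obtain F where F: "subsemilattice F" "?G \<subseteq> F" using ex_subsemilattice by blast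
    have "supported F F x"
      unfolding supported_def
    proof
      fix u assume u: "u \<in> Poly_Mapping.keys x"
      then have "e u \<in> F" "\<Union>(S u) \<subseteq> F" using F(2) by auto
      then show "u \<in> {pt e S |e S. admissible P e S \<and> e \<in> F \<and> \<Union>S \<subseteq> F}"
        using eS[OF u] by blast
    qed
    then show ?thesis using kernel_supported[OF F(1), of F x] x(2) by auto
  qed
  then show ?thesis
    using rel_ideal_sub_kernel by (auto simp: kernel_def ZE_one)
qed

end

section \<open>The long exact sequence\<close>

theorem theorem4p11:
  fixes \<Gamma> :: "('g, 'm) monoid_scheme"
    and P :: "('a, 'g) cov_semilattice"
  assumes "group \<Gamma>"
    and "gamma_semilattice \<Gamma> P"
    and "collection_of_finite_covers P"
    and "cond_i P" and "cond_ii P" and "cond_iii \<Gamma> P"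
  shows "(\<forall>k. equivariant_alg_hom \<Gamma> (tower P (Suc k)) (tower P k) (induced_map encode)) \<and>
    equivariant_alg_hom \<Gamma> (tower P 0) P (induced_map Lvl1) \<and>
    equivariant_hom \<Gamma> (ZE P) (zact P) (zquot P) (quot_act P) (zproj P) \<and>
    (\<forall>k. exact_at (ZE (tower P (Suc (Suc k)))) (induced_map encode)
                  (ZE (tower P (Suc k))) (induced_map encode) (ZE (tower P k))) \<and>
    exact_at (ZE (tower P (Suc 0))) (induced_map encode) (ZE (tower P 0)) (induced_map Lvl1) (ZE P) \<and>
    exact_at (ZE (tower P 0)) (induced_map Lvl1) (ZE P) (zproj P) (zquot P) \<and>
    zproj P ` carrier (ZE P) = carrier (zquot P)"
proof -
  interpret P: cover_pair \<Gamma> P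
    by (intro cover_pair.intro semilattice_record.intro cover_pair_axioms.intro)
      (use assms in \<open>simp_all add: gamma_semilattice_def\<close>)
  interpret D: derivation \<Gamma> P Lvl1
    by unfold_locales (rule inj_Lvl1)
  have tower: "cover_pair \<Gamma> (tower P k)" for k
  proof (induction k)
    case 0
    then show ?case using D.cover_pair_Q by simp
  next
    case (Suc k)
    then have "derivation \<Gamma> (tower P k) encode"
      by (intro derivation.intro derivation_axioms.intro inj_encode)
    then show ?case using derivation.cover_pair_Q by fastforce
  qed
  have step: "derivation \<Gamma> (tower P k) encode" for k
    by (intro derivation.intro derivation_axioms.intro inj_encode tower)
  have hom: "equivariant_alg_hom \<Gamma> (tower P (Suc k)) (tower P k) (induced_map encode)" for k
    using derivation.equivariant_alg_hom_bdry[OF step] by simp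
  \<comment> \<open>Image and kernel at each term are both written as the ideal of that stage, so
    exactness is an equality of identical sets.\<close>
  have image: "induced_map encode ` carrier (ZE (tower P (Suc k))) = rel_ideal (tower P k)" for k
    using derivation.image_bdry[OF step] by simp
  have ker: "kernel (ZE (tower P (Suc k))) (ZE (tower P k)) (induced_map encode) = rel_ideal (tower P (Suc k))" for k
    using derivation.kernel_bdry[OF step] by simp
  have hom0: "equivariant_alg_hom \<Gamma> (tower P 0) P (induced_map Lvl1)"
    and image0: "induced_map Lvl1 ` carrier (ZE (tower P 0)) = rel_ideal P"
    and ker0: "kernel (ZE (tower P 0)) (ZE P) (induced_map Lvl1) = rel_ideal (tower P 0)"
    using D.equivariant_alg_hom_bdry D.image_bdry D.kernel_bdry by simp_all
  show ?thesis
    unfolding exact_at_def image ker image0 ker0 P.kernel_zproj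
    using hom hom0 P.equivariant_hom_zproj P.carrier_zquot by simp
qed

end
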